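(* Let $\tau>0$ and, for $i=1,2$, let $U_i=(u_i,v_i)\in W^{1,2}_{loc}([0,\infty);H)$ be a solution of $$\frac{dU_i}{dt}(t)\in-\partial_\tau E(U_i(t))\ \text{ in } H\ \text{ for a.e. } t>0,\qquad U_i(0)=U_{i0}=(u_{i0},v_{i0})\in H .$$ If $U_{10}\le U_{20}$, then $U_1(t)\le U_2(t)$ for all $t>0$, i.e. $u_1(t)\le u_2(t)$ and $v_1(t)\le v_2(t)$ for all $t>0$.
   Context: $\Omega\subset\mathbb{R}^N$, $N\ge1$, is a bounded domain with $C^1$ boundary (when $N>1$; a bounded interval when $N=1$), and $\Gamma\subset\partial\Omega$ (possibly $\Gamma=\partial\Omega$) has positive $\mathcal{H}^{N-1}$-measure. $H=L^2(\Omega)\times L^2(\Gamma)$, and $\gamma:BV(\Omega)\to L^1(\partial\Omega)$ is the trace operator. The functional $E:H\to[0,\infty]$ is $$E(u,v)=\int_\Omega|Du|+\int_\Gamma|\gamma u-v|\,d\mathcal{H}^{N-1}\ \text{ if } (u,v)\in BV(\Omega)\times L^2(\Gamma),\qquad E(u,v)=+\infty\ \text{ otherwise.}$$ $\partial_\tau E$ is the subdifferential of $E$ with respect to the inner product $((f_1,f_2),(g_1,g_2))_\tau=\int_\Omega f_1g_1\,dx+\tau\int_\Gamma f_2g_2\,d\mathcal{H}^{N-1}$ on $H$. The order on $H$: $(f_1,f_2)\le(g_1,g_2)$ means $f_1\le g_1$ a.e. in $\Omega$ and $f_2\le g_2$ $\mathcal{H}^{N-1}$-a.e. on $\Gamma$.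 *)

theory Defs
  imports "HOL-Analysis.Analysis" "HOL-Library.Function_Algebras"
begin

section \<open>Hausdorff measure\<close>

text \<open>
  Normalised with \<open>unit_ball_vol k\<close>. The covering sets are required to be bounded because
  \<open>diameter\<close> is unspecified on unbounded sets. The empty set is treated separately only for
  \<open>k = 0\<close>, where \<open>(diameter {} / 2) ^ 0 = 1\<close>.
\<close>

definition hausdorff_size :: "nat \<Rightarrow> 'a::euclidean_space set \<Rightarrow> ennreal" where
  "hausdorff_size k C =
     (if C = {} then 0 else ennreal (unit_ball_vol (real k) * (diameter C / 2) ^ k))"

definition hausdorff_covers :: "real \<Rightarrow> 'a::euclidean_space set \<Rightarrow> (nat \<Rightarrow> 'a set) set" where
  "hausdorff_covers \<delta> A =
     {C. A \<subseteq> (\<Union>i. C i) \<and> (\<forall>i. bounded (C i) \<and> diameter (C i) \<le> \<delta>)}"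

definition hausdorff_content :: "nat \<Rightarrow> real \<Rightarrow> 'a::euclidean_space set \<Rightarrow> ennreal" where
  "hausdorff_content k \<delta> A = (INF C\<in>hausdorff_covers \<delta> A. \<Sum>i. hausdorff_size k (C i))"

definition hausdorff_outer :: "nat \<Rightarrow> 'a::euclidean_space set \<Rightarrow> ennreal" where
  "hausdorff_outer k A = (SUP \<delta>\<in>{0<..}. hausdorff_content k \<delta> A)"

text \<open>The measurable sets are all Caratheodory-measurable ones.\<close>

definition hausdorff_measure :: "nat \<Rightarrow> 'a::euclidean_space measure" where
  "hausdorff_measure k =
     measure_of UNIV (lambda_system UNIV UNIV (hausdorff_outer k)) (hausdorff_outer k)"

definition surface_on :: "'a::euclidean_space set \<Rightarrow> 'a measure" where
  "surface_on \<Gamma> = restrict_space (hausdorff_measure (DIM('a) - 1)) \<Gamma>"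

lemma hausdorff_content_mono: "A \<subseteq> B \<Longrightarrow> hausdorff_content k \<delta> A \<le> hausdorff_content k \<delta> B"
  unfolding hausdorff_content_def hausdorff_covers_def by (rule INF_superset_mono) auto

lemma hausdorff_content_subadditive:
  fixes A :: "nat \<Rightarrow> 'a::euclidean_space set"
  shows "hausdorff_content k \<delta> (\<Union>i. A i) \<le> (\<Sum>i. hausdorff_content k \<delta> (A i))"
proof (rule ennreal_le_epsilon)
  fix e :: real
  assume e: "0 < e" and fin: "(\<Sum>i. hausdorff_content k \<delta> (A i)) < top"
  let ?s = "\<lambda>C. \<Sum>i. hausdorff_size k (C i)"
  have "\<exists>C\<in>hausdorff_covers \<delta> (A n). ?s C \<le> hausdorff_content k \<delta> (A n) + ennreal (e * (1/2) ^ Suc n)"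
    for n
  proof -
    have le: "hausdorff_content k \<delta> (A n) \<le> (\<Sum>i. hausdorff_content k \<delta> (A i))"
      using sum_le_suminf[of "\<lambda>i. hausdorff_content k \<delta> (A i)" "{n}"] by simp
    have "hausdorff_content k \<delta> (A n) < top"
      using le fin by (rule le_less_trans)
    moreover have "0 < ennreal (e * (1/2) ^ Suc n)"
      using e by (simp add: ennreal_less_zero_iff)
    ultimately have "hausdorff_content k \<delta> (A n)
        < hausdorff_content k \<delta> (A n) + ennreal (e * (1/2) ^ Suc n)"
      by (simp add: ennreal_add_left_cancel_less[of _ 0, simplified])
    then show ?thesis
      unfolding hausdorff_content_def[of k \<delta> "A n"] INF_less_iff by (blast intro: less_imp_le)
  qed
  then obtain C where C: "\<And>n. C n \<in> hausdorff_covers \<delta> (A n)"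
    and le: "\<And>n. ?s (C n) \<le> hausdorff_content k \<delta> (A n) + ennreal (e * (1/2) ^ Suc n)"
    by metis
  define D where "D = (\<lambda>m. case prod_decode m of (i, j) \<Rightarrow> C i j)"
  have "D \<in> hausdorff_covers \<delta> (\<Union>i. A i)"
    unfolding hausdorff_covers_def
  proof (intro CollectI conjI allI)
    show "(\<Union>i. A i) \<subseteq> (\<Union>m. D m)"
    proof
      fix x assume "x \<in> (\<Union>i. A i)"
      then obtain i where "x \<in> A i" by auto
      then obtain j where "x \<in> C i j"
        using C[of i] by (auto simp: hausdorff_covers_def)
      then have "x \<in> D (prod_encode (i, j))"
        by (simp add: D_def)
      then show "x \<in> (\<Union>m. D m)" by blast
    qed
    show "bounded (D m)" "diameter (D m) \<le> \<delta>" for m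
      using C by (auto simp: D_def hausdorff_covers_def split: prod.split)
  qed
  then have "hausdorff_content k \<delta> (\<Union>i. A i) \<le> ?s D"
    unfolding hausdorff_content_def by (rule INF_lower)
  also have "\<dots> = (\<Sum>i. ?s (C i))"
    using suminf_ennreal_2dimen[of "\<lambda>i. ?s (C i)" "\<lambda>(i, j). hausdorff_size k (C i j)"]
    by (simp add: D_def comp_def case_prod_unfold)
  also have "\<dots> \<le> (\<Sum>n. hausdorff_content k \<delta> (A n) + ennreal (e * (1/2) ^ Suc n))"
    by (intro suminf_le le) auto
  also have "\<dots> = (\<Sum>n. hausdorff_content k \<delta> (A n)) + (\<Sum>n. ennreal (e * (1/2) ^ Suc n))"
    by (intro suminf_add[symmetric]) auto
  also have "(\<Sum>n. ennreal (e * (1/2) ^ Suc n)) = ennreal e"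
    using sums_mult[OF power_half_series, of e] e
    by (intro suminf_ennreal_eq) auto
  finally show "hausdorff_content k \<delta> (\<Union>i. A i) \<le> (\<Sum>n. hausdorff_content k \<delta> (A n)) + ennreal e" .
qed

lemma outer_measure_space_hausdorff:
  "outer_measure_space UNIV (hausdorff_outer k :: 'a::euclidean_space set \<Rightarrow> ennreal)"
  unfolding outer_measure_space_def
proof (intro conjI)
  show "positive UNIV (hausdorff_outer k :: 'a set \<Rightarrow> ennreal)"
  proof -
    have "hausdorff_content k \<delta> ({} :: 'a set) \<le> 0" if "0 < \<delta>" for \<delta>
      unfolding hausdorff_content_def
      by (rule INF_lower2[of "\<lambda>_. {}"])
         (use that in \<open>auto simp: hausdorff_covers_def hausdorff_size_def\<close>)
    then show ?thesis
      unfolding positive_def hausdorff_outer_def by (auto intro!: antisym SUP_least)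
  qed
  show "increasing UNIV (hausdorff_outer k :: 'a set \<Rightarrow> ennreal)"
    unfolding increasing_def hausdorff_outer_def
    by (auto intro!: SUP_mono hausdorff_content_mono)
  show "countably_subadditive UNIV (hausdorff_outer k :: 'a set \<Rightarrow> ennreal)"
    unfolding countably_subadditive_def
  proof (intro allI impI)
    fix A :: "nat \<Rightarrow> 'a set"
    show "hausdorff_outer k (\<Union>i. A i) \<le> (\<Sum>i. hausdorff_outer k (A i))"
      unfolding hausdorff_outer_def[of k "\<Union>i. A i"]
    proof (rule SUP_least)
      fix \<delta> :: real assume d: "\<delta> \<in> {0<..}"
      have "hausdorff_content k \<delta> (\<Union>i. A i) \<le> (\<Sum>i. hausdorff_content k \<delta> (A i))"
        by (rule hausdorff_content_subadditive)
      also have "\<dots> \<le> (\<Sum>i. hausdorff_outer k (A i))"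
        unfolding hausdorff_outer_def by (intro suminf_le SUP_upper d) auto
      finally show "hausdorff_content k \<delta> (\<Union>i. A i) \<le> (\<Sum>i. hausdorff_outer k (A i))" .
    qed
  qed
qed

lemma measure_space_hausdorff:
  "measure_space UNIV (lambda_system UNIV UNIV (hausdorff_outer k))
     (hausdorff_outer k :: 'a::euclidean_space set \<Rightarrow> ennreal)"
proof -
  interpret sigma_algebra UNIV "UNIV :: 'a set set"
    using sigma_algebra_Pow[of UNIV] by simp
  show ?thesis
    by (rule caratheodory_lemma[OF outer_measure_space_hausdorff])
qed

lemma sets_hausdorff_measure:
  "sets (hausdorff_measure k :: 'a::euclidean_space measure)
     = lambda_system UNIV UNIV (hausdorff_outer k)"
  using measure_space_hausdorff[of k, where 'a='a]
  by (auto simp: hausdorff_measure_def measure_space_def sigma_algebra.sigma_sets_eq)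

lemma emeasure_hausdorff_measure:
  "A \<in> sets (hausdorff_measure k) \<Longrightarrow> emeasure (hausdorff_measure k) A = hausdorff_outer k A"
  using measure_space_hausdorff[of k]
  unfolding sets_hausdorff_measure unfolding hausdorff_measure_def
  by (intro emeasure_measure_of_sigma) (auto simp: measure_space_def)


section \<open>Domains with C1 boundary\<close>

definition C1_map :: "('a::euclidean_space \<Rightarrow> 'b::real_normed_vector) \<Rightarrow> bool" where
  "C1_map f \<longleftrightarrow> (\<forall>x. f differentiable (at x)) \<and>
     (\<forall>h. continuous_on UNIV (\<lambda>x. frechet_derivative f (at x) h))"

text \<open>
  Near each boundary point, \<open>\<Omega>\<close> is the region above a C1 graph over the hyperplane
  orthogonal to \<open>e\<close>; \<open>y - (y \<bullet> e) *\<^sub>R e\<close> is the projection of \<open>y\<close> onto that hyperplane.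
\<close>

definition C1_boundary :: "'a::euclidean_space set \<Rightarrow> bool" where
  "C1_boundary \<Omega> \<longleftrightarrow> (\<forall>x\<in>frontier \<Omega>. \<exists>r>0. \<exists>e \<psi>. norm e = 1 \<and> C1_map \<psi> \<and>
     \<Omega> \<inter> ball x r = {y \<in> ball x r. \<psi> (y - (y \<bullet> e) *\<^sub>R e) < y \<bullet> e})"

definition bounded_domain :: "'a::euclidean_space set \<Rightarrow> bool" where
  "bounded_domain \<Omega> \<longleftrightarrow> open \<Omega> \<and> connected \<Omega> \<and> \<Omega> \<noteq> {} \<and> bounded \<Omega>"


section \<open>Functions of bounded variation and their traces\<close>

definition divergence :: "('a::euclidean_space \<Rightarrow> 'a) \<Rightarrow> 'a \<Rightarrow> real" where
  "divergence \<phi> x = (\<Sum>b\<in>Basis. frechet_derivative \<phi> (at x) b \<bullet> b)"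

definition BV_test_fields :: "'a::euclidean_space set \<Rightarrow> ('a \<Rightarrow> 'a) set" where
  "BV_test_fields \<Omega> = {\<phi>. C1_map \<phi> \<and> (\<exists>K. compact K \<and> K \<subseteq> \<Omega> \<and> (\<forall>x. x \<notin> K \<longrightarrow> \<phi> x = 0)) \<and>
     (\<forall>x. norm (\<phi> x) \<le> 1)}"

text \<open>Negative integrals are cut off at 0 by \<open>ennreal\<close>; as \<open>\<phi> = 0\<close> is admissible, this does
  not affect the supremum.\<close>

definition total_variation :: "'a::euclidean_space set \<Rightarrow> ('a \<Rightarrow> real) \<Rightarrow> ennreal" where
  "total_variation \<Omega> u =
     (SUP \<phi>\<in>BV_test_fields \<Omega>. ennreal (\<integral>x. u x * divergence \<phi> x \<partial>lebesgue_on \<Omega>))"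

definition BV :: "'a::euclidean_space set \<Rightarrow> ('a \<Rightarrow> real) set" where
  "BV \<Omega> = {u. integrable (lebesgue_on \<Omega>) u \<and> total_variation \<Omega> u < \<infinity>}"

text \<open>
  The trace of a BV function in the sense of Ambrosio, Fusco and Pallara: \<open>\<gamma> u x\<close> is the
  one-sided approximate limit of \<open>u\<close> at almost every boundary point. This determines the class
  of \<open>\<gamma> u\<close> in \<open>L\<^sup>1(\<partial>\<Omega>)\<close> uniquely.
\<close>

definition BV_trace_operator ::
  "'a::euclidean_space set \<Rightarrow> (('a \<Rightarrow> real) \<Rightarrow> 'a \<Rightarrow> real) \<Rightarrow> bool" where
  "BV_trace_operator \<Omega> \<gamma> \<longleftrightarrow> (\<forall>u\<in>BV \<Omega>.
     integrable (surface_on (frontier \<Omega>)) (\<gamma> u) \<and>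
     (AE x in surface_on (frontier \<Omega>).
        ((\<lambda>r. (\<integral>y. \<bar>u y - \<gamma> u x\<bar> \<partial>lebesgue_on (\<Omega> \<inter> ball x r)) / r ^ DIM('a)) \<longlongrightarrow> 0)
          (at_right 0)))"


section \<open>The Hilbert space \<open>H = L\<^sup>2(\<Omega>) \<times> L\<^sup>2(\<Gamma>)\<close>\<close>

text \<open>
  Elements of \<open>H\<close> are represented by pairs of functions; equality in \<open>H\<close> is \<open>H_eq\<close>.
  Sums and differences of pairs are pointwise.
\<close>

type_synonym 'a state = "('a \<Rightarrow> real) \<times> ('a \<Rightarrow> real)"

definition L2_functions :: "'a measure \<Rightarrow> ('a \<Rightarrow> real) set" where
  "L2_functions M = {f \<in> borel_measurable M. integrable M (\<lambda>x. (f x)\<^sup>2)}"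

definition H_space :: "'a::euclidean_space set \<Rightarrow> 'a set \<Rightarrow> 'a state set" where
  "H_space \<Omega> \<Gamma> = L2_functions (lebesgue_on \<Omega>) \<times> L2_functions (surface_on \<Gamma>)"

definition H_inner ::
  "real \<Rightarrow> 'a::euclidean_space set \<Rightarrow> 'a set \<Rightarrow> 'a state \<Rightarrow> 'a state \<Rightarrow> real" where
  "H_inner \<tau> \<Omega> \<Gamma> X Y =
     (\<integral>x. fst X x * fst Y x \<partial>lebesgue_on \<Omega>) + \<tau> * (\<integral>x. snd X x * snd Y x \<partial>surface_on \<Gamma>)"

definition H_norm :: "'a::euclidean_space set \<Rightarrow> 'a set \<Rightarrow> 'a state \<Rightarrow> real" where
  "H_norm \<Omega> \<Gamma> X = sqrt (H_inner 1 \<Omega> \<Gamma> X X)"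

definition H_scale :: "real \<Rightarrow> 'a state \<Rightarrow> 'a state" where
  "H_scale c X = (\<lambda>x. c * fst X x, \<lambda>x. c * snd X x)"

definition H_eq :: "'a::euclidean_space set \<Rightarrow> 'a set \<Rightarrow> 'a state \<Rightarrow> 'a state \<Rightarrow> bool" where
  "H_eq \<Omega> \<Gamma> X Y \<longleftrightarrow>
     (AE x in lebesgue_on \<Omega>. fst X x = fst Y x) \<and> (AE x in surface_on \<Gamma>. snd X x = snd Y x)"

definition H_le :: "'a::euclidean_space set \<Rightarrow> 'a set \<Rightarrow> 'a state \<Rightarrow> 'a state \<Rightarrow> bool" where
  "H_le \<Omega> \<Gamma> X Y \<longleftrightarrow>
     (AE x in lebesgue_on \<Omega>. fst X x \<le> fst Y x) \<and> (AE x in surface_on \<Gamma>. snd X x \<le> snd Y x)"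


section \<open>Bochner integral and Sobolev functions of time with values in \<open>H\<close>\<close>

text \<open>The library's Bochner integral needs a normed space as a type, whereas \<open>H\<close> is a set
  of representatives depending on \<open>\<Omega>\<close> and \<open>\<Gamma>\<close>.\<close>

definition H_simple ::
  "'a::euclidean_space set \<Rightarrow> 'a set \<Rightarrow> (real \<Rightarrow> 'a state) \<Rightarrow> bool" where
  "H_simple \<Omega> \<Gamma> S \<longleftrightarrow>
     finite (range S) \<and> range S \<subseteq> H_space \<Omega> \<Gamma> \<and> (\<forall>Y. S -` {Y} \<in> sets lebesgue)"

definition H_simple_integral :: "real \<Rightarrow> (real \<Rightarrow> 'a state) \<Rightarrow> 'a state" where
  "H_simple_integral T S = (\<Sum>Y\<in>range S. H_scale (measure lebesgue (S -` {Y} \<inter> {0<..<T})) Y)"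

definition H_strongly_measurable ::
  "'a::euclidean_space set \<Rightarrow> 'a set \<Rightarrow> real \<Rightarrow> (real \<Rightarrow> 'a state) \<Rightarrow> bool" where
  "H_strongly_measurable \<Omega> \<Gamma> T F \<longleftrightarrow>
     (\<forall>t\<in>{0<..<T}. F t \<in> H_space \<Omega> \<Gamma>) \<and>
     (\<exists>S. (\<forall>n::nat. H_simple \<Omega> \<Gamma> (S n)) \<and>
        (AE t in lebesgue_on {0<..<T}. (\<lambda>n. H_norm \<Omega> \<Gamma> (S n t - F t)) \<longlonglongrightarrow> 0))"

definition H_has_integral ::
  "'a::euclidean_space set \<Rightarrow> 'a set \<Rightarrow> real \<Rightarrow> (real \<Rightarrow> 'a state) \<Rightarrow> 'a state \<Rightarrow> bool" where
  "H_has_integral \<Omega> \<Gamma> T F X \<longleftrightarrow>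
     X \<in> H_space \<Omega> \<Gamma> \<and> H_strongly_measurable \<Omega> \<Gamma> T F \<and>
     (\<exists>S. (\<forall>n::nat. H_simple \<Omega> \<Gamma> (S n)) \<and>
        (\<lambda>n. \<integral>\<^sup>+t. ennreal (H_norm \<Omega> \<Gamma> (S n t - F t)) \<partial>lebesgue_on {0<..<T}) \<longlonglongrightarrow> 0 \<and>
        (\<lambda>n. H_norm \<Omega> \<Gamma> (H_simple_integral T (S n) - X)) \<longlonglongrightarrow> 0)"

definition L2_time ::
  "'a::euclidean_space set \<Rightarrow> 'a set \<Rightarrow> real \<Rightarrow> (real \<Rightarrow> 'a state) \<Rightarrow> bool" where
  "L2_time \<Omega> \<Gamma> T F \<longleftrightarrow> H_strongly_measurable \<Omega> \<Gamma> T F \<and>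
     integrable (lebesgue_on {0<..<T}) (\<lambda>t. (H_norm \<Omega> \<Gamma> (F t))\<^sup>2)"

definition weak_time_derivative ::
  "'a::euclidean_space set \<Rightarrow> 'a set \<Rightarrow> real \<Rightarrow> (real \<Rightarrow> 'a state) \<Rightarrow> (real \<Rightarrow> 'a state) \<Rightarrow> bool"
  where
  "weak_time_derivative \<Omega> \<Gamma> T U G \<longleftrightarrow>
     (\<forall>\<phi>. \<phi> C1_differentiable_on UNIV \<and>
        (\<exists>K. compact K \<and> K \<subseteq> {0<..<T} \<and> (\<forall>t. t \<notin> K \<longrightarrow> \<phi> t = 0)) \<longrightarrow>
        (\<exists>X. H_has_integral \<Omega> \<Gamma> T (\<lambda>t. H_scale (deriv \<phi> t) (U t)) X \<and>
             H_has_integral \<Omega> \<Gamma> T (\<lambda>t. H_scale (\<phi> t) (G t)) (- X)))"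

text \<open>
  \<open>U\<close> belongs to the local Sobolev space of order (1,2) on \<open>{0..}\<close> with weak derivative \<open>G\<close>. As usual, \<open>U\<close> stands for its
  continuous representative, which gives a meaning to \<open>U t\<close> for every single \<open>t \<ge> 0\<close>.
\<close>

definition W12_loc_with_derivative ::
  "'a::euclidean_space set \<Rightarrow> 'a set \<Rightarrow> (real \<Rightarrow> 'a state) \<Rightarrow> (real \<Rightarrow> 'a state) \<Rightarrow> bool" where
  "W12_loc_with_derivative \<Omega> \<Gamma> U G \<longleftrightarrow>
     (\<forall>T>0. L2_time \<Omega> \<Gamma> T U \<and> L2_time \<Omega> \<Gamma> T G \<and> weak_time_derivative \<Omega> \<Gamma> T U G) \<and>
     (\<forall>t\<ge>0. U t \<in> H_space \<Omega> \<Gamma> \<and> ((\<lambda>s. H_norm \<Omega> \<Gamma> (U s - U t)) \<longlongrightarrow> 0) (at t within {0..}))"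


section \<open>The energy and its gradient flow\<close>

definition energy ::
  "'a::euclidean_space set \<Rightarrow> 'a set \<Rightarrow> (('a \<Rightarrow> real) \<Rightarrow> 'a \<Rightarrow> real) \<Rightarrow> 'a state \<Rightarrow> ennreal" where
  "energy \<Omega> \<Gamma> \<gamma> U =
     (if fst U \<in> BV \<Omega> \<and> snd U \<in> L2_functions (surface_on \<Gamma>)
      then total_variation \<Omega> (fst U)
             + (\<integral>\<^sup>+x. ennreal \<bar>\<gamma> (fst U) x - snd U x\<bar> \<partial>surface_on \<Gamma>)
      else \<infinity>)"

definition H_subdifferential ::
  "real \<Rightarrow> 'a::euclidean_space set \<Rightarrow> 'a set \<Rightarrow> ('a state \<Rightarrow> ennreal) \<Rightarrow> 'a state \<Rightarrow> 'a state set" where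
  "H_subdifferential \<tau> \<Omega> \<Gamma> E U =
     {\<xi> \<in> H_space \<Omega> \<Gamma>. E U < \<infinity> \<and>
        (\<forall>V\<in>H_space \<Omega> \<Gamma>.
           enn2ereal (E U) + ereal (H_inner \<tau> \<Omega> \<Gamma> \<xi> (V - U)) \<le> enn2ereal (E V))}"

definition gradient_flow_solution ::
  "real \<Rightarrow> 'a::euclidean_space set \<Rightarrow> 'a set \<Rightarrow> ('a state \<Rightarrow> ennreal) \<Rightarrow> 'a state
     \<Rightarrow> (real \<Rightarrow> 'a state) \<Rightarrow> bool" where
  "gradient_flow_solution \<tau> \<Omega> \<Gamma> E U0 U \<longleftrightarrow>
     (\<exists>G. W12_loc_with_derivative \<Omega> \<Gamma> U G \<and>
        (AE t in lebesgue. t > 0 \<longrightarrow> - G t \<in> H_subdifferential \<tau> \<Omega> \<Gamma> E (U t))) \<and>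
     H_eq \<Omega> \<Gamma> (U 0) U0"

end

theory Submission
  imports Defs
begin

text \<open>
  The energy is submodular: \<open>E (U \<and> V) + E (U \<or> V) \<le> E U + E V\<close>. For the total variation this is
  seen by mollifying \<open>u\<close> and \<open>v\<close> and smoothing the minimum and the maximum; as the test fields have
  compact support, only local approximation is involved. For the boundary term it follows from the
  pointwise inequality, since the trace commutes with minimum and maximum. Testing the two
  subdifferential inclusions with \<open>U1 \<and> U2\<close> and \<open>U1 \<or> U2\<close> then gives
  \<open>(U1' - U2', (U1 - U2)\<^sup>+)\<^sub>\<tau> \<le> 0\<close>, so the \<open>\<tau>\<close>-norm of \<open>(U1 - U2)\<^sup>+\<close> does not increase in time.
\<close>

section \<open>Closed sets are Hausdorff measurable\<close>

text \<open>Three obstacles shape the proof. The total variation is a supremum over C1 fields, so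
  the gradient measure of a BV function never appears; the weights of the convex combinations end up
  inside the test fields and must be C1 themselves, which asks for a C2 smoothing of the positive
  part. A mollified function inherits the bound of the original only against fields whose small
  translates stay admissible, so one compact support is fixed before the radius is chosen. Next,
  \<open>BV_trace_operator\<close> determines \<gamma> only through approximate limits; the
  commutation rests on their uniqueness, which follows from a density condition at boundary points.
  Carrying it from the whole frontier to \<Gamma> uses that the frontier is measurable, hence the
  section on closed sets. Finally, \<open>H_space\<close> is a set of representatives with a
  seminorm. Its vector-valued integral is used only through inner products with fixed elements, and
  monotonicity in time is obtained between positive times and extended to time 0 by
  continuity.\<close>

lemma hausdorff_content_antimono: "\<delta> \<le> \<delta>' \<Longrightarrow> hausdorff_content k \<delta>' A \<le> hausdorff_content k \<delta> A"
  unfolding hausdorff_content_def hausdorff_covers_def by (rule INF_superset_mono) (auto intro: order_trans)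

text \<open>A covering set of diameter at most \<delta> < d cannot meet both \<open>A\<close> and
  \<open>B\<close>, so every cover of the union splits into a cover of each.\<close>

lemma hausdorff_content_separated:
  fixes A B :: "'a::euclidean_space set"
  assumes "0 < \<delta>" "\<delta> < d" and sep: "\<And>x y. x \<in> A \<Longrightarrow> y \<in> B \<Longrightarrow> d \<le> dist x y"
  shows "hausdorff_content k \<delta> A + hausdorff_content k \<delta> B \<le> hausdorff_content k \<delta> (A \<union> B)"
  unfolding hausdorff_content_def[of k \<delta> "A \<union> B"]
proof (rule INF_greatest)
  fix C assume C: "C \<in> hausdorff_covers \<delta> (A \<union> B)"
  \<comment> \<open>Covering sets that miss \<open>A\<close> become empty and contribute size 0,
    also for \<open>k = 0\<close>; the indexing of the cover is kept.\<close>
  define CA where "CA i = (if C i \<inter> A = {} then {} else C i)" for i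
  define CB where "CB i = (if C i \<inter> B = {} then {} else C i)" for i
  have CA: "CA \<in> hausdorff_covers \<delta> A" and CB: "CB \<in> hausdorff_covers \<delta> B"
    using C \<open>0 < \<delta>\<close> unfolding hausdorff_covers_def CA_def CB_def by fastforce+
  have disj: "C i \<inter> A = {} \<or> C i \<inter> B = {}" for i
  proof (rule ccontr)
    assume "\<not> ?thesis"
    then obtain x y where xy: "x \<in> C i" "x \<in> A" "y \<in> C i" "y \<in> B" by auto
    have "d \<le> dist x y" using sep xy by auto
    also have "\<dots> \<le> diameter (C i)"
      using C xy by (intro diameter_bounded_bound) (auto simp: hausdorff_covers_def)
    also have "\<dots> \<le> \<delta>" using C by (auto simp: hausdorff_covers_def)
    finally show False using \<open>\<delta> < d\<close> by simp
  qed
  have le: "hausdorff_size k (CA i) + hausdorff_size k (CB i) \<le> hausdorff_size k (C i)" for i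
    using disj[of i] by (auto simp: CA_def CB_def hausdorff_size_def)
  have "hausdorff_content k \<delta> A + hausdorff_content k \<delta> B
      \<le> (\<Sum>i. hausdorff_size k (CA i)) + (\<Sum>i. hausdorff_size k (CB i))"
    unfolding hausdorff_content_def using CA CB by (intro add_mono INF_lower)
  also have "\<dots> = (\<Sum>i. hausdorff_size k (CA i) + hausdorff_size k (CB i))"
    by (intro suminf_add) auto
  also have "\<dots> \<le> (\<Sum>i. hausdorff_size k (C i))"
    by (intro suminf_le le) auto
  finally show "hausdorff_content k \<delta> A + hausdorff_content k \<delta> B \<le> (\<Sum>i. hausdorff_size k (C i))" .
qed

text \<open>The contents grow as \<delta> shrinks, so both suprema can be taken along a common
  \<delta>, which may moreover be lowered below \<open>d\<close>.\<close>

lemma hausdorff_outer_separated: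
  fixes A B :: "'a::euclidean_space set"
  assumes "0 < d" and sep: "\<And>x y. x \<in> A \<Longrightarrow> y \<in> B \<Longrightarrow> d \<le> dist x y"
  shows "hausdorff_outer k A + hausdorff_outer k B \<le> hausdorff_outer k (A \<union> B)"
proof -
  have "hausdorff_outer k A + hausdorff_outer k B
      = (SUP \<delta>\<in>{0<..}. hausdorff_content k \<delta> A + hausdorff_content k \<delta> B)"
    unfolding hausdorff_outer_def
  proof (rule SUP_add_directed_ennreal[symmetric])
    fix i j :: real assume "i \<in> {0<..}" "j \<in> {0<..}"
    then show "\<exists>l\<in>{0<..}. hausdorff_content k i A + hausdorff_content k j B
        \<le> hausdorff_content k l A + hausdorff_content k l B"
      by (intro bexI[of _ "min i j"] add_mono hausdorff_content_antimono) auto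
  qed
  also have "\<dots> \<le> hausdorff_outer k (A \<union> B)"
  proof (rule SUP_least)
    fix \<delta> :: real assume \<delta>: "\<delta> \<in> {0<..}"
    let ?e = "min \<delta> (d / 2)"
    have "hausdorff_content k \<delta> A + hausdorff_content k \<delta> B
        \<le> hausdorff_content k ?e A + hausdorff_content k ?e B"
      by (intro add_mono hausdorff_content_antimono) auto
    also have "\<dots> \<le> hausdorff_content k ?e (A \<union> B)"
      using assms \<delta> by (intro hausdorff_content_separated[of _ d]) auto
    also have "\<dots> \<le> hausdorff_outer k (A \<union> B)"
      unfolding hausdorff_outer_def using assms \<delta> by (intro SUP_upper) auto
    finally show "hausdorff_content k \<delta> A + hausdorff_content k \<delta> B \<le> hausdorff_outer k (A \<union> B)" .
  qed
  finally show ?thesis .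
qed

lemma hausdorff_outer_mono: "A \<subseteq> B \<Longrightarrow> hausdorff_outer k A \<le> hausdorff_outer k B"
  unfolding hausdorff_outer_def by (intro SUP_mono) (auto intro: hausdorff_content_mono)

lemma hausdorff_outer_empty [simp]: "hausdorff_outer k {} = 0"
  using outer_measure_space_hausdorff[of k] by (auto simp: outer_measure_space_def positive_def)

lemma hausdorff_outer_UN_le: "hausdorff_outer k (\<Union>i. A i) \<le> (\<Sum>i. hausdorff_outer k (A i))"
  unfolding hausdorff_outer_def[of k "\<Union>i. A i"]
proof (rule SUP_least)
  fix \<delta> :: real assume \<delta>: "\<delta> \<in> {0<..}"
  have "hausdorff_content k \<delta> (\<Union>i. A i) \<le> (\<Sum>i. hausdorff_content k \<delta> (A i))"
    by (rule hausdorff_content_subadditive)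
  also have "\<dots> \<le> (\<Sum>i. hausdorff_outer k (A i))"
    unfolding hausdorff_outer_def by (intro suminf_le SUP_upper \<delta>) auto
  finally show "hausdorff_content k \<delta> (\<Union>i. A i) \<le> (\<Sum>i. hausdorff_outer k (A i))" .
qed

lemma hausdorff_outer_Un_le: "hausdorff_outer k (A \<union> B) \<le> hausdorff_outer k A + hausdorff_outer k B"
proof -
  have "hausdorff_outer k (A \<union> B) \<le> (\<Sum>i. hausdorff_outer k (binaryset A B i))"
    unfolding UN_binaryset_eq[symmetric] by (rule hausdorff_outer_UN_le)
  also have "\<dots> = hausdorff_outer k A + hausdorff_outer k B"
    by (intro suminf_binaryset_eq) auto
  finally show ?thesis .
qed

text \<open>Caratheodory's criterion: the shells around \<open>F\<close> with indices of equal parity are pairwise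
  separated, so the sum of their outer measures is finite.\<close>

lemma closed_in_sets_hausdorff_measure:
  fixes F :: "'a::euclidean_space set"
  assumes "closed F"
  shows "F \<in> sets (hausdorff_measure k)"
proof (cases "F = {}")
  case False
  let ?\<mu> = "hausdorff_outer k"
  have split: "?\<mu> (A \<inter> F) + ?\<mu> (A - F) \<le> ?\<mu> A" for A
  proof (cases "?\<mu> A = top")
    case fin: False
    define R where "R j = {x \<in> A. 1 / real (j + 2) \<le> infdist x F \<and> infdist x F < 1 / real (j + 1)}" for j
    define B where "B n = {x \<in> A. 1 / real (n + 1) \<le> infdist x F}" for n
    have parity: "(\<Sum>j<m. ?\<mu> (R (2 * j + i))) \<le> ?\<mu> (\<Union>j<m. R (2 * j + i))" for i m
    proof (induction m)
      case (Suc m)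
      have "(\<Sum>j<Suc m. ?\<mu> (R (2 * j + i))) \<le> ?\<mu> (\<Union>j<m. R (2 * j + i)) + ?\<mu> (R (2 * m + i))"
        using Suc by (simp add: add_right_mono)
      also have "\<dots> \<le> ?\<mu> ((\<Union>j<m. R (2 * j + i)) \<union> R (2 * m + i))"
      \<comment> \<open>For \<open>m = 0\<close> the union on the left is empty. With
        \<open>i = 0\<close> the separation constant used in the other case would involve 1 / 0 =
        0.\<close>
      proof (cases "m = 0")
        case False
        show ?thesis
        proof (rule hausdorff_outer_separated)
          \<comment> \<open>Points of the earlier shells have distance at least 1 / (2m + i) from
            \<open>F\<close>, those of the new shell less than 1 / (2m + i + 1): the shell in
            between, of the other parity, is left out.\<close>
          show "0 < 1 / real (2 * m + i) - 1 / real (2 * m + i + 1)"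
            using False by (simp add: frac_less2)
          fix x y assume "x \<in> (\<Union>j<m. R (2 * j + i))" and y: "y \<in> R (2 * m + i)"
          then obtain j where j: "j < m" "1 / real (2 * j + i + 2) \<le> infdist x F"
            by (auto simp: R_def)
          have "1 / real (2 * m + i) \<le> 1 / real (2 * j + i + 2)"
            using j by (intro divide_left_mono) (auto simp: of_nat_add[symmetric] simp del: of_nat_add)
          also note j(2)
          also have "infdist x F \<le> infdist y F + dist x y" by (rule infdist_triangle)
          finally show "1 / real (2 * m + i) - 1 / real (2 * m + i + 1) \<le> dist x y"
            using y by (auto simp: R_def)
        qed
      qed auto
      also have "(\<Union>j<m. R (2 * j + i)) \<union> R (2 * m + i) = (\<Union>j<Suc m. R (2 * j + i))"
        by (auto simp: lessThan_Suc)
      finally show ?case .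
    qed simp
    have parity': "(\<Sum>j<m. ?\<mu> (R (2 * j + i))) \<le> ?\<mu> A" for i m
      by (rule order_trans[OF parity hausdorff_outer_mono]) (auto simp: R_def)
    have part: "(\<Sum>j<m. ?\<mu> (R j)) \<le> ?\<mu> A + ?\<mu> A" for m
    proof -
      have "(\<Sum>j<m. ?\<mu> (R j)) \<le> (\<Sum>j<2*m. ?\<mu> (R j))"
        by (intro sum_mono2) auto
      also have "\<dots> = (\<Sum>j<m. ?\<mu> (R (2 * j + 0))) + (\<Sum>j<m. ?\<mu> (R (2 * j + 1)))"
        by (induction m) (auto simp: algebra_simps)
      also have "\<dots> \<le> ?\<mu> A + ?\<mu> A"
        by (intro add_mono parity')
      finally show ?thesis .
    qed
    have "(\<Sum>j. ?\<mu> (R j)) \<le> ?\<mu> A + ?\<mu> A"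
      unfolding suminf_eq_SUP by (intro SUP_least part)
    then have S: "(\<Sum>j. ?\<mu> (R j)) < top"
      using fin by (auto simp: less_top[symmetric] top_unique)
    have pos: "0 < infdist x F" if "x \<notin> F" for x
      using infdist_pos_not_in_closed[OF assms False that] .
    have cover: "A - F \<subseteq> B n \<union> (\<Union>j. R (j + n))" for n
    proof
      fix x assume x: "x \<in> A - F"
      have p: "0 < infdist x F" using pos x by auto
      show "x \<in> B n \<union> (\<Union>j. R (j + n))"
      proof (cases "x \<in> B n")
        case False
        then have lt: "infdist x F < 1 / real (n + 1)" using x by (auto simp: B_def)
        have ex: "\<exists>j. 1 / real (j + 2) \<le> infdist x F"
        proof -
          obtain j where "1 / infdist x F < real j" using reals_Archimedean2 by blast
          then have "1 / real (j + 2) \<le> infdist x F" using p by (simp add: field_simps)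
          then show ?thesis ..
        qed
        \<comment> \<open>Minimality of the index yields the strict upper bound that the shell
          requires; for \<open>j = n\<close> this bound comes from x lying outside
          \<open>B n\<close>.\<close>
        define j where "j = (LEAST j. 1 / real (j + 2) \<le> infdist x F)"
        have j1: "1 / real (j + 2) \<le> infdist x F" unfolding j_def by (rule LeastI_ex[OF ex])
        have "n \<le> j"
        proof (rule ccontr)
          assume "\<not> n \<le> j"
          then have "1 / real (n + 1) \<le> 1 / real (j + 2)" by (intro divide_left_mono) auto
          with j1 lt show False by simp
        qed
        have j2: "infdist x F < 1 / real (j + 1)"
        proof (cases "j = n")
          case False
          then have "j - 1 < j" and eq: "j - 1 + 2 = j + 1" using \<open>n \<le> j\<close> by auto
          then have "\<not> 1 / real (j - 1 + 2) \<le> infdist x F"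
            using not_less_Least[of "j - 1" "\<lambda>j. 1 / real (j + 2) \<le> infdist x F"]
            unfolding j_def[symmetric] by blast
          then show ?thesis unfolding eq by simp
        qed (use lt in simp)
        have "x \<in> R (j - n + n)" using j1 j2 x \<open>n \<le> j\<close> by (simp add: R_def)
        then show ?thesis by blast
      qed simp
    qed
    \<comment> \<open>Instead of letting the tail of the series tend to 0, the first
      \<open>n\<close> terms are added on both sides. The tail becomes the full series, which is
      finite and can be cancelled after passing to the supremum, and no subtraction in
      \<open>ennreal\<close> occurs.\<close>
    have "?\<mu> (A \<inter> F) + ?\<mu> (A - F) + (\<Sum>j<n. ?\<mu> (R j)) \<le> ?\<mu> A + (\<Sum>j. ?\<mu> (R j))" for n
    proof -
      have 1: "?\<mu> (A - F) \<le> ?\<mu> (B n) + (\<Sum>j. ?\<mu> (R (j + n)))"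
        by (rule order_trans[OF hausdorff_outer_mono[OF cover[of n]]],
            rule order_trans[OF hausdorff_outer_Un_le add_left_mono], rule hausdorff_outer_UN_le)
      have "?\<mu> (A \<inter> F) + ?\<mu> (B n) \<le> ?\<mu> (A \<inter> F \<union> B n)"
      proof (rule hausdorff_outer_separated)
        show "0 < 1 / real (n + 1)" by simp
        fix x y assume "x \<in> A \<inter> F" "y \<in> B n"
        then show "1 / real (n + 1) \<le> dist x y"
          using infdist_triangle[of y F x] by (auto simp: B_def dist_commute)
      qed
      also have "\<dots> \<le> ?\<mu> A" by (intro hausdorff_outer_mono) (auto simp: B_def)
      finally have 2: "?\<mu> (A \<inter> F) + ?\<mu> (B n) \<le> ?\<mu> A" .
      have "?\<mu> (A \<inter> F) + ?\<mu> (A - F) + (\<Sum>j<n. ?\<mu> (R j))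
          \<le> ?\<mu> (A \<inter> F) + (?\<mu> (B n) + (\<Sum>j. ?\<mu> (R (j + n)))) + (\<Sum>j<n. ?\<mu> (R j))"
        by (intro add_mono 1 order_refl)
      also have "\<dots> = (?\<mu> (A \<inter> F) + ?\<mu> (B n)) + ((\<Sum>j. ?\<mu> (R (j + n))) + (\<Sum>j<n. ?\<mu> (R j)))"
        by (simp only: add.assoc)
      also have "\<dots> \<le> ?\<mu> A + ((\<Sum>j. ?\<mu> (R (j + n))) + (\<Sum>j<n. ?\<mu> (R j)))"
        by (intro add_mono 2 order_refl)
      also have "(\<Sum>j. ?\<mu> (R (j + n))) + (\<Sum>j<n. ?\<mu> (R j)) = (\<Sum>j. ?\<mu> (R j))"
        by (rule suminf_offset[symmetric]) auto
      finally show ?thesis .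
    qed
    then have "(SUP n. ?\<mu> (A \<inter> F) + ?\<mu> (A - F) + (\<Sum>j<n. ?\<mu> (R j))) \<le> ?\<mu> A + (\<Sum>j. ?\<mu> (R j))"
      by (rule SUP_least)
    then have "?\<mu> (A \<inter> F) + ?\<mu> (A - F) + (\<Sum>j. ?\<mu> (R j)) \<le> ?\<mu> A + (\<Sum>j. ?\<mu> (R j))"
      by (simp add: ennreal_SUP_add_right suminf_eq_SUP)
    then show ?thesis
      using S by (auto simp add: ennreal_add_left_cancel_le add.commute[of _ "\<Sum>j. ?\<mu> (R j)"])
  qed simp
  interpret sigma_algebra UNIV "UNIV :: 'a set set"
    using sigma_algebra_Pow[of UNIV] by simp
  show ?thesis
    unfolding sets_hausdorff_measure lambda_system_eq
  proof (safe intro!: antisym split)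
    show "?\<mu> x \<le> ?\<mu> (x \<inter> F) + ?\<mu> (x - F)" for x
      using hausdorff_outer_Un_le[of k "x \<inter> F" "x - F"] by (simp add: Int_Diff_Un)
  qed auto
qed simp

section \<open>Mollification\<close>

lemma integrable_lborel_translate:
  fixes f :: "'a::euclidean_space \<Rightarrow> real"
  assumes "integrable lborel f"
  shows "integrable lborel (\<lambda>x. f (x + z))"
proof -
  have "integrable (distr lborel borel ((+) z)) f"
    using assms by (simp add: lborel_distr_plus)
  then have "integrable lborel (\<lambda>x. f (z + x))"
    by (subst (asm) integrable_distr_eq) (use assms in auto)
  then show ?thesis by (simp add: add.commute)
qed

lemma integral_lborel_translate:
  fixes f :: "'a::euclidean_space \<Rightarrow> real"
  assumes [measurable]: "f \<in> borel_measurable borel"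
  shows "(\<integral>x. f (x + z) \<partial>lborel) = (\<integral>x. f x \<partial>lborel)"
proof -
  have "(\<integral>x. f x \<partial>lborel) = (\<integral>x. f x \<partial>distr lborel borel ((+) z))"
    by (simp add: lborel_distr_plus)
  also have "\<dots> = (\<integral>x. f (z + x) \<partial>lborel)"
    by (subst integral_distr) auto
  finally show ?thesis by (simp add: add.commute)
qed

text \<open>Compactness from inside is obtained in two steps: a closed subset \<open>T\<close>, then
  its intersection with large balls, whose measures converge because \<open>T\<close> has finite
  measure. The losses V - A, A - T and the truncation of \<open>T\<close> take e/3 each.\<close>

lemma lborel_compact_open_approx:
  fixes A :: "'a::euclidean_space set"
  assumes A: "A \<in> sets lborel" "emeasure lborel A < \<infinity>" and "0 < e"
  obtains K V where "compact K" "K \<subseteq> A" "open V" "A \<subseteq> V" "emeasure lborel V < \<infinity>"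
    "measure lborel V < measure lborel K + e"
proof -
  have AL: "A \<in> sets lebesgue" using A by simp
  obtain V where V: "open V" "A \<subseteq> V" "V - A \<in> lmeasurable" "emeasure lebesgue (V - A) < ennreal (e/3)"
    using sets_lebesgue_outer_open[OF AL, of "e/3"] \<open>0 < e\<close> by auto
  obtain T where T: "closed T" "T \<subseteq> A" "A - T \<in> lmeasurable" "emeasure lebesgue (A - T) < ennreal (e/3)"
    using sets_lebesgue_inner_closed[OF AL, of "e/3"] \<open>0 < e\<close> by auto
  have [measurable]: "A \<in> sets borel" "V \<in> sets borel" "T \<in> sets borel"
    using A V T by auto
  have VA: "emeasure lborel (V - A) < ennreal (e/3)" and AT: "emeasure lborel (A - T) < ennreal (e/3)"
    using V(4) T(4) by auto
  have Vfin: "emeasure lborel V < \<infinity>"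
  proof -
    have "emeasure lborel V = emeasure lborel A + emeasure lborel (V - A)"
      using V by (subst plus_emeasure) (auto intro!: arg_cong[where f="emeasure lborel"])
    also have "\<dots> < \<infinity>" using A VA by (auto simp: less_top[symmetric])
    finally show ?thesis .
  qed
  have Tfin: "emeasure lborel T < \<infinity>"
    using emeasure_mono[OF T(2), of lborel] A by auto
  have "(\<lambda>n. emeasure lborel (T \<inter> cball 0 (real n))) \<longlonglongrightarrow> emeasure lborel (\<Union>n. T \<inter> cball 0 (real n))"
    by (intro Lim_emeasure_incseq) (auto simp: incseq_def)
  also have "(\<Union>n. T \<inter> cball 0 (real n)) = T"
    by (auto intro: real_arch_simple)
  finally have "(\<lambda>n. measure lborel (T \<inter> cball 0 (real n))) \<longlonglongrightarrow> measure lborel T"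
    unfolding measure_def using Tfin by (intro tendsto_enn2real) auto
  then have "\<forall>\<^sub>F n in sequentially. measure lborel T - e/3 < measure lborel (T \<inter> cball 0 (real n))"
    using \<open>0 < e\<close> by (intro order_tendstoD) auto
  then obtain n where n: "measure lborel T - e/3 < measure lborel (T \<inter> cball 0 (real n))"
    by (auto simp: eventually_sequentially)
  show thesis
  proof
    show "compact (T \<inter> cball 0 (real n))"
      using T(1) by (intro closed_Int_compact) auto
    have fm: "V \<in> fmeasurable lborel" "A \<in> fmeasurable lborel" "T \<in> fmeasurable lborel"
      using Vfin A Tfin by (auto intro!: fmeasurableI)
    have "measure lborel V = measure lborel T + measure lborel (A - T) + measure lborel (V - A)"
      using measurable_measure_Diff[OF fm(1), of A] measurable_measure_Diff[OF fm(2), of T] V T by simp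
    moreover have "measure lborel (A - T) < e/3" "measure lborel (V - A) < e/3"
      using VA AT \<open>0 < e\<close> unfolding measure_def
      by (cases "emeasure lborel (A - T)"; cases "emeasure lborel (V - A)"; simp add: ennreal_less_iff)+
    ultimately show "measure lborel V < measure lborel (T \<inter> cball 0 (real n)) + e"
      using n by simp
  qed (use V T Vfin in auto)
qed

text \<open>For small z, x + z \<in> K forces x \<in> V. The symmetric difference of
  \<open>A\<close> and its translate is then controlled by the losses between \<open>K\<close>,
  \<open>A\<close> and \<open>V\<close>, and translation invariance removes z from their
  integrals.\<close>

lemma L1_translation_continuous_indicator:
  fixes A :: "'a::euclidean_space set"
  assumes A: "A \<in> sets lborel" "emeasure lborel A < \<infinity>" and "0 < e"
  shows "\<exists>d>0. \<forall>z. norm z < d \<longrightarrow> (\<integral>x. \<bar>indicat_real A (x + z) - indicat_real A x\<bar> \<partial>lborel) < e"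
proof -
  \<comment> \<open>The final bound is 2 (|A| - |K|) + 2 (|V| - |K|), at most four times |V| -
    |K|.\<close>
  obtain K V where KV: "compact K" "K \<subseteq> A" "open V" "A \<subseteq> V" "emeasure lborel V < \<infinity>"
    "measure lborel V < measure lborel K + e / 4"
    using lborel_compact_open_approx[OF A, of "e/4"] \<open>0 < e\<close> by auto
  have sets[measurable]: "K \<in> sets borel" "V \<in> sets borel" "A \<in> sets borel"
    using KV A by (auto intro: borel_compact)
  obtain d where d: "d > 0" "(\<Union>x\<in>K. ball x d) \<subseteq> V"
    using compact_subset_open_imp_ball_epsilon_subset[OF KV(1,3)] KV(2,4) by blast
  have Kfin: "emeasure lborel K < \<infinity>"
    using emeasure_mono[of K V lborel] KV(2,4,5) sets by (auto intro: le_less_trans)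
  have i: "integrable lborel (indicator K :: 'a \<Rightarrow> real)" "integrable lborel (indicator V :: 'a \<Rightarrow> real)"
     "integrable lborel (indicator A :: 'a \<Rightarrow> real)"
    using KV A Kfin by (auto simp: less_top)
  show ?thesis
  proof (intro exI conjI allI impI)
    fix z :: 'a assume z: "norm z < d"
    let ?a = "indicator A :: 'a \<Rightarrow> real" and ?k = "indicator K :: 'a \<Rightarrow> real" and ?v = "indicator V :: 'a \<Rightarrow> real"
    note tr = integrable_lborel_translate
    have "(\<integral>x. \<bar>?a (x + z) - ?a x\<bar> \<partial>lborel)
       \<le> (\<integral>x. (?a (x + z) - ?k (x + z)) + (?v x - ?k (x + z)) + ((?v x - ?k x) + (?a x - ?k x)) \<partial>lborel)"
    proof (rule integral_mono)
      fix x
      have "x + z \<in> K \<Longrightarrow> x \<in> V"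
        using d z by (auto simp: dist_norm subset_eq)
      then show "\<bar>?a (x + z) - ?a x\<bar> \<le> (?a (x + z) - ?k (x + z)) + (?v x - ?k (x + z)) + ((?v x - ?k x) + (?a x - ?k x))"
        using KV(2,4) by (auto simp: indicator_def split: if_splits)
    qed (intro Bochner_Integration.integrable_add Bochner_Integration.integrable_diff tr i integrable_abs)+
    also have "\<dots> = ((\<integral>x. ?a x \<partial>lborel) - (\<integral>x. ?k x \<partial>lborel)) + ((\<integral>x. ?v x \<partial>lborel) - (\<integral>x. ?k x \<partial>lborel))
        + (((\<integral>x. ?v x \<partial>lborel) - (\<integral>x. ?k x \<partial>lborel)) + ((\<integral>x. ?a x \<partial>lborel) - (\<integral>x. ?k x \<partial>lborel)))"
      by (simp add: i tr[OF i(1)] tr[OF i(3)] integral_lborel_translate[of ?a z] integral_lborel_translate[of ?k z])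
    also have "\<dots> = 2 * (measure lborel A - measure lborel K) + 2 * (measure lborel V - measure lborel K)"
      by simp
    also have "measure lborel A \<le> measure lborel V"
      using KV by (intro measure_mono_fmeasurable) (auto simp: fmeasurable_def)
    finally show "(\<integral>x. \<bar>?a (x + z) - ?a x\<bar> \<partial>lborel) < e" using KV(6) by simp
  qed (use d in auto)
qed

text \<open>A density argument: the estimate survives scaling, sums and L1 limits, the last because
  a translation leaves the L1 norm of the approximation error unchanged.\<close>

lemma L1_translation_continuous:
  fixes u :: "'a::euclidean_space \<Rightarrow> real"
  assumes "integrable lborel u" "0 < e"
  shows "\<exists>d>0. \<forall>z. norm z < d \<longrightarrow> (\<integral>x. \<bar>u (x + z) - u x\<bar> \<partial>lborel) < e"
  using assms
proof (induction u arbitrary: e rule: integrable_induct)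
  case (base A c)
  obtain d where d: "d > 0" "\<And>z. norm z < d \<Longrightarrow>
      (\<integral>x. \<bar>indicat_real A (x + z) - indicat_real A x\<bar> \<partial>lborel) < e / (\<bar>c\<bar> + 1)"
    using L1_translation_continuous_indicator[OF base(1,2), of "e / (\<bar>c\<bar> + 1)"] base(3) by auto
  show ?case
  proof (intro exI[of _ d] conjI allI impI)
    fix z :: 'a assume z: "norm z < d"
    have "(\<integral>x. \<bar>indicator A (x + z) *\<^sub>R c - indicator A x *\<^sub>R c\<bar> \<partial>lborel)
        = (\<integral>x. \<bar>c\<bar> * \<bar>indicat_real A (x + z) - indicat_real A x\<bar> \<partial>lborel)"
      by (intro Bochner_Integration.integral_cong) (auto simp: abs_mult[symmetric] algebra_simps)
    also have "\<dots> = \<bar>c\<bar> * (\<integral>x. \<bar>indicat_real A (x + z) - indicat_real A x\<bar> \<partial>lborel)" by simp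
    also have "\<dots> \<le> \<bar>c\<bar> * (e / (\<bar>c\<bar> + 1))"
      using d(2)[OF z] by (intro mult_left_mono) auto
    also have "\<dots> < e" using base(3) by (simp add: field_simps)
    finally show "(\<integral>x. \<bar>indicator A (x + z) *\<^sub>R c - indicator A x *\<^sub>R c\<bar> \<partial>lborel) < e" .
  qed fact
next
  case (add f g)
  obtain d1 where d1: "d1 > 0" "\<And>z. norm z < d1 \<Longrightarrow> (\<integral>x. \<bar>f (x + z) - f x\<bar> \<partial>lborel) < e / 2"
    using add.IH(1)[of "e/2"] add.prems by auto
  obtain d2 where d2: "d2 > 0" "\<And>z. norm z < d2 \<Longrightarrow> (\<integral>x. \<bar>g (x + z) - g x\<bar> \<partial>lborel) < e / 2"
    using add.IH(2)[of "e/2"] add.prems by auto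
  note tr = integrable_lborel_translate
  show ?case
  proof (intro exI[of _ "min d1 d2"] conjI allI impI)
    fix z :: 'a assume z: "norm z < min d1 d2"
    have "(\<integral>x. \<bar>f (x + z) + g (x + z) - (f x + g x)\<bar> \<partial>lborel)
       \<le> (\<integral>x. \<bar>f (x + z) - f x\<bar> + \<bar>g (x + z) - g x\<bar> \<partial>lborel)"
      using add.hyps by (intro integral_mono integrable_abs Bochner_Integration.integrable_add Bochner_Integration.integrable_diff tr) auto
    also have "\<dots> = (\<integral>x. \<bar>f (x + z) - f x\<bar> \<partial>lborel) + (\<integral>x. \<bar>g (x + z) - g x\<bar> \<partial>lborel)"
      using add.hyps by (intro Bochner_Integration.integral_add integrable_abs Bochner_Integration.integrable_diff tr) auto
    also have "\<dots> < e" using d1(2)[of z] d2(2)[of z] z by simp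
    finally show "(\<integral>x. \<bar>f (x + z) + g (x + z) - (f x + g x)\<bar> \<partial>lborel) < e" .
  qed (use d1 d2 in auto)
next
  case (lim f s)
  note tr = integrable_lborel_translate
  have [measurable]: "f \<in> borel_measurable borel" "\<And>i. s i \<in> borel_measurable borel"
    using lim.hyps borel_measurable_integrable by force+
  have "(\<lambda>i. \<integral>x. \<bar>s i x - f x\<bar> \<partial>lborel) \<longlonglongrightarrow> (\<integral>x. 0 \<partial>(lborel :: 'a measure))"
  \<comment> \<open>The approximants of \<open>integrable_induct\<close> satisfy |s i x| \<le> 2 |f
    x|, whence the factor 3.\<close>
  proof (rule integral_dominated_convergence[where w="\<lambda>x. 3 * \<bar>f x\<bar>" and f="\<lambda>x. 0" and s="\<lambda>i x. \<bar>s i x - f x\<bar>"])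
    show "AE x in lborel. (\<lambda>i. \<bar>s i x - f x\<bar>) \<longlonglongrightarrow> 0"
      using lim.hyps by (auto intro!: tendsto_rabs_zero LIM_zero)
    show "AE x in lborel. norm \<bar>s i x - f x\<bar> \<le> 3 * \<bar>f x\<bar>" for i
    proof (rule AE_I2)
      fix x show "norm \<bar>s i x - f x\<bar> \<le> 3 * \<bar>f x\<bar>"
        using lim.hyps(3)[of x i] by (auto simp: abs_le_iff)
    qed
  qed (use lim.hyps in auto)
  then have "\<forall>\<^sub>F i in sequentially. (\<integral>x. \<bar>s i x - f x\<bar> \<partial>lborel) < e/3"
    using lim.prems by (intro order_tendstoD) auto
  then obtain i where i: "(\<integral>x. \<bar>s i x - f x\<bar> \<partial>lborel) < e/3"
    by (auto simp: eventually_sequentially)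
  obtain d where d: "d > 0" "\<And>z. norm z < d \<Longrightarrow> (\<integral>x. \<bar>s i (x + z) - s i x\<bar> \<partial>lborel) < e / 3"
    using lim.IH[of "e/3" i] lim.prems by auto
  show ?case
  proof (intro exI[of _ d] conjI allI impI)
    fix z :: 'a assume z: "norm z < d"
    have sf: "integrable lborel (\<lambda>x. \<bar>s i x - f x\<bar>)" "integrable lborel (\<lambda>x. \<bar>s i (x + z) - s i x\<bar>)"
      using lim.hyps by (auto intro!: integrable_abs Bochner_Integration.integrable_diff tr)
    have "(\<integral>x. \<bar>f (x + z) - f x\<bar> \<partial>lborel)
       \<le> (\<integral>x. \<bar>s i (x + z) - f (x + z)\<bar> + (\<bar>s i (x + z) - s i x\<bar> + \<bar>s i x - f x\<bar>) \<partial>lborel)"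
      using lim.hyps by (intro integral_mono integrable_abs Bochner_Integration.integrable_add Bochner_Integration.integrable_diff tr) auto
    also have "\<dots> = (\<integral>x. \<bar>s i (x + z) - f (x + z)\<bar> \<partial>lborel)
        + ((\<integral>x. \<bar>s i (x + z) - s i x\<bar> \<partial>lborel) + (\<integral>x. \<bar>s i x - f x\<bar> \<partial>lborel))"
      using sf tr[OF sf(1), of z] by (simp)
    also have "(\<integral>x. \<bar>s i (x + z) - f (x + z)\<bar> \<partial>lborel) = (\<integral>x. \<bar>s i x - f x\<bar> \<partial>lborel)"
      by (rule integral_lborel_translate[of "\<lambda>x. \<bar>s i x - f x\<bar>"]) measurable
    finally show "(\<integral>x. \<bar>f (x + z) - f x\<bar> \<partial>lborel) < e"
      using i d(2)[OF z] by simp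
  qed fact
qed

text \<open>A piecewise polynomial kernel: mollified functions only have to be C1, and the squared
  positive part has an elementary second-order remainder. The normalisation is left to
  \<open>mollify\<close>.\<close>

definition bump :: "real \<Rightarrow> 'a::euclidean_space \<Rightarrow> real" where
  "bump \<epsilon> x = (max 0 (\<epsilon>\<^sup>2 - x \<bullet> x))\<^sup>2"

definition mollify :: "real \<Rightarrow> ('a::euclidean_space \<Rightarrow> real) \<Rightarrow> 'a \<Rightarrow> real" where
  "mollify \<epsilon> u x = (\<integral>y. bump \<epsilon> (x - y) * u y \<partial>lborel) / (\<integral>y. bump \<epsilon> (y::'a) \<partial>lborel)"

lemma bump_nonneg [simp]: "0 \<le> bump \<epsilon> x"
  by (simp add: bump_def)

lemma bump_minus [simp]: "bump \<epsilon> (- x) = bump \<epsilon> x"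
  by (simp add: bump_def)

lemma bump_eq_0: "0 \<le> \<epsilon> \<Longrightarrow> \<epsilon> \<le> norm x \<Longrightarrow> bump \<epsilon> x = 0"
  using power_mono[of \<epsilon> "norm x" 2] by (simp add: bump_def power2_norm_eq_inner)

lemma continuous_on_bump [continuous_intros]:
  "continuous_on S f \<Longrightarrow> continuous_on S (\<lambda>x. bump \<epsilon> (f x))"
  unfolding bump_def by (intro continuous_intros)

lemma borel_measurable_bump [measurable]: "bump \<epsilon> \<in> borel_measurable borel"
  using continuous_on_bump[OF continuous_on_id] by (intro borel_measurable_continuous_onI) simp

lemma bump_le: "bump \<epsilon> x \<le> \<epsilon> ^ 4"
proof -
  have "max 0 (\<epsilon>\<^sup>2 - x \<bullet> x) \<le> \<epsilon>\<^sup>2" by simp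
  then have "(max 0 (\<epsilon>\<^sup>2 - x \<bullet> x))\<^sup>2 \<le> (\<epsilon>\<^sup>2)\<^sup>2" by (intro power_mono) auto
  then show ?thesis by (simp add: bump_def flip: power_mult)
qed

lemma integrable_bump:
  assumes "0 < \<epsilon>"
  shows "integrable lborel (bump \<epsilon> :: 'a::euclidean_space \<Rightarrow> real)"
proof (rule Bochner_Integration.integrable_bound)
  show "integrable lborel (\<lambda>x::'a. \<epsilon> ^ 4 * indicat_real (ball 0 \<epsilon>) x)"
    using emeasure_lborel_ball_finite[of "0::'a" \<epsilon>] by (auto simp: less_top)
  show "AE x::'a in lborel. norm (bump \<epsilon> x) \<le> norm (\<epsilon> ^ 4 * indicat_real (ball 0 \<epsilon>) x)"
  proof (rule AE_I2)
    fix x :: 'a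
    show "norm (bump \<epsilon> x) \<le> norm (\<epsilon> ^ 4 * indicat_real (ball 0 \<epsilon>) x)"
      using bump_le[of \<epsilon> x] bump_eq_0[of \<epsilon> x] assms by (cases "norm x < \<epsilon>") auto
  qed
qed measurable

lemma integral_bump_pos:
  assumes "0 < \<epsilon>"
  shows "0 < (\<integral>y. bump \<epsilon> (y::'a::euclidean_space) \<partial>lborel)"
proof -
  \<comment> \<open>On the ball of half the radius, \<epsilon>^2 - |x|^2 is at least 3/4
    \<epsilon>^2.\<close>
  let ?B = "ball (0::'a) (\<epsilon>/2)"
  have i: "integrable lborel (\<lambda>x::'a. (3/4 * \<epsilon>\<^sup>2)\<^sup>2 * indicat_real ?B x)"
    using emeasure_lborel_ball_finite[of "0::'a" "\<epsilon>/2"] by (auto simp: less_top)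
  have "0 < (3/4 * \<epsilon>\<^sup>2)\<^sup>2 * measure lborel ?B"
    using assms by (intro mult_pos_pos) auto
  also have "\<dots> = (\<integral>x. (3/4 * \<epsilon>\<^sup>2)\<^sup>2 * indicat_real ?B x \<partial>lborel)"
    by simp
  also have "\<dots> \<le> (\<integral>y. bump \<epsilon> (y::'a) \<partial>lborel)"
  proof (rule integral_mono[OF i integrable_bump[OF assms]])
    fix x :: 'a
    show "(3/4 * \<epsilon>\<^sup>2)\<^sup>2 * indicat_real ?B x \<le> bump \<epsilon> x"
    proof (cases "x \<in> ?B")
      case True
      then have "(norm x)\<^sup>2 \<le> (\<epsilon>/2)\<^sup>2" by (intro power_mono) auto
      then have "3/4 * \<epsilon>\<^sup>2 \<le> \<epsilon>\<^sup>2 - x \<bullet> x"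
        by (simp add: power2_norm_eq_inner power_divide)
      then have "3/4 * \<epsilon>\<^sup>2 \<le> max 0 (\<epsilon>\<^sup>2 - x \<bullet> x)"
        by (simp add: le_max_iff_disj)
      then have "(3/4 * \<epsilon>\<^sup>2)\<^sup>2 \<le> bump \<epsilon> x"
        unfolding bump_def by (intro power_mono) auto
      then show ?thesis using True by simp
    qed simp
  qed
  finally show ?thesis .
qed

text \<open>The squared positive part of s changes by 2 max(0, s) q up to an error q^2, for every
  increment q; here q is the change of \<epsilon>^2 - |x|^2, of size at most (2R + 1) |h|. The bound
  is uniform over |x| \<le> R, so that it can be integrated.\<close>

lemma bump_taylor:
  fixes x h :: "'a::euclidean_space"
  assumes "norm x \<le> R" "norm h \<le> 1"
  shows "\<bar>bump \<epsilon> (x + h) - bump \<epsilon> x + 4 * max 0 (\<epsilon>\<^sup>2 - x \<bullet> x) * (x \<bullet> h)\<bar>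
     \<le> ((2 * R + 1)\<^sup>2 + 2 * \<epsilon>\<^sup>2) * (norm h)\<^sup>2"
proof -
  define s where "s = \<epsilon>\<^sup>2 - x \<bullet> x"
  define q where "q = - 2 * (x \<bullet> h) - (norm h)\<^sup>2"
  have sq: "\<epsilon>\<^sup>2 - (x + h) \<bullet> (x + h) = s + q"
    by (simp add: s_def q_def algebra_simps inner_commute power2_norm_eq_inner)
  have quad: "\<bar>(max 0 (s + q))\<^sup>2 - (max 0 s)\<^sup>2 - 2 * max 0 s * q\<bar> \<le> q\<^sup>2"
  proof (cases "0 \<le> s"; cases "0 \<le> s + q")
    assume "0 \<le> s" "\<not> 0 \<le> s + q"
    then have "0 \<le> s" "s \<le> - q" by auto
    then have "s * s \<le> s * (- q)" "s * q \<le> 0" "(q + s)\<^sup>2 \<ge> 0" "q * q \<ge> 0"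
      by (simp_all only: mult_left_mono zero_le_power2 zero_le_square mult_nonneg_nonpos neg_0_le_iff_le[symmetric, of q] order.trans[of 0 s "- q"])
    then show ?thesis using \<open>0 \<le> s\<close> \<open>\<not> 0 \<le> s + q\<close>
      by (simp add: abs_le_iff power2_eq_square algebra_simps)
  next
    assume "\<not> 0 \<le> s" "0 \<le> s + q"
    then have "(s + q)\<^sup>2 \<le> q\<^sup>2" by (intro power_mono) auto
    then show ?thesis using \<open>\<not> 0 \<le> s\<close> \<open>0 \<le> s + q\<close> by simp
  qed (auto simp: power2_eq_square algebra_simps)
  have "\<bar>q\<bar> \<le> 2 * (norm x * norm h) + (norm h)\<^sup>2"
    using Cauchy_Schwarz_ineq2[of x h] zero_le_power2[of "norm h"] unfolding q_def abs_le_iff by linarith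
  also have "\<dots> \<le> 2 * (R * norm h) + norm h * 1"
    using assms mult_right_mono[OF assms(1), of "norm h"] mult_left_le[of "norm h" "norm h"]
    by (intro add_mono) (auto simp: power2_eq_square)
  finally have "\<bar>q\<bar> \<le> (2 * R + 1) * norm h" by (simp add: algebra_simps)
  then have "q\<^sup>2 \<le> ((2 * R + 1) * norm h)\<^sup>2" by (rule abs_le_square_iff[THEN iffD1, OF order_trans]) simp
  then have q2: "q\<^sup>2 \<le> (2 * R + 1)\<^sup>2 * (norm h)\<^sup>2" by (simp add: power_mult_distrib)
  \<comment> \<open>The last term comes from the part of \<open>q\<close> that is quadratic in
    h.\<close>
  have eq: "bump \<epsilon> (x + h) - bump \<epsilon> x + 4 * max 0 (\<epsilon>\<^sup>2 - x \<bullet> x) * (x \<bullet> h)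
     = ((max 0 (s + q))\<^sup>2 - (max 0 s)\<^sup>2 - 2 * max 0 s * q) - 2 * max 0 s * (norm h)\<^sup>2"
    unfolding bump_def sq s_def[symmetric] by (simp add: q_def algebra_simps)
  have "max 0 s \<le> \<epsilon>\<^sup>2" by (simp add: s_def)
  then have lin: "\<bar>2 * max 0 s * (norm h)\<^sup>2\<bar> \<le> 2 * \<epsilon>\<^sup>2 * (norm h)\<^sup>2"
    by (simp add: abs_mult mult_right_mono)
  show ?thesis
    unfolding eq distrib_right[of "(2 * R + 1)\<^sup>2"]
    by (rule order_trans[OF abs_triangle_ineq4 add_mono[OF order_trans[OF quad q2] lin]])
qed

lemma C1_mapI:
  assumes der: "\<And>x. (f has_derivative f' x) (at x)" and cont: "\<And>h. continuous_on UNIV (\<lambda>x. f' x h)"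
  shows "C1_map f"
  unfolding C1_map_def using cont frechet_derivative_at[OF der]
  by (auto intro: differentiableI[OF der])

lemma C1_map_has_derivative:
  "C1_map f \<Longrightarrow> (f has_derivative frechet_derivative f (at x)) (at x)"
  by (simp add: C1_map_def frechet_derivative_works)

text \<open>Differentiation under the integral is carried out by integrating the Taylor remainder of
  the kernel. As \<open>u\<close> vanishes outside a ball, x - y ranges over a bounded set on which
  that remainder is uniform.\<close>

lemma C1_mollify:
  fixes u :: "'a::euclidean_space \<Rightarrow> real"
  assumes u: "integrable lborel u" and R: "\<And>x. R < norm x \<Longrightarrow> u x = 0" and "0 < \<epsilon>"
  shows "C1_map (mollify \<epsilon> u)"
proof -
  define Z where "Z = (\<integral>y. bump \<epsilon> (y::'a) \<partial>lborel)"
  have Z: "0 < Z" unfolding Z_def by (rule integral_bump_pos[OF \<open>0 < \<epsilon>\<close>])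
  have [measurable]: "u \<in> borel_measurable borel" using u by auto
  \<comment> \<open>The gradient of the kernel at x - y.\<close>
  define g where "g x y = (- 4 * max 0 (\<epsilon>\<^sup>2 - (x - y) \<bullet> (x - y))) *\<^sub>R (x - y)" for x y :: 'a
  have g_bound: "\<bar>(g x y \<bullet> h) * u y\<bar> \<le> 4 * \<epsilon> ^ 3 * norm h * \<bar>u y\<bar>" for x y h
  proof -
    have "norm (g x y) \<le> 4 * \<epsilon> ^ 3"
    proof (cases "norm (x - y) \<le> \<epsilon>")
      case True
      have "max 0 (\<epsilon>\<^sup>2 - (x - y) \<bullet> (x - y)) * norm (x - y) \<le> \<epsilon>\<^sup>2 * \<epsilon>"
        using True \<open>0 < \<epsilon>\<close> by (intro mult_mono) auto
      then show ?thesis by (simp add: g_def power2_eq_square power3_eq_cube)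
    next
      case False
      then have "\<epsilon>\<^sup>2 \<le> (norm (x - y))\<^sup>2" using \<open>0 < \<epsilon>\<close> by (intro power_mono) auto
      then show ?thesis using \<open>0 < \<epsilon>\<close> by (simp add: g_def power2_norm_eq_inner)
    qed
    then have "\<bar>g x y \<bullet> h\<bar> \<le> 4 * \<epsilon> ^ 3 * norm h"
      using Cauchy_Schwarz_ineq2[of "g x y" h] mult_right_mono[of _ "4 * \<epsilon> ^ 3" "norm h"] by fastforce
    then show ?thesis by (simp add: abs_mult mult_right_mono)
  qed
  have g_meas [measurable]: "(\<lambda>y. g x y \<bullet> h) \<in> borel_measurable borel" for x h
    unfolding g_def by (intro borel_measurable_continuous_onI continuous_intros)
  have g_int: "integrable lborel (\<lambda>y. (g x y \<bullet> h) * u y)" for x h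
  proof (rule Bochner_Integration.integrable_bound)
    show "integrable lborel (\<lambda>y. 4 * \<epsilon> ^ 3 * norm h * \<bar>u y\<bar>)" using u by auto
  qed (use g_bound \<open>0 < \<epsilon>\<close> in \<open>auto simp: abs_mult\<close>)
  have k_int: "integrable lborel (\<lambda>y. bump \<epsilon> (x - y) * u y)" for x
  proof (rule Bochner_Integration.integrable_bound)
    show "integrable lborel (\<lambda>y. \<epsilon> ^ 4 * \<bar>u y\<bar>)" using u by auto
    show "AE y in lborel. norm (bump \<epsilon> (x - y) * u y) \<le> norm (\<epsilon> ^ 4 * \<bar>u y\<bar>)"
      using bump_le[of \<epsilon>] by (intro AE_I2) (auto simp: abs_mult intro!: mult_right_mono)
  qed measurable
  define D where "D x h = (\<integral>y. (g x y \<bullet> h) * u y \<partial>lborel) / Z" for x h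
  have "linear (D x)" for x
    by (rule linearI) (simp_all add: D_def inner_add_right distrib_right add_divide_distrib g_int mult.assoc)
  then have bl: "bounded_linear (D x)" for x
    by (simp add: linear_linear)
  have der: "(mollify \<epsilon> u has_derivative D x) (at x)" for x
    unfolding has_derivative_at_alt
  proof (intro conjI bl allI impI)
    fix e :: real assume "0 < e"
    define R' where "R' = norm x + \<bar>R\<bar>"
    define C where "C = (2 * R' + 1)\<^sup>2 + 2 * \<epsilon>\<^sup>2"
    define L where "L = (\<integral>y. C * \<bar>u y\<bar> \<partial>lborel) / Z"
    have "0 \<le> C" unfolding C_def by simp
    then have "0 \<le> L" using Z unfolding L_def by (intro divide_nonneg_pos Bochner_Integration.integral_nonneg) auto
    have rem: "\<bar>mollify \<epsilon> u (x + h) - mollify \<epsilon> u x - D x h\<bar> \<le> L * (norm h)\<^sup>2" if h: "norm h \<le> 1" for h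
    proof -
      have "mollify \<epsilon> u (x + h) - mollify \<epsilon> u x - D x h
          = (\<integral>y. bump \<epsilon> (x + h - y) * u y - bump \<epsilon> (x - y) * u y - (g x y \<bullet> h) * u y \<partial>lborel) / Z"
        using k_int g_int by (simp add: mollify_def D_def Z_def diff_divide_distrib)
      also have "\<bar>\<dots>\<bar> \<le> (\<integral>y. C * \<bar>u y\<bar> * (norm h)\<^sup>2 \<partial>lborel) / Z"
        unfolding abs_divide abs_of_pos[OF Z]
      proof (intro divide_right_mono integral_abs_bound[THEN order_trans] integral_mono)
        fix y
        show "\<bar>bump \<epsilon> (x + h - y) * u y - bump \<epsilon> (x - y) * u y - (g x y \<bullet> h) * u y\<bar>
            \<le> C * \<bar>u y\<bar> * (norm h)\<^sup>2"
        proof (cases "R < norm y")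
          case False
          then have "norm (x - y) \<le> R'" using norm_triangle_ineq4[of x y] by (simp add: R'_def)
          from bump_taylor[OF this h, of \<epsilon>]
          have "\<bar>bump \<epsilon> (x + h - y) - bump \<epsilon> (x - y) - g x y \<bullet> h\<bar> \<le> C * (norm h)\<^sup>2"
            by (simp add: g_def C_def algebra_simps)
          then have "\<bar>bump \<epsilon> (x + h - y) - bump \<epsilon> (x - y) - g x y \<bullet> h\<bar> * \<bar>u y\<bar> \<le> C * (norm h)\<^sup>2 * \<bar>u y\<bar>"
            by (intro mult_right_mono) auto
          then show ?thesis
            by (simp add: abs_mult[symmetric] left_diff_distrib mult.assoc mult.commute[of "(norm h)\<^sup>2"])
        qed (simp add: R)
      qed (use k_int g_int u Z in auto)
      also have "\<dots> = L * (norm h)\<^sup>2"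
        by (simp add: L_def)
      finally show ?thesis .
    qed
    show "\<exists>d>0. \<forall>y. norm (y - x) < d \<longrightarrow> norm (mollify \<epsilon> u y - mollify \<epsilon> u x - D x (y - x)) \<le> e * norm (y - x)"
    proof (intro exI conjI allI impI)
      \<comment> \<open>\<open>rem\<close> holds for increments of norm at most 1; adding 1 to
        \<open>L\<close> allows \<open>L = 0\<close>.\<close>
      show "0 < min 1 (e / (L + 1))" using \<open>0 < e\<close> \<open>0 \<le> L\<close> by simp
      fix y assume y: "norm (y - x) < min 1 (e / (L + 1))"
      have "L * norm (y - x) \<le> (L + 1) * (e / (L + 1))"
        using y \<open>0 \<le> L\<close> by (intro mult_mono) auto
      then have "L * norm (y - x) \<le> e" using \<open>0 \<le> L\<close> by simp
      then have "L * norm (y - x) * norm (y - x) \<le> e * norm (y - x)"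
        by (intro mult_right_mono) auto
      then show "norm (mollify \<epsilon> u y - mollify \<epsilon> u x - D x (y - x)) \<le> e * norm (y - x)"
        using rem[of "y - x"] y by (simp add: power2_eq_square mult.assoc)
    qed
  qed
  have cont: "continuous_on UNIV (\<lambda>x. D x h)" for h
  proof -
    have "isCont (\<lambda>x. D x h) x" for x
      unfolding continuous_at_sequentially comp_def
    proof (intro allI impI)
      fix X :: "nat \<Rightarrow> 'a" assume X: "X \<longlonglongrightarrow> x"
      have "(\<lambda>n. \<integral>y. (g (X n) y \<bullet> h) * u y \<partial>lborel) \<longlonglongrightarrow> (\<integral>y. (g x y \<bullet> h) * u y \<partial>lborel)"
      proof (rule integral_dominated_convergence[where w="\<lambda>y. 4 * \<epsilon> ^ 3 * norm h * \<bar>u y\<bar>"])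
        show "AE y in lborel. (\<lambda>n. (g (X n) y \<bullet> h) * u y) \<longlonglongrightarrow> (g x y \<bullet> h) * u y"
          unfolding g_def by (auto intro!: tendsto_intros X)
      qed (use g_bound u in auto)
      then show "(\<lambda>n. D (X n) h) \<longlonglongrightarrow> D x h"
        unfolding D_def using Z by (intro tendsto_divide) auto
    qed
    then show ?thesis by (simp add: continuous_at_imp_continuous_on)
  qed
  show ?thesis by (rule C1_mapI[OF der cont])
qed

text \<open>Written as a weighted average of translates of \<open>u\<close>, the mollification
  inherits bounds that hold for single translates.\<close>

lemma mollify_eq_shift:
  fixes u :: "'a::euclidean_space \<Rightarrow> real"
  assumes [measurable]: "u \<in> borel_measurable borel"
  shows "mollify \<epsilon> u x = (\<integral>z. bump \<epsilon> z * u (x + z) \<partial>lborel) / (\<integral>y. bump \<epsilon> (y::'a) \<partial>lborel)"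
proof -
  have "(\<integral>y. bump \<epsilon> (x - y) * u y \<partial>lborel) = (\<integral>z. bump \<epsilon> (x - (z + x)) * u (z + x) \<partial>lborel)"
    by (rule integral_lborel_translate[symmetric]) measurable
  then show ?thesis by (simp add: mollify_def add.commute)
qed

text \<open>The Fubini condition for such averages: slices of uniformly bounded L1 norm, weighted by
  an integrable kernel.\<close>

lemma integrable_bump_mult:
  fixes F :: "'a::euclidean_space \<Rightarrow> 'a \<Rightarrow> real"
  assumes [measurable]: "(\<lambda>(z, x). F z x) \<in> borel_measurable (borel \<Otimes>\<^sub>M borel)"
    and int: "\<And>z. integrable lborel (F z)" and bnd: "\<And>z. (\<integral>x. \<bar>F z x\<bar> \<partial>lborel) \<le> B" and "0 < \<epsilon>"
  shows "integrable (lborel \<Otimes>\<^sub>M lborel) (\<lambda>(z, x). bump \<epsilon> z * F z x)"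
proof (rule lborel_pair.Fubini_integrable)
  have [measurable]: "(\<lambda>z. \<integral>x. \<bar>F z x\<bar> \<partial>lborel) \<in> borel_measurable borel"
    by measurable
  show "integrable lborel (\<lambda>z. \<integral>x. norm (case (z, x) of (z, x) \<Rightarrow> bump \<epsilon> z * F z x) \<partial>lborel)"
  proof (rule Bochner_Integration.integrable_bound)
    show "integrable lborel (\<lambda>z::'a. bump \<epsilon> z * B)"
      using integrable_bump[OF \<open>0 < \<epsilon>\<close>] by auto
    have "0 \<le> (\<integral>x. \<bar>F z x\<bar> \<partial>lborel)" for z by (intro Bochner_Integration.integral_nonneg) auto
    then show "AE z in lborel. norm (\<integral>x. norm (case (z, x) of (z, x) \<Rightarrow> bump \<epsilon> z * F z x) \<partial>lborel)
        \<le> norm (bump \<epsilon> z * B)"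
      using bnd by (auto simp: abs_mult intro!: mult_left_mono order_trans[OF _ abs_ge_self])
  qed (simp add: abs_mult)
qed (use int in auto)

text \<open>By Fubini the pairing with the mollification is an average, with total weight 1, of
  pairings of \<open>u\<close> with translates of \<open>f\<close>. It is meant for \<open>f\<close>
  the divergence of a test field, whose translates are divergences of translated fields.\<close>

lemma mollify_pairing_le:
  fixes u f :: "'a::euclidean_space \<Rightarrow> real"
  assumes u: "integrable lborel u" and f[measurable]: "f \<in> borel_measurable borel"
    and bnd: "\<And>x. \<bar>f x\<bar> \<le> C" and "0 < \<epsilon>"
    and le: "\<And>z. norm z < \<epsilon> \<Longrightarrow> (\<integral>x. u x * f (x - z) \<partial>lborel) \<le> A"
  shows "(\<integral>x. mollify \<epsilon> u x * f x \<partial>lborel) \<le> A"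
proof -
  define Z where "Z = (\<integral>y. bump \<epsilon> (y::'a) \<partial>lborel)"
  have Z: "0 < Z" unfolding Z_def by (rule integral_bump_pos[OF \<open>0 < \<epsilon>\<close>])
  have [measurable]: "u \<in> borel_measurable borel" using u by auto
  have int: "integrable lborel (\<lambda>x. u (x + z) * f x)" for z
  proof (rule Bochner_Integration.integrable_bound)
    show "integrable lborel (\<lambda>x. C * u (x + z))"
      using integrable_lborel_translate[OF u] by auto
    show "AE x in lborel. norm (u (x + z) * f x) \<le> norm (C * u (x + z))"
      using bnd by (intro AE_I2) (auto simp: abs_mult mult.commute intro!: mult_right_mono order_trans[OF bnd abs_ge_self])
  qed measurable
  have I: "integrable (lborel \<Otimes>\<^sub>M lborel) (\<lambda>(z, x). bump \<epsilon> z * (u (x + z) * f x))"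
  proof (rule integrable_bump_mult[OF _ int _ \<open>0 < \<epsilon>\<close>])
    fix z
    have "(\<integral>x. \<bar>u (x + z) * f x\<bar> \<partial>lborel) \<le> (\<integral>x. \<bar>u (x + z)\<bar> * C \<partial>lborel)"
      using integrable_abs[OF int[of z]] integrable_lborel_translate[OF u, of z] bnd
      by (intro integral_mono) (auto simp: abs_mult intro!: mult_left_mono)
    also have "\<dots> = (\<integral>x. \<bar>u x\<bar> * C \<partial>lborel)"
      by (rule integral_lborel_translate[of "\<lambda>x. \<bar>u x\<bar> * C"]) measurable
    finally show "(\<integral>x. \<bar>u (x + z) * f x\<bar> \<partial>lborel) \<le> (\<integral>x. \<bar>u x\<bar> * C \<partial>lborel)" .
  qed measurable
  have "(\<integral>x. mollify \<epsilon> u x * f x \<partial>lborel) = (\<integral>x. (\<integral>z. bump \<epsilon> z * (u (x + z) * f x) \<partial>lborel) / Z \<partial>lborel)"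
    by (intro Bochner_Integration.integral_cong) (auto simp: mollify_eq_shift Z_def mult.assoc[symmetric])
  also have "\<dots> = (\<integral>x. (\<integral>z. bump \<epsilon> z * (u (x + z) * f x) \<partial>lborel) \<partial>lborel) / Z"
    by simp
  also have "(\<integral>x. (\<integral>z. bump \<epsilon> z * (u (x + z) * f x) \<partial>lborel) \<partial>lborel)
      = (\<integral>z. (\<integral>x. bump \<epsilon> z * (u (x + z) * f x) \<partial>lborel) \<partial>lborel)"
    by (rule lborel_pair.Fubini_integral[OF I])
  also have "\<dots> \<le> (\<integral>z. bump \<epsilon> z * A \<partial>(lborel::'a measure))"
  proof (rule integral_mono)
    show "integrable lborel (\<lambda>z. \<integral>x. bump \<epsilon> z * (u (x + z) * f x) \<partial>lborel)"
      using lborel_pair.integrable_fst'[OF I] by simp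
    show "integrable lborel (\<lambda>z::'a. bump \<epsilon> z * A)" using integrable_bump[OF \<open>0 < \<epsilon>\<close>] by auto
    fix z :: 'a
    have "(\<integral>x. u (x + z) * f x \<partial>lborel) = (\<integral>x. u x * f (x - z) \<partial>lborel)"
      using integral_lborel_translate[of "\<lambda>x. u x * f (x - z)" z] by simp
    then show "(\<integral>x. bump \<epsilon> z * (u (x + z) * f x) \<partial>lborel) \<le> bump \<epsilon> z * A"
      using le[of z] bump_eq_0[of \<epsilon> z] \<open>0 < \<epsilon>\<close> by (cases "norm z < \<epsilon>") (auto intro!: mult_left_mono)
  qed
  also have "\<dots> / Z = A" using Z by (simp add: Z_def)
  finally show ?thesis using Z by (simp add: divide_right_mono)
qed

text \<open>The difference between the mollification and \<open>u\<close> is an average of the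
  differences u(x + z) - u(x) with |z| < \<epsilon>, so Fubini bounds its norm by the largest of
  theirs. Integrability of the mollification follows by adding \<open>u\<close> back.\<close>

lemma L1_mollify:
  fixes u :: "'a::euclidean_space \<Rightarrow> real"
  assumes u: "integrable lborel u" and "0 < \<epsilon>"
    and le: "\<And>z. norm z < \<epsilon> \<Longrightarrow> (\<integral>x. \<bar>u (x + z) - u x\<bar> \<partial>lborel) \<le> e"
  shows "integrable lborel (mollify \<epsilon> u)" "(\<integral>x. \<bar>mollify \<epsilon> u x - u x\<bar> \<partial>lborel) \<le> e"
proof -
  define Z where "Z = (\<integral>y. bump \<epsilon> (y::'a) \<partial>lborel)"
  have Z: "0 < Z" unfolding Z_def by (rule integral_bump_pos[OF \<open>0 < \<epsilon>\<close>])
  have [measurable]: "u \<in> borel_measurable borel" using u by auto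
  note tr = integrable_lborel_translate[OF u]
  have int: "integrable lborel (\<lambda>x. u (x + z) - u x)" for z
    using u tr by auto
  have I: "integrable (lborel \<Otimes>\<^sub>M lborel) (\<lambda>(z, x). bump \<epsilon> z * (u (x + z) - u x))"
  proof (rule integrable_bump_mult[OF _ int _ \<open>0 < \<epsilon>\<close>])
    fix z
    have "(\<integral>x. \<bar>u (x + z) - u x\<bar> \<partial>lborel) \<le> (\<integral>x. \<bar>u (x + z)\<bar> + \<bar>u x\<bar> \<partial>lborel)"
      using int[of z] tr[of z] u by (intro integral_mono) auto
    also have "\<dots> = (\<integral>x. \<bar>u (x + z)\<bar> \<partial>lborel) + (\<integral>x. \<bar>u x\<bar> \<partial>lborel)"
      using tr[of z] u by simp
    also have "(\<integral>x. \<bar>u (x + z)\<bar> \<partial>lborel) = (\<integral>x. \<bar>u x\<bar> \<partial>lborel)"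
      by (rule integral_lborel_translate[of "\<lambda>x. \<bar>u x\<bar>"]) measurable
    finally show "(\<integral>x. \<bar>u (x + z) - u x\<bar> \<partial>lborel) \<le> (\<integral>x. \<bar>u x\<bar> \<partial>lborel) + (\<integral>x. \<bar>u x\<bar> \<partial>lborel)" .
  qed measurable
  have eq: "mollify \<epsilon> u x - u x = (\<integral>z. bump \<epsilon> z * (u (x + z) - u x) \<partial>lborel) / Z" for x
  proof -
    have "integrable lborel (\<lambda>z. bump \<epsilon> z * u (x + z))"
    proof (rule Bochner_Integration.integrable_bound)
      show "integrable lborel (\<lambda>z. \<epsilon> ^ 4 * \<bar>u (z + x)\<bar>)" using tr by auto
      show "AE z in lborel. norm (bump \<epsilon> z * u (x + z)) \<le> norm (\<epsilon> ^ 4 * \<bar>u (z + x)\<bar>)"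
        using bump_le[of \<epsilon>] by (intro AE_I2) (auto simp: abs_mult add.commute intro!: mult_right_mono)
    qed measurable
    then have "(\<integral>z. bump \<epsilon> z * (u (x + z) - u x) \<partial>lborel) = (\<integral>z. bump \<epsilon> z * u (x + z) \<partial>lborel) - Z * u x"
      using integrable_bump[OF \<open>0 < \<epsilon>\<close>, where 'a='a] by (simp add: right_diff_distrib Z_def)
    then show ?thesis using Z by (simp add: mollify_eq_shift Z_def[symmetric] field_simps)
  qed
  have "integrable lborel (\<lambda>x. \<integral>z. bump \<epsilon> z * (u (x + z) - u x) \<partial>lborel)"
    using lborel_pair.integrable_snd[OF I] .
  then have idiff: "integrable lborel (\<lambda>x. mollify \<epsilon> u x - u x)"
    unfolding eq by auto
  from Bochner_Integration.integrable_add[OF this u] show "integrable lborel (mollify \<epsilon> u)" by simp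
  have In: "integrable (lborel \<Otimes>\<^sub>M lborel) (\<lambda>(z, x). bump \<epsilon> z * \<bar>u (x + z) - u x\<bar>)"
    using integrable_abs[OF I] by (simp add: abs_mult case_prod_unfold)
  have In': "integrable lborel (\<lambda>x. \<integral>z. bump \<epsilon> z * \<bar>u (x + z) - u x\<bar> \<partial>lborel)"
    using lborel_pair.integrable_snd[OF In] .
  have "(\<integral>x. \<bar>mollify \<epsilon> u x - u x\<bar> \<partial>lborel) \<le> (\<integral>x. (\<integral>z. bump \<epsilon> z * \<bar>u (x + z) - u x\<bar> \<partial>lborel) / Z \<partial>lborel)"
  proof (rule integral_mono)
    fix x
    have "\<bar>\<integral>z. bump \<epsilon> z * (u (x + z) - u x) \<partial>lborel\<bar> \<le> (\<integral>z. bump \<epsilon> z * \<bar>u (x + z) - u x\<bar> \<partial>lborel)"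
      using integral_abs_bound[of lborel "\<lambda>z. bump \<epsilon> z * (u (x + z) - u x)"] by (simp add: abs_mult)
    then show "\<bar>mollify \<epsilon> u x - u x\<bar> \<le> (\<integral>z. bump \<epsilon> z * \<bar>u (x + z) - u x\<bar> \<partial>lborel) / Z"
      unfolding eq using Z by (simp add: divide_right_mono)
  qed (use In' idiff in auto)
  also have "\<dots> = (\<integral>x. (\<integral>z. bump \<epsilon> z * \<bar>u (x + z) - u x\<bar> \<partial>lborel) \<partial>lborel) / Z" by simp
  also have "(\<integral>x. (\<integral>z. bump \<epsilon> z * \<bar>u (x + z) - u x\<bar> \<partial>lborel) \<partial>lborel)
      = (\<integral>z. (\<integral>x. bump \<epsilon> z * \<bar>u (x + z) - u x\<bar> \<partial>lborel) \<partial>lborel)"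
    by (rule lborel_pair.Fubini_integral[OF In])
  also have "\<dots> \<le> (\<integral>z. bump \<epsilon> z * e \<partial>(lborel::'a measure))"
  proof (rule integral_mono)
    show "integrable lborel (\<lambda>z. \<integral>x. bump \<epsilon> z * \<bar>u (x + z) - u x\<bar> \<partial>lborel)"
      using lborel_pair.integrable_fst'[OF In] by simp
    show "integrable lborel (\<lambda>z::'a. bump \<epsilon> z * e)" using integrable_bump[OF \<open>0 < \<epsilon>\<close>] by auto
    fix z :: 'a
    show "(\<integral>x. bump \<epsilon> z * \<bar>u (x + z) - u x\<bar> \<partial>lborel) \<le> bump \<epsilon> z * e"
      using le[of z] bump_eq_0[of \<epsilon> z] \<open>0 < \<epsilon>\<close> by (cases "norm z < \<epsilon>") (auto intro!: mult_left_mono)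
  qed
  also have "\<dots> / Z = e" using Z by (simp add: Z_def)
  finally show "(\<integral>x. \<bar>mollify \<epsilon> u x - u x\<bar> \<partial>lborel) \<le> e" using Z by (simp add: divide_right_mono)
qed

section \<open>Submodularity of the total variation\<close>

lemma C1_map_continuous: "C1_map f \<Longrightarrow> continuous_on S f"
  unfolding C1_map_def
  by (meson continuous_at_imp_continuous_on differentiable_imp_continuous_within)

lemma C1_map_continuous_deriv:
  "C1_map f \<Longrightarrow> continuous_on S (\<lambda>x. frechet_derivative f (at x) h)"
  unfolding C1_map_def by (meson continuous_on_subset subset_UNIV)

lemma C1_map_add:
  assumes f: "C1_map f" and g: "C1_map g"
  shows "C1_map (\<lambda>x. f x + g x)"
  by (rule C1_mapI[OF has_derivative_add[OF f[THEN C1_map_has_derivative] g[THEN C1_map_has_derivative]]])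
     (intro continuous_intros C1_map_continuous_deriv f g)

lemma C1_map_diff:
  assumes f: "C1_map f" and g: "C1_map g"
  shows "C1_map (\<lambda>x. f x - g x)"
  by (rule C1_mapI[OF has_derivative_diff[OF f[THEN C1_map_has_derivative] g[THEN C1_map_has_derivative]]])
     (intro continuous_intros C1_map_continuous_deriv f g)

lemma C1_map_scaleR:
  fixes f :: "'a::euclidean_space \<Rightarrow> real" and g :: "'a \<Rightarrow> 'b::real_normed_vector"
  assumes f: "C1_map f" and g: "C1_map g"
  shows "C1_map (\<lambda>x. f x *\<^sub>R g x)"
  by (rule C1_mapI[OF has_derivative_scaleR[OF f[THEN C1_map_has_derivative] g[THEN C1_map_has_derivative]]])
     (intro continuous_intros C1_map_continuous_deriv C1_map_continuous f g)

lemma C1_map_compose_real: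
  fixes f :: "'a::euclidean_space \<Rightarrow> real" and g :: "real \<Rightarrow> real"
  assumes f: "C1_map f" and g: "\<And>s. (g has_real_derivative g' s) (at s)" and g': "continuous_on UNIV g'"
  shows "C1_map (\<lambda>x. g (f x))"
    and "frechet_derivative (\<lambda>x. g (f x)) (at x) = (\<lambda>h. g' (f x) * frechet_derivative f (at x) h)"
proof -
  have der: "((\<lambda>x. g (f x)) has_derivative (\<lambda>h. g' (f x) * frechet_derivative f (at x) h)) (at x)" for x
    using has_derivative_compose[OF f[THEN C1_map_has_derivative] g[unfolded has_field_derivative_def]] .
  then show "frechet_derivative (\<lambda>x. g (f x)) (at x) = (\<lambda>h. g' (f x) * frechet_derivative f (at x) h)"
    by (rule frechet_derivative_at[symmetric])
  show "C1_map (\<lambda>x. g (f x))"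
    by (rule C1_mapI[OF der])
       (intro continuous_intros C1_map_continuous_deriv C1_map_continuous f continuous_on_compose2[OF g'] subset_UNIV)
qed

lemma C1_map_inner_left:
  fixes f :: "'a::euclidean_space \<Rightarrow> 'b::real_inner"
  assumes f: "C1_map f"
  shows "C1_map (\<lambda>x. f x \<bullet> c)"
    and "frechet_derivative (\<lambda>x. f x \<bullet> c) (at x) = (\<lambda>h. frechet_derivative f (at x) h \<bullet> c)"
proof -
  have der: "((\<lambda>x. f x \<bullet> c) has_derivative (\<lambda>h. frechet_derivative f (at x) h \<bullet> c)) (at x)" for x
    by (rule has_derivative_inner_left[OF f[THEN C1_map_has_derivative]])
  then show "frechet_derivative (\<lambda>x. f x \<bullet> c) (at x) = (\<lambda>h. frechet_derivative f (at x) h \<bullet> c)"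
    by (rule frechet_derivative_at[symmetric])
  show "C1_map (\<lambda>x. f x \<bullet> c)"
    by (rule C1_mapI[OF der]) (intro continuous_intros C1_map_continuous_deriv f)
qed

lemma C1_map_translate:
  fixes f :: "'a::euclidean_space \<Rightarrow> 'b::real_normed_vector"
  assumes f: "C1_map f"
  shows "C1_map (\<lambda>x. f (x - z))"
    and "frechet_derivative (\<lambda>x. f (x - z)) (at x) = frechet_derivative f (at (x - z))"
proof -
  have der: "((\<lambda>x. f (x - z)) has_derivative (\<lambda>h. frechet_derivative f (at (x - z)) h)) (at x)" for x
    by (rule has_derivative_compose[of "\<lambda>x. x - z" "\<lambda>h. h", OF _ f[THEN C1_map_has_derivative]])
       (auto intro!: derivative_eq_intros)
  then show "frechet_derivative (\<lambda>x. f (x - z)) (at x) = frechet_derivative f (at (x - z))"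
    by (rule frechet_derivative_at[symmetric])
  show "C1_map (\<lambda>x. f (x - z))"
    by (rule C1_mapI[OF der])
       (intro continuous_on_compose2[OF C1_map_continuous_deriv[OF f, of UNIV]] continuous_intros, auto)
qed

section \<open>Compactly supported functions and integration by parts\<close>

lemma frechet_derivative_outside:
  assumes "closed K" and 0: "\<And>x. x \<notin> K \<Longrightarrow> f x = 0" and "x \<notin> K"
  shows "frechet_derivative f (at x) h = 0"
proof -
  have "((\<lambda>x. 0) has_derivative (\<lambda>h. 0)) (at x)" by simp
  then have "(f has_derivative (\<lambda>h. 0)) (at x)"
    by (rule has_derivative_transform_within_open[of _ _ _ _ "- K"]) (use assms in auto)
  then have "frechet_derivative f (at x) = (\<lambda>h. 0)" by (rule frechet_derivative_at[symmetric])
  then show ?thesis by simp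
qed

lemma integrable_compact_support:
  fixes f :: "'a::euclidean_space \<Rightarrow> real"
  assumes "continuous_on UNIV f" "compact K" and "\<And>x. x \<notin> K \<Longrightarrow> f x = 0"
  shows "integrable lborel f"
proof -
  have "integrable lborel (\<lambda>x. indicator K x *\<^sub>R f x)"
    using borel_integrable_compact[OF \<open>compact K\<close> continuous_on_subset[OF assms(1)]] by simp
  moreover have "(\<lambda>x. indicator K x *\<^sub>R f x) = f"
    using assms(3) by (intro ext) (auto simp: indicator_def)
  ultimately show ?thesis by simp
qed

lemma bounded_compact_support:
  fixes f :: "'a::euclidean_space \<Rightarrow> real"
  assumes "continuous_on UNIV f" "compact K" and "\<And>x. x \<notin> K \<Longrightarrow> f x = 0"
  obtains B where "0 \<le> B" "\<And>x. \<bar>f x\<bar> \<le> B"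
proof -
  have "bounded (f ` K)"
    using assms by (intro compact_imp_bounded compact_continuous_image continuous_on_subset[OF assms(1)]) auto
  then obtain B where B: "\<And>x. x \<in> K \<Longrightarrow> \<bar>f x\<bar> \<le> B"
    by (auto simp: bounded_iff)
  show thesis
  proof (rule that[of "max 0 B"])
    show "\<bar>f x\<bar> \<le> max 0 B" for x
      using B[of x] assms(3)[of x] by (cases "x \<in> K") auto
  qed simp
qed

text \<open>Every difference quotient has integral 0 by translation invariance, and the quotients
  converge dominatedly to the derivative; no iterated integration along coordinate lines is
  involved.\<close>

lemma integral_directional_derivative_eq_0:
  fixes f :: "'a::euclidean_space \<Rightarrow> real"
  assumes f: "C1_map f" and K: "compact K" and 0: "\<And>x. x \<notin> K \<Longrightarrow> f x = 0"
  shows "(\<integral>x. frechet_derivative f (at x) h \<partial>lborel) = 0"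
proof -
  let ?f' = "\<lambda>x. frechet_derivative f (at x) h"
  have cont: "continuous_on UNIV f" "continuous_on UNIV ?f'"
    using f by (auto intro: C1_map_continuous C1_map_continuous_deriv)
  then have [measurable]: "f \<in> borel_measurable borel" "?f' \<in> borel_measurable borel"
    by (auto intro: borel_measurable_continuous_onI)
  have out: "\<And>x. x \<notin> K \<Longrightarrow> ?f' x = 0"
    by (rule frechet_derivative_outside[OF compact_imp_closed[OF K] 0])
  obtain B where B: "0 \<le> B" "\<And>x. \<bar>?f' x\<bar> \<le> B"
    using bounded_compact_support[OF cont(2) K out] by blast
  obtain R where R: "\<And>x. x \<in> K \<Longrightarrow> norm x \<le> R"
    using compact_imp_bounded[OF K] by (auto simp: bounded_iff)
  have line: "((\<lambda>t. f (x + t *\<^sub>R h)) has_real_derivative ?f' (x + t *\<^sub>R h)) (at t)" for x t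
  proof -
    have "((\<lambda>t. f (x + t *\<^sub>R h)) has_derivative (\<lambda>s. frechet_derivative f (at (x + t *\<^sub>R h)) (s *\<^sub>R h))) (at t)"
      by (rule has_derivative_compose[OF _ f[THEN C1_map_has_derivative]]) (auto intro!: derivative_eq_intros)
    moreover have "frechet_derivative f (at (x + t *\<^sub>R h)) (s *\<^sub>R h) = ?f' (x + t *\<^sub>R h) * s" for s
      using linear_cmul[OF linear_frechet_derivative, of f "at (x + t *\<^sub>R h)"] f by (simp add: C1_map_def)
    ultimately show ?thesis by (simp add: has_field_derivative_def)
  qed
  define q where "q n x = (f (x + (1 / real (Suc n)) *\<^sub>R h) - f x) * real (Suc n)" for n x
  have q: "(\<lambda>n. q n x) \<longlonglongrightarrow> ?f' x" for x
  proof -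
    have 1: "((\<lambda>t. (f (x + t *\<^sub>R h) - f x) / t) \<longlongrightarrow> ?f' x) (at 0)"
      using line[of x 0] by (simp add: has_field_derivative_iff)
    have 2: "filterlim (\<lambda>n. 1 / real (Suc n)) (at 0) sequentially"
      unfolding filterlim_at using LIMSEQ_inverse_real_of_nat by (auto simp: inverse_eq_divide)
    show ?thesis
      using filterlim_compose[OF 1 2] unfolding q_def by (simp only: divide_divide_eq_right div_by_1)
  qed
  have "(\<lambda>n. \<integral>x. q n x \<partial>lborel) \<longlonglongrightarrow> (\<integral>x. ?f' x \<partial>lborel)"
  \<comment> \<open>Outside this ball neither x nor the shifted point lies in \<open>K\<close>, so
    the quotient vanishes; inside it the mean value theorem bounds the quotient by
    \<open>B\<close>.\<close>
  proof (rule integral_dominated_convergence[where w="\<lambda>x. B * indicat_real (cball 0 (R + norm h)) x"])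
    show "integrable lborel (\<lambda>x::'a. B * indicat_real (cball 0 (R + norm h)) x)"
      using emeasure_lborel_cball_finite[of "0::'a" "R + norm h"]
      by (intro integrable_mult_right integrable_real_indicator) auto
    show "q n \<in> borel_measurable lborel" for n unfolding q_def by measurable
    show "AE x in lborel. norm (q n x) \<le> B * indicat_real (cball 0 (R + norm h)) x" for n
    proof (rule AE_I2)
      fix x
      have small: "norm ((1 / real (Suc n)) *\<^sub>R h) \<le> norm h"
        using mult_right_mono[of "1 / real (Suc n)" 1 "norm h"] by simp
      show "norm (q n x) \<le> B * indicat_real (cball 0 (R + norm h)) x"
      proof (cases "norm x \<le> R + norm h")
        case True
        obtain t where "f (x + (1 / real (Suc n)) *\<^sub>R h) - f (x + 0 *\<^sub>R h) = (1 / real (Suc n) - 0) * ?f' (x + t *\<^sub>R h)"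
          using MVT2[of 0 "1 / real (Suc n)" "\<lambda>t. f (x + t *\<^sub>R h)" "\<lambda>t. ?f' (x + t *\<^sub>R h)"] line by auto
        then have "q n x = ?f' (x + t *\<^sub>R h)" by (simp add: q_def)
        then show ?thesis using B True by simp
      next
        case False
        have "x \<notin> K" using R[of x] False norm_ge_zero[of h] by fastforce
        moreover have "x + (1 / real (Suc n)) *\<^sub>R h \<notin> K"
        proof
          assume "x + (1 / real (Suc n)) *\<^sub>R h \<in> K"
          from R[OF this] show False
            using small norm_triangle_ineq4[of "x + (1 / real (Suc n)) *\<^sub>R h" "(1 / real (Suc n)) *\<^sub>R h"] False
            by simp
        qed
        ultimately show ?thesis using False by (simp add: q_def 0)
      qed
    qed
  qed (use q in auto)
  moreover have "(\<integral>x. q n x \<partial>lborel) = 0" for n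
    using integral_lborel_translate[of f "(1 / real (Suc n)) *\<^sub>R h"] integrable_compact_support[OF cont(1) K 0]
      integrable_lborel_translate[of f "(1 / real (Suc n)) *\<^sub>R h"] by (simp add: q_def)
  ultimately show ?thesis by (simp add: LIMSEQ_const_iff)
qed

lemma continuous_on_divergence: "C1_map \<phi> \<Longrightarrow> continuous_on S (divergence \<phi>)"
  unfolding divergence_def by (intro continuous_intros C1_map_continuous_deriv)

lemma divergence_outside:
  assumes "closed K" "\<And>x. x \<notin> K \<Longrightarrow> \<phi> x = 0" "x \<notin> K"
  shows "divergence \<phi> x = 0"
  using frechet_derivative_outside[OF assms] by (simp add: divergence_def)

lemma frechet_derivative_basis_expansion:
  fixes m :: "'a::euclidean_space \<Rightarrow> real"
  assumes "C1_map m"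
  shows "frechet_derivative m (at x) w = (\<Sum>b\<in>Basis. (w \<bullet> b) * frechet_derivative m (at x) b)"
proof -
  have lin: "linear (frechet_derivative m (at x))"
    using assms by (intro linear_frechet_derivative) (simp add: C1_map_def)
  have "frechet_derivative m (at x) w = frechet_derivative m (at x) (\<Sum>b\<in>Basis. (w \<bullet> b) *\<^sub>R b)"
    by (simp add: euclidean_representation)
  also have "\<dots> = (\<Sum>b\<in>Basis. (w \<bullet> b) * frechet_derivative m (at x) b)"
    by (simp add: linear_sum[OF lin] linear_cmul[OF lin])
  finally show ?thesis .
qed

lemma integrable_mult_divergence:
  fixes m :: "'a::euclidean_space \<Rightarrow> real"
  assumes m: "C1_map m" and \<phi>: "C1_map \<phi>" and K: "compact K" and 0: "\<And>x. x \<notin> K \<Longrightarrow> \<phi> x = 0"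
  shows "integrable lborel (\<lambda>x. m x * divergence \<phi> x)"
    and "integrable lborel (\<lambda>x. frechet_derivative m (at x) (\<phi> x))"
proof -
  show "integrable lborel (\<lambda>x. m x * divergence \<phi> x)"
    by (rule integrable_compact_support[OF _ K])
       (auto intro!: continuous_on_mult continuous_on_divergence[OF \<phi>] C1_map_continuous[OF m]
         simp: divergence_outside[OF compact_imp_closed[OF K] 0])
  show "integrable lborel (\<lambda>x. frechet_derivative m (at x) (\<phi> x))"
    unfolding frechet_derivative_basis_expansion[OF m, of _ "\<phi> _"]
    by (rule integrable_compact_support[OF _ K])
       (auto intro!: continuous_intros C1_map_continuous_deriv[OF m] C1_map_continuous[OF \<phi>] simp: 0)
qed

text \<open>The product rule for the field m \<phi>, whose divergence integrates to 0 because each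
  of its components has compact support.\<close>

lemma integral_mult_divergence:
  fixes m :: "'a::euclidean_space \<Rightarrow> real"
  assumes m: "C1_map m" and \<phi>: "C1_map \<phi>" and K: "compact K" and 0: "\<And>x. x \<notin> K \<Longrightarrow> \<phi> x = 0"
  shows "(\<integral>x. m x * divergence \<phi> x \<partial>lborel) = - (\<integral>x. frechet_derivative m (at x) (\<phi> x) \<partial>lborel)"
proof -
  let ?F = "\<lambda>x. m x *\<^sub>R \<phi> x"
  have F: "C1_map ?F" by (rule C1_map_scaleR[OF m \<phi>])
  have der: "frechet_derivative ?F (at x) = (\<lambda>h. m x *\<^sub>R frechet_derivative \<phi> (at x) h + frechet_derivative m (at x) h *\<^sub>R \<phi> x)" for x
    by (rule frechet_derivative_at[symmetric],
        rule has_derivative_scaleR[OF m[THEN C1_map_has_derivative] \<phi>[THEN C1_map_has_derivative]])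
  have "divergence ?F x = m x * divergence \<phi> x + frechet_derivative m (at x) (\<phi> x)" for x
    unfolding frechet_derivative_basis_expansion[OF m, of x "\<phi> x"]
    by (simp add: divergence_def der inner_add_left sum.distrib sum_distrib_left mult.commute)
  then have "(\<integral>x. divergence ?F x \<partial>lborel)
      = (\<integral>x. m x * divergence \<phi> x \<partial>lborel) + (\<integral>x. frechet_derivative m (at x) (\<phi> x) \<partial>lborel)"
    using integrable_mult_divergence[OF assms] by simp
  moreover have "(\<integral>x. divergence ?F x \<partial>lborel) = 0"
  proof -
    have C: "C1_map (\<lambda>x. ?F x \<bullet> b)" for b by (rule C1_map_inner_left[OF F])
    have fd: "frechet_derivative ?F (at x) b \<bullet> b = frechet_derivative (\<lambda>x. ?F x \<bullet> b) (at x) b" for x b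
      using C1_map_inner_left(2)[OF F, of b x] by simp
    have int: "integrable lborel (\<lambda>x. frechet_derivative (\<lambda>x. ?F x \<bullet> b) (at x) b)" for b
      by (rule integrable_compact_support[OF C1_map_continuous_deriv[OF C] K])
         (rule frechet_derivative_outside[OF compact_imp_closed[OF K]], auto simp: 0)
    have "(\<integral>x. divergence ?F x \<partial>lborel)
        = (\<Sum>b\<in>Basis. \<integral>x. frechet_derivative (\<lambda>x. ?F x \<bullet> b) (at x) b \<partial>lborel)"
      unfolding divergence_def fd by (rule Bochner_Integration.integral_sum[OF int])
    also have "\<dots> = 0"
      by (intro sum.neutral ballI integral_directional_derivative_eq_0[OF C K]) (simp add: 0)
    finally show ?thesis .
  qed
  ultimately show ?thesis by simp
qed

text \<open>The positive part is (s + |s|) / 2; the modulus is replaced by the root of s^2 +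
  \<delta>^2.\<close>

definition smooth_pos :: "real \<Rightarrow> real \<Rightarrow> real" where
  "smooth_pos \<delta> s = (s + sqrt (s\<^sup>2 + \<delta>\<^sup>2)) / 2"

definition smooth_step :: "real \<Rightarrow> real \<Rightarrow> real" where
  "smooth_step \<delta> s = (1 + s / sqrt (s\<^sup>2 + \<delta>\<^sup>2)) / 2"

lemma smooth_pos_derivative:
  assumes "0 < \<delta>"
  shows "(smooth_pos \<delta> has_real_derivative smooth_step \<delta> s) (at s)"
proof -
  have "0 < s\<^sup>2 + \<delta>\<^sup>2" using assms by (simp add: add_nonneg_pos)
  then show ?thesis
    unfolding smooth_pos_def[abs_def] smooth_step_def
    by (auto intro!: derivative_eq_intros simp: field_simps)
qed

lemma continuous_on_smooth_step: "0 < \<delta> \<Longrightarrow> continuous_on S (smooth_step \<delta>)"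
  unfolding smooth_step_def[abs_def]
  by (intro continuous_intros) (auto simp: sum_power2_eq_zero_iff)

text \<open>A second derivative of \<open>smooth_pos\<close> is taken because
  \<open>smooth_step\<close>, its first one, becomes the weight in convex combinations of test
  fields, which must again be C1.\<close>

lemma smooth_step_derivative:
  assumes "0 < \<delta>"
  shows "(smooth_step \<delta> has_real_derivative
    (sqrt (s\<^sup>2 + \<delta>\<^sup>2) - s * (s / sqrt (s\<^sup>2 + \<delta>\<^sup>2))) / (s\<^sup>2 + \<delta>\<^sup>2) / 2) (at s)"
proof -
  have p: "0 < s\<^sup>2 + \<delta>\<^sup>2" using assms by (simp add: add_nonneg_pos)
  have r: "((\<lambda>s. sqrt (s\<^sup>2 + \<delta>\<^sup>2)) has_real_derivative s / sqrt (s\<^sup>2 + \<delta>\<^sup>2)) (at s)"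
    using p by (auto intro!: derivative_eq_intros simp: field_simps)
  have "((\<lambda>s. s / sqrt (s\<^sup>2 + \<delta>\<^sup>2)) has_real_derivative
      (1 * sqrt (s\<^sup>2 + \<delta>\<^sup>2) - s * (s / sqrt (s\<^sup>2 + \<delta>\<^sup>2))) / (sqrt (s\<^sup>2 + \<delta>\<^sup>2) * sqrt (s\<^sup>2 + \<delta>\<^sup>2))) (at s)"
    by (rule DERIV_divide[OF DERIV_ident r]) (use assms in simp)
  from DERIV_cdivide[OF DERIV_add[OF DERIV_const[of 1] this], of 2] show ?thesis
    unfolding smooth_step_def[abs_def] using p by simp
qed

lemma smooth_step_bounds:
  assumes "0 < \<delta>"
  shows "0 \<le> smooth_step \<delta> s" "smooth_step \<delta> s \<le> 1"
proof -
  have p: "0 < s\<^sup>2 + \<delta>\<^sup>2" using assms by (simp add: add_nonneg_pos)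
  have "\<bar>s\<bar> \<le> sqrt (s\<^sup>2 + \<delta>\<^sup>2)" by (rule real_le_rsqrt) simp
  then have "\<bar>s / sqrt (s\<^sup>2 + \<delta>\<^sup>2)\<bar> \<le> 1" using p by (simp add: abs_divide)
  from abs_le_D1[OF this] abs_le_D2[OF this] show "0 \<le> smooth_step \<delta> s" "smooth_step \<delta> s \<le> 1"
    unfolding smooth_step_def by simp_all
qed

lemma smooth_pos_approx:
  assumes "0 < \<delta>"
  shows "\<bar>smooth_pos \<delta> s - max 0 s\<bar> \<le> \<delta>"
proof -
  have "\<bar>s\<bar> \<le> sqrt (s\<^sup>2 + \<delta>\<^sup>2)" by (rule real_le_rsqrt) simp
  moreover have "sqrt (s\<^sup>2 + \<delta>\<^sup>2) \<le> \<bar>s\<bar> + \<delta>"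
    using assms sqrt_sum_squares_le_sum_abs[of s \<delta>] by simp
  ultimately show ?thesis using assms by (auto simp: smooth_pos_def abs_le_iff max_def)
qed

text \<open>Unlike in \<open>BV_test_fields\<close>, the support set is a parameter: the
  mollification radius depends on it and has to be chosen before the new fields are constructed from
  the mollified functions.\<close>

definition test_field_on :: "'a::euclidean_space set \<Rightarrow> ('a \<Rightarrow> 'a) \<Rightarrow> bool" where
  "test_field_on K \<phi> \<longleftrightarrow> C1_map \<phi> \<and> (\<forall>x. x \<notin> K \<longrightarrow> \<phi> x = 0) \<and> (\<forall>x. norm (\<phi> x) \<le> 1)"

lemma test_field_onD:
  assumes "test_field_on K \<phi>"
  shows "C1_map \<phi>" "\<And>x. x \<notin> K \<Longrightarrow> \<phi> x = 0" "\<And>x. norm (\<phi> x) \<le> 1"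
  using assms by (auto simp: test_field_on_def)

lemma BV_test_fields_iff:
  "\<phi> \<in> BV_test_fields \<Omega> \<longleftrightarrow> (\<exists>K. compact K \<and> K \<subseteq> \<Omega> \<and> test_field_on K \<phi>)"
  unfolding BV_test_fields_def test_field_on_def by auto

lemma BV_test_fields_translate:
  assumes \<phi>: "test_field_on K \<phi>" and K: "compact K"
    and d: "(\<Union>x\<in>K. ball x d) \<subseteq> \<Omega>" and z: "norm z < d"
  shows "(\<lambda>x. \<phi> (x - z)) \<in> BV_test_fields \<Omega>"
  unfolding BV_test_fields_iff
proof (intro exI[of _ "(+) z ` K"] conjI)
  show "compact ((+) z ` K)" by (rule compact_translation[OF K])
  show "(+) z ` K \<subseteq> \<Omega>" using d z by (auto simp: subset_eq dist_norm)
  have "x \<in> (+) z ` K" if "x - z \<in> K" for x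
    using imageI[OF that, of "(+) z"] by simp
  then show "test_field_on ((+) z ` K) (\<lambda>x. \<phi> (x - z))"
    using C1_map_translate(1)[OF test_field_onD(1)[OF \<phi>]] \<phi> by (auto simp: test_field_on_def)
qed

text \<open>For C1 functions the smoothed minimum and maximum have the gradients
  \<open>(1 - k) \<nabla>u + k \<nabla>v\<close> and \<open>k \<nabla>u + (1 - k) \<nabla>v\<close> with \<open>0 \<le> k \<le> 1\<close>, and the convex
  combinations can be moved onto the test fields.\<close>

lemma C1_map_smooth_pos:
  fixes u v :: "'a::euclidean_space \<Rightarrow> real"
  assumes "C1_map u" "C1_map v" "0 < \<delta>"
  shows "C1_map (\<lambda>x. smooth_pos \<delta> (u x - v x))"
  by (rule C1_map_compose_real(1)[OF C1_map_diff smooth_pos_derivative continuous_on_smooth_step])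
     (use assms in auto)

lemma smooth_min_max_divergence:
  fixes u v :: "'a::euclidean_space \<Rightarrow> real"
  assumes u: "C1_map u" and v: "C1_map v" and "0 < \<delta>" and K: "compact K"
    and t\<phi>: "test_field_on K \<phi>" and t\<psi>: "test_field_on K \<psi>"
  shows "\<exists>\<theta> \<eta>. test_field_on K \<theta> \<and> test_field_on K \<eta> \<and>
    (\<integral>x. (u x - smooth_pos \<delta> (u x - v x)) * divergence \<phi> x \<partial>lborel)
       + (\<integral>x. (v x + smooth_pos \<delta> (u x - v x)) * divergence \<psi> x \<partial>lborel)
     = (\<integral>x. u x * divergence \<theta> x \<partial>lborel) + (\<integral>x. v x * divergence \<eta> x \<partial>lborel)"
proof -
  note \<phi> = test_field_onD(1)[OF t\<phi>] and \<phi>0 = test_field_onD(2)[OF t\<phi>] and \<phi>1 = test_field_onD(3)[OF t\<phi>]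
  note \<psi> = test_field_onD(1)[OF t\<psi>] and \<psi>0 = test_field_onD(2)[OF t\<psi>] and \<psi>1 = test_field_onD(3)[OF t\<psi>]
  let ?w = "\<lambda>x. u x - v x"
  let ?m = "\<lambda>x. u x - smooth_pos \<delta> (u x - v x)" and ?M = "\<lambda>x. v x + smooth_pos \<delta> (u x - v x)"
  let ?k = "\<lambda>x. smooth_step \<delta> (u x - v x)"
  have w: "C1_map ?w" by (rule C1_map_diff[OF u v])
  note h = smooth_pos_derivative[OF \<open>0 < \<delta>\<close>] continuous_on_smooth_step[OF \<open>0 < \<delta>\<close>, of UNIV]
  have p: "C1_map (\<lambda>x. smooth_pos \<delta> (?w x))" by (rule C1_map_smooth_pos[OF u v \<open>0 < \<delta>\<close>])
  have k: "C1_map ?k"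
  proof (rule C1_map_compose_real(1)[OF w smooth_step_derivative[OF \<open>0 < \<delta>\<close>]])
    have "s\<^sup>2 + \<delta>\<^sup>2 \<noteq> 0" for s using \<open>0 < \<delta>\<close> by (simp add: sum_power2_eq_zero_iff)
    then show "continuous_on UNIV (\<lambda>s. (sqrt (s\<^sup>2 + \<delta>\<^sup>2) - s * (s / sqrt (s\<^sup>2 + \<delta>\<^sup>2))) / (s\<^sup>2 + \<delta>\<^sup>2) / 2)"
      by (intro continuous_intros) auto
  qed
  have m: "C1_map ?m" and M: "C1_map ?M"
    by (rule C1_map_diff[OF u p], rule C1_map_add[OF v p])
  \<comment> \<open>The coefficients of the gradients of u and v in the sum of the two pairings,
    collected. Both are pointwise convex combinations of \<phi> and \<psi> with weight
    \<open>?k\<close>, which preserves the norm bound.\<close>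
  define \<theta> where "\<theta> x = \<phi> x + ?k x *\<^sub>R (\<psi> x - \<phi> x)" for x
  define \<eta> where "\<eta> x = \<psi> x - ?k x *\<^sub>R (\<psi> x - \<phi> x)" for x
  have \<theta>: "C1_map \<theta>" and \<eta>: "C1_map \<eta>"
    unfolding \<theta>_def[abs_def] \<eta>_def[abs_def]
    by (intro C1_map_add C1_map_diff C1_map_scaleR \<phi> \<psi> k)+
  have \<theta>0: "x \<notin> K \<Longrightarrow> \<theta> x = 0" and \<eta>0: "x \<notin> K \<Longrightarrow> \<eta> x = 0" for x
    by (simp_all add: \<theta>_def \<eta>_def \<phi>0 \<psi>0)
  have convex: "norm ((1 - t) *\<^sub>R a + t *\<^sub>R b) \<le> 1" if "norm a \<le> 1" "norm b \<le> 1" "0 \<le> t" "t \<le> 1" for t and a b :: 'a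
  proof -
    have "norm ((1 - t) *\<^sub>R a + t *\<^sub>R b) \<le> (1 - t) * norm a + t * norm b"
      using that norm_triangle_ineq[of "(1 - t) *\<^sub>R a" "t *\<^sub>R b"] by simp
    also have "\<dots> \<le> (1 - t) * 1 + t * 1" using that by (intro add_mono mult_left_mono) auto
    finally show ?thesis by simp
  qed
  have \<theta>1: "norm (\<theta> x) \<le> 1" for x
    using convex[OF \<phi>1[of x] \<psi>1[of x] smooth_step_bounds[OF \<open>0 < \<delta>\<close>, of "?w x"]] by (simp add: \<theta>_def algebra_simps)
  have \<eta>1: "norm (\<eta> x) \<le> 1" for x
    using convex[OF \<psi>1[of x] \<phi>1[of x] smooth_step_bounds[OF \<open>0 < \<delta>\<close>, of "?w x"]] by (simp add: \<eta>_def algebra_simps)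
  have du: "(u has_derivative frechet_derivative u (at x)) (at x)" and dv: "(v has_derivative frechet_derivative v (at x)) (at x)" for x
    using u v by (auto intro: C1_map_has_derivative)
  have dw: "frechet_derivative ?w (at x) = (\<lambda>h. frechet_derivative u (at x) h - frechet_derivative v (at x) h)" for x
    by (rule frechet_derivative_at[symmetric], rule has_derivative_diff[OF du dv])
  have dp: "((\<lambda>x. smooth_pos \<delta> (?w x)) has_derivative
      (\<lambda>h. ?k x * (frechet_derivative u (at x) h - frechet_derivative v (at x) h))) (at x)" for x
    using C1_map_has_derivative[OF p, of x] unfolding C1_map_compose_real(2)[OF w h] dw .
  have dm: "frechet_derivative ?m (at x) = (\<lambda>h. frechet_derivative u (at x) h
      - ?k x * (frechet_derivative u (at x) h - frechet_derivative v (at x) h))" for x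
    by (rule frechet_derivative_at[symmetric], rule has_derivative_diff[OF du dp])
  have dM: "frechet_derivative ?M (at x) = (\<lambda>h. frechet_derivative v (at x) h
      + ?k x * (frechet_derivative u (at x) h - frechet_derivative v (at x) h))" for x
    by (rule frechet_derivative_at[symmetric], rule has_derivative_add[OF dv dp])
  have lu: "linear (frechet_derivative u (at x))" and lv: "linear (frechet_derivative v (at x))" for x
    using u v by (auto intro!: linear_frechet_derivative simp: C1_map_def)
  have pt: "frechet_derivative ?m (at x) (\<phi> x) + frechet_derivative ?M (at x) (\<psi> x)
     = frechet_derivative u (at x) (\<theta> x) + frechet_derivative v (at x) (\<eta> x)" for x
    unfolding dm dM \<theta>_def \<eta>_def
    by (simp add: linear_add[OF lu] linear_diff[OF lu] linear_cmul[OF lu]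
        linear_add[OF lv] linear_diff[OF lv] linear_cmul[OF lv] algebra_simps)
  have "(\<integral>x. ?m x * divergence \<phi> x \<partial>lborel) + (\<integral>x. ?M x * divergence \<psi> x \<partial>lborel)
      = - (\<integral>x. frechet_derivative ?m (at x) (\<phi> x) + frechet_derivative ?M (at x) (\<psi> x) \<partial>lborel)"
    using integrable_mult_divergence(2)[OF m \<phi> K \<phi>0] integrable_mult_divergence(2)[OF M \<psi> K \<psi>0]
    by (simp add: integral_mult_divergence[OF m \<phi> K \<phi>0] integral_mult_divergence[OF M \<psi> K \<psi>0])
  also have "\<dots> = (\<integral>x. u x * divergence \<theta> x \<partial>lborel) + (\<integral>x. v x * divergence \<eta> x \<partial>lborel)"
    unfolding pt
    using integrable_mult_divergence(2)[OF u \<theta> K \<theta>0] integrable_mult_divergence(2)[OF v \<eta> K \<eta>0]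
    by (simp add: integral_mult_divergence[OF u \<theta> K \<theta>0] integral_mult_divergence[OF v \<eta> K \<eta>0])
  finally show ?thesis
    using \<theta> \<eta> \<theta>0 \<eta>0 \<theta>1 \<eta>1 by (intro exI[of _ \<theta>] exI[of _ \<eta>]) (auto simp: test_field_on_def)
qed

text \<open>For the mollified functions and the smoothed minimum and maximum, the derivatives can be
  exchanged exactly by \<open>smooth_min_max_divergence\<close>, and the bounds \<open>A\<close> and
  \<open>B\<close> apply to the resulting fields. Since the divergences live on a fixed compact set
  and are bounded, L1 closeness there suffices to return to u and v.\<close>

lemma min_max_divergence_le:
  fixes u v :: "'a::euclidean_space \<Rightarrow> real"
  assumes "open \<Omega>" and u: "integrable lborel u" and v: "integrable lborel v"
    and R: "\<And>x. R < norm x \<Longrightarrow> u x = 0" "\<And>x. R < norm x \<Longrightarrow> v x = 0"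
    and A: "\<And>\<theta>. \<theta> \<in> BV_test_fields \<Omega> \<Longrightarrow> (\<integral>x. u x * divergence \<theta> x \<partial>lborel) \<le> A"
    and B: "\<And>\<theta>. \<theta> \<in> BV_test_fields \<Omega> \<Longrightarrow> (\<integral>x. v x * divergence \<theta> x \<partial>lborel) \<le> B"
    and "\<phi> \<in> BV_test_fields \<Omega>" "\<psi> \<in> BV_test_fields \<Omega>"
  shows "(\<integral>x. min (u x) (v x) * divergence \<phi> x \<partial>lborel)
     + (\<integral>x. max (u x) (v x) * divergence \<psi> x \<partial>lborel) \<le> A + B"
proof -
  from \<open>\<phi> \<in> _\<close> \<open>\<psi> \<in> _\<close> obtain K1 K2 where
    K1: "compact K1" "K1 \<subseteq> \<Omega>" "test_field_on K1 \<phi>" and K2: "compact K2" "K2 \<subseteq> \<Omega>" "test_field_on K2 \<psi>"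
    unfolding BV_test_fields_iff by blast
  define K where "K = K1 \<union> K2"
  have K: "compact K" "K \<subseteq> \<Omega>" and t\<phi>: "test_field_on K \<phi>" and t\<psi>: "test_field_on K \<psi>"
    using K1 K2 by (auto simp: K_def test_field_on_def)
  note \<phi> = test_field_onD[OF t\<phi>] and \<psi> = test_field_onD[OF t\<psi>]
  have [measurable]: "u \<in> borel_measurable borel" "v \<in> borel_measurable borel" "K \<in> sets borel"
    using u v K by (auto intro: borel_compact)
  \<comment> \<open>Fields supported in \<open>K\<close> may be translated by less than
    \<open>d\<close> without leaving \<Omega>.\<close>
  obtain d where d: "0 < d" "(\<Union>x\<in>K. ball x d) \<subseteq> \<Omega>"
    using compact_subset_open_imp_ball_epsilon_subset[OF K(1) \<open>open \<Omega>\<close> K(2)] by blast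
  have div_cont: "continuous_on UNIV (divergence \<phi>)" "continuous_on UNIV (divergence \<psi>)"
    using \<phi> \<psi> by (auto intro: continuous_on_divergence)
  then have [measurable]: "divergence \<phi> \<in> borel_measurable borel" "divergence \<psi> \<in> borel_measurable borel"
    by (auto intro: borel_measurable_continuous_onI)
  have div0: "x \<notin> K \<Longrightarrow> divergence \<phi> x = 0" "x \<notin> K \<Longrightarrow> divergence \<psi> x = 0" for x
    using divergence_outside[OF compact_imp_closed[OF K(1)] \<phi>(2)] divergence_outside[OF compact_imp_closed[OF K(1)] \<psi>(2)] by auto
  obtain C1 where C1: "0 \<le> C1" "\<And>x. \<bar>divergence \<phi> x\<bar> \<le> C1"
    using bounded_compact_support[OF div_cont(1) K(1) div0(1)] by blast
  obtain C2 where C2: "0 \<le> C2" "\<And>x. \<bar>divergence \<psi> x\<bar> \<le> C2"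
    using bounded_compact_support[OF div_cont(2) K(1) div0(2)] by blast
  define C where "C = max C1 C2"
  have C: "0 \<le> C" "\<And>x. \<bar>divergence \<phi> x\<bar> \<le> C" "\<And>x. \<bar>divergence \<psi> x\<bar> \<le> C"
    using C1 C2 by (auto simp: C_def le_max_iff_disj)
  have Kint: "integrable lborel (indicat_real K)"
    using emeasure_compact_finite[OF K(1)] by (auto simp: less_top)
  let ?L = "(\<integral>x. min (u x) (v x) * divergence \<phi> x \<partial>lborel)
     + (\<integral>x. max (u x) (v x) * divergence \<psi> x \<partial>lborel)"
  \<comment> \<open>Each of the two replacements costs C (2 + |K|) per unit of e: two mollification
    errors in L1, and the pointwise smoothing error integrated over \<open>K\<close>. There is one
    replacement for the minimum and one for the maximum.\<close>
  define c where "c = 2 * (C * (2 + measure lborel K))"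
  have "0 \<le> c" using C by (simp add: c_def)
  have *: "?L \<le> A + B + c * e" if "0 < e" for e
  proof -
    obtain d1 where d1: "0 < d1" "\<And>z. norm z < d1 \<Longrightarrow> (\<integral>x. \<bar>u (x + z) - u x\<bar> \<partial>lborel) < e"
      using L1_translation_continuous[OF u \<open>0 < e\<close>] by blast
    obtain d2 where d2: "0 < d2" "\<And>z. norm z < d2 \<Longrightarrow> (\<integral>x. \<bar>v (x + z) - v x\<bar> \<partial>lborel) < e"
      using L1_translation_continuous[OF v \<open>0 < e\<close>] by blast
    \<comment> \<open>Below \<open>d\<close> the translated fields stay admissible; below
      \<open>d1\<close> and \<open>d2\<close> the mollifications are e-close in L1. The same
      \<open>e\<close> serves as smoothing parameter.\<close>
    define \<epsilon> where "\<epsilon> = min d (min d1 d2)"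
    have \<epsilon>: "0 < \<epsilon>" using d d1 d2 by (simp add: \<epsilon>_def)
    define U where "U = mollify \<epsilon> u"
    define V where "V = mollify \<epsilon> v"
    have U: "integrable lborel U" "(\<integral>x. \<bar>U x - u x\<bar> \<partial>lborel) \<le> e"
      unfolding U_def using L1_mollify[OF u \<epsilon>, of e] d1 by (auto simp: \<epsilon>_def intro: less_imp_le)
    have V: "integrable lborel V" "(\<integral>x. \<bar>V x - v x\<bar> \<partial>lborel) \<le> e"
      unfolding V_def using L1_mollify[OF v \<epsilon>, of e] d2 by (auto simp: \<epsilon>_def intro: less_imp_le)
    have UC: "C1_map U" "C1_map V"
      unfolding U_def V_def using C1_mollify[OF u R(1) \<epsilon>] C1_mollify[OF v R(2) \<epsilon>] by auto
    let ?m = "\<lambda>x. U x - smooth_pos e (U x - V x)" and ?M = "\<lambda>x. V x + smooth_pos e (U x - V x)"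
    have mM: "C1_map ?m" "C1_map ?M"
      by (intro C1_map_diff C1_map_add C1_map_smooth_pos UC \<open>0 < e\<close>)+
    obtain \<theta> \<eta> where \<theta>: "test_field_on K \<theta>" and \<eta>: "test_field_on K \<eta>"
      and eq: "(\<integral>x. ?m x * divergence \<phi> x \<partial>lborel) + (\<integral>x. ?M x * divergence \<psi> x \<partial>lborel)
        = (\<integral>x. U x * divergence \<theta> x \<partial>lborel) + (\<integral>x. V x * divergence \<eta> x \<partial>lborel)"
      using smooth_min_max_divergence[OF UC \<open>0 < e\<close> K(1) t\<phi> t\<psi>] by (elim exE conjE)
    \<comment> \<open>A bound against all admissible fields passes to the mollified function against
      fields supported in \<open>K\<close>, because their small translates are admissible.\<close>
    have mollified: "(\<integral>x. mollify \<epsilon> w x * divergence \<xi> x \<partial>lborel) \<le> D"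
      if w: "integrable lborel w" and D: "\<And>\<theta>. \<theta> \<in> BV_test_fields \<Omega> \<Longrightarrow> (\<integral>x. w x * divergence \<theta> x \<partial>lborel) \<le> D"
        and t: "test_field_on K \<xi>" for w \<xi> D
    proof -
      note \<xi> = test_field_onD[OF t]
      have cont: "continuous_on UNIV (divergence \<xi>)" by (rule continuous_on_divergence[OF \<xi>(1)])
      obtain C' where C': "\<And>x. \<bar>divergence \<xi> x\<bar> \<le> C'"
        using bounded_compact_support[OF cont K(1) divergence_outside[OF compact_imp_closed[OF K(1)] \<xi>(2)]] by blast
      show ?thesis
      proof (rule mollify_pairing_le[OF w _ C' \<epsilon>])
        show "divergence \<xi> \<in> borel_measurable borel" using cont by (rule borel_measurable_continuous_onI)
        fix z :: 'a assume "norm z < \<epsilon>"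
        then have "norm z < d" by (simp add: \<epsilon>_def)
        have "divergence (\<lambda>x. \<xi> (x - z)) x = divergence \<xi> (x - z)" for x
          by (simp add: divergence_def C1_map_translate(2)[OF \<xi>(1)])
        then show "(\<integral>x. w x * divergence \<xi> (x - z) \<partial>lborel) \<le> D"
          using D[OF BV_test_fields_translate[OF t K(1) d(2) \<open>norm z < d\<close>]] by simp
      qed
    qed
    have le: "(\<integral>x. w x * divergence \<xi> x \<partial>lborel) \<le> (\<integral>x. W x * divergence \<xi> x \<partial>lborel) + C * (2 + measure lborel K) * e"
      if w: "integrable lborel w" and W: "C1_map W" and t: "test_field_on K \<xi>"
        and Cb: "\<And>x. \<bar>divergence \<xi> x\<bar> \<le> C"
        and pt: "\<And>x. \<bar>w x - W x\<bar> \<le> \<bar>U x - u x\<bar> + \<bar>V x - v x\<bar> + e" for w W \<xi>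
    proof -
      note \<xi> = test_field_onD[OF t]
      have [measurable]: "w \<in> borel_measurable borel" "divergence \<xi> \<in> borel_measurable borel"
        using w continuous_on_divergence[OF \<xi>(1)] by (auto intro: borel_measurable_continuous_onI)
      have i1: "integrable lborel (\<lambda>x. w x * divergence \<xi> x)"
      proof (rule Bochner_Integration.integrable_bound)
        show "integrable lborel (\<lambda>x. C * w x)" using w by auto
        show "AE x in lborel. norm (w x * divergence \<xi> x) \<le> norm (C * w x)"
        proof (rule AE_I2)
          fix x show "norm (w x * divergence \<xi> x) \<le> norm (C * w x)"
            using mult_left_mono[OF Cb[of x], of "\<bar>w x\<bar>"] C(1) by (simp add: abs_mult mult.commute)
        qed
      qed measurable
      have i2: "integrable lborel (\<lambda>x. W x * divergence \<xi> x)"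
        by (rule integrable_mult_divergence(1)[OF W \<xi>(1) K(1) \<xi>(2)])
      have i3: "integrable lborel (\<lambda>x. \<bar>U x - u x\<bar>)" "integrable lborel (\<lambda>x. \<bar>V x - v x\<bar>)"
        using U V u v by auto
      have "(\<integral>x. w x * divergence \<xi> x \<partial>lborel)
          \<le> (\<integral>x. W x * divergence \<xi> x + C * (\<bar>U x - u x\<bar> + \<bar>V x - v x\<bar> + e * indicat_real K x) \<partial>lborel)"
      proof (rule integral_mono[OF i1])
        show "integrable lborel (\<lambda>x. W x * divergence \<xi> x + C * (\<bar>U x - u x\<bar> + \<bar>V x - v x\<bar> + e * indicat_real K x))"
          using i2 i3 Kint by (intro Bochner_Integration.integrable_add integrable_mult_right) auto
        fix x
        have dx: "divergence \<xi> x = 0" if "x \<notin> K"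
          by (rule divergence_outside[OF compact_imp_closed[OF K(1)] \<xi>(2) that])
        have "(w x - W x) * divergence \<xi> x \<le> C * (\<bar>U x - u x\<bar> + \<bar>V x - v x\<bar> + e * indicat_real K x)"
        proof (cases "x \<in> K")
          case True
          have "(w x - W x) * divergence \<xi> x \<le> \<bar>divergence \<xi> x\<bar> * \<bar>w x - W x\<bar>"
            by (metis abs_ge_self abs_mult mult.commute)
          also have "\<dots> \<le> C * (\<bar>U x - u x\<bar> + \<bar>V x - v x\<bar> + e)"
            using C(1) by (intro mult_mono Cb pt) auto
          finally show ?thesis using True by simp
        qed (use dx C(1) in simp)
        then show "w x * divergence \<xi> x \<le> W x * divergence \<xi> x + C * (\<bar>U x - u x\<bar> + \<bar>V x - v x\<bar> + e * indicat_real K x)"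
          by (simp add: left_diff_distrib)
      qed
      also have "\<dots> = (\<integral>x. W x * divergence \<xi> x \<partial>lborel)
          + C * ((\<integral>x. \<bar>U x - u x\<bar> \<partial>lborel) + (\<integral>x. \<bar>V x - v x\<bar> \<partial>lborel) + e * measure lborel K)"
        using i2 i3 Kint by simp
      also have "C * ((\<integral>x. \<bar>U x - u x\<bar> \<partial>lborel) + (\<integral>x. \<bar>V x - v x\<bar> \<partial>lborel) + e * measure lborel K)
          \<le> C * (e + e + e * measure lborel K)"
        using U V C(1) \<open>0 < e\<close> by (intro mult_left_mono add_mono) auto
      also have "C * (e + e + e * measure lborel K) = C * (2 + measure lborel K) * e"
        by (simp add: algebra_simps)
      finally show ?thesis by simp
    qed
    \<comment> \<open>Minimum and maximum are nonexpansive in the sum of the moduli, and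
      \<open>e\<close> accounts for the smoothed positive part.\<close>
    have "\<bar>min (u x) (v x) - ?m x\<bar> \<le> \<bar>U x - u x\<bar> + \<bar>V x - v x\<bar> + e"
         "\<bar>max (u x) (v x) - ?M x\<bar> \<le> \<bar>U x - u x\<bar> + \<bar>V x - v x\<bar> + e" for x
      using smooth_pos_approx[OF \<open>0 < e\<close>, of "U x - V x"] by (auto simp: min_def max_def abs_if split: if_splits)
    then have "?L \<le> (\<integral>x. ?m x * divergence \<phi> x \<partial>lborel) + C * (2 + measure lborel K) * e
       + ((\<integral>x. ?M x * divergence \<psi> x \<partial>lborel) + C * (2 + measure lborel K) * e)"
      using u v mM t\<phi> t\<psi> C by (intro add_mono le) auto
    also have "\<dots> = (\<integral>x. U x * divergence \<theta> x \<partial>lborel) + (\<integral>x. V x * divergence \<eta> x \<partial>lborel) + c * e"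
      using eq by (simp add: c_def algebra_simps)
    also have "\<dots> \<le> A + B + c * e"
      unfolding U_def V_def by (intro add_mono mollified u v A B \<theta> \<eta> order_refl)
    finally show ?thesis .
  qed
  show ?thesis
  proof (rule field_le_epsilon)
    fix e :: real assume "0 < e"
    have "c * (e / (c + 1)) \<le> e"
      using \<open>0 \<le> c\<close> \<open>0 < e\<close> by (simp add: field_simps)
    then show "?L \<le> A + B + e"
      using *[of "e / (c + 1)"] \<open>0 \<le> c\<close> \<open>0 < e\<close> by simp
  qed
qed

text \<open>Translations and Fubini are used over \<open>lborel\<close> on the whole space, whereas
  \<open>total_variation\<close> integrates over \<open>lebesgue_on \<Omega>\<close>; extension by
  zero and a Borel version bridge the two.\<close>

lemma lebesgue_on_borel_representative:
  fixes u :: "'a::euclidean_space \<Rightarrow> real"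
  assumes "open \<Omega>" and u: "integrable (lebesgue_on \<Omega>) u"
  obtains u' where "integrable lborel u'" "\<And>x. x \<notin> \<Omega> \<Longrightarrow> u' x = 0" "AE x in lborel. x \<in> \<Omega> \<longrightarrow> u x = u' x"
proof -
  have O: "\<Omega> \<in> sets lebesgue" "\<Omega> \<in> sets borel" using \<open>open \<Omega>\<close> by auto
  have i: "integrable lebesgue (\<lambda>x. indicator \<Omega> x *\<^sub>R u x)"
    using u integrable_restrict_space[of \<Omega> lebesgue u] O by simp
  obtain u1 where u1[measurable]: "u1 \<in> borel_measurable lborel" and ae: "AE x in lborel. indicator \<Omega> x *\<^sub>R u x = u1 x"
    using completion_ex_borel_measurable_real[OF borel_measurable_integrable[OF i]] by auto
  let ?u = "\<lambda>x. indicator \<Omega> x * u1 x"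
  have ae': "AE x in lborel. indicator \<Omega> x *\<^sub>R u x = ?u x"
    using ae by eventually_elim (auto simp: indicator_def)
  have [measurable]: "?u \<in> borel_measurable lborel" using O by measurable
  have "integrable lebesgue ?u"
    using i by (rule integrable_cong_AE_imp) (use ae' AE_completion[OF ae'] in \<open>auto simp: measurable_completion\<close>)
  then have "integrable lborel ?u"
    by (subst (asm) integrable_completion) auto
  then show thesis
  proof (rule that)
    show "AE x in lborel. x \<in> \<Omega> \<longrightarrow> u x = ?u x" using ae' by eventually_elim auto
  qed auto
qed

lemma integral_lebesgue_on_representative:
  fixes u u' f :: "'a::euclidean_space \<Rightarrow> real"
  assumes "open \<Omega>" and u': "u' \<in> borel_measurable borel" "\<And>x. x \<notin> \<Omega> \<Longrightarrow> u' x = 0"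
    and ae: "AE x in lborel. x \<in> \<Omega> \<longrightarrow> u x = u' x" and u: "u \<in> borel_measurable (lebesgue_on \<Omega>)"
    and f: "f \<in> borel_measurable borel"
  shows "(\<integral>x. u x * f x \<partial>lebesgue_on \<Omega>) = (\<integral>x. u' x * f x \<partial>lborel)"
proof -
  have O: "\<Omega> \<in> sets lebesgue" "\<Omega> \<in> sets borel" using \<open>open \<Omega>\<close> by auto
  have m: "(\<lambda>x. indicator \<Omega> x *\<^sub>R u x) \<in> borel_measurable lebesgue"
    using u borel_measurable_restrict_space_iff[of \<Omega> lebesgue u] O by simp
  have f': "f \<in> borel_measurable lebesgue" and u'': "u' \<in> borel_measurable lebesgue"
    using f u' by (auto simp: measurable_completion)
  have "(\<integral>x. u x * f x \<partial>lebesgue_on \<Omega>) = (\<integral>x. indicator \<Omega> x *\<^sub>R (u x * f x) \<partial>lebesgue)"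
    using O by (subst integral_restrict_space) auto
  also have "\<dots> = (\<integral>x. u' x * f x \<partial>lebesgue)"
  proof (rule integral_cong_AE)
    show "(\<lambda>x. indicator \<Omega> x *\<^sub>R (u x * f x)) \<in> borel_measurable lebesgue"
      using borel_measurable_times[OF m f'] by (simp add: mult.assoc)
    show "(\<lambda>x. u' x * f x) \<in> borel_measurable lebesgue"
      using u'' f' by measurable
    show "AE x in lebesgue. indicator \<Omega> x *\<^sub>R (u x * f x) = u' x * f x"
      using AE_completion[OF ae] by eventually_elim (auto simp: indicator_def u'(2))
  qed
  also have "\<dots> = (\<integral>x. u' x * f x \<partial>lborel)"
    using f u' by (intro integral_completion) auto
  finally show ?thesis .
qed

section \<open>The total variation as a supremum over test fields\<close>

lemma zero_in_BV_test_fields: "(\<lambda>x. 0) \<in> BV_test_fields \<Omega>"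
proof -
  have "C1_map (\<lambda>x::'a. 0::'a)" by (rule C1_mapI[of _ "\<lambda>x h. 0"]) auto
  then show ?thesis by (auto simp: BV_test_fields_def intro!: exI[of _ "{}"])
qed

lemma total_variation_ge:
  assumes "total_variation \<Omega> u < \<infinity>" "\<phi> \<in> BV_test_fields \<Omega>"
  shows "(\<integral>x. u x * divergence \<phi> x \<partial>lebesgue_on \<Omega>) \<le> enn2real (total_variation \<Omega> u)"
proof -
  have "ennreal (\<integral>x. u x * divergence \<phi> x \<partial>lebesgue_on \<Omega>) \<le> ennreal (enn2real (total_variation \<Omega> u))"
    using assms unfolding total_variation_def by (auto intro: SUP_upper)
  then show ?thesis by (simp add: ennreal_le_iff)
qed

lemma total_variation_le_add:
  assumes le: "\<And>\<phi> \<psi>. \<phi> \<in> BV_test_fields \<Omega> \<Longrightarrow> \<psi> \<in> BV_test_fields \<Omega> \<Longrightarrow>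
     (\<integral>x. u x * divergence \<phi> x \<partial>lebesgue_on \<Omega>) + (\<integral>x. v x * divergence \<psi> x \<partial>lebesgue_on \<Omega>) \<le> A"
  shows "total_variation \<Omega> u + total_variation \<Omega> v \<le> ennreal A"
proof -
  let ?a = "\<lambda>\<phi>. \<integral>x. u x * divergence \<phi> x \<partial>lebesgue_on \<Omega>" and ?b = "\<lambda>\<phi>. \<integral>x. v x * divergence \<phi> x \<partial>lebesgue_on \<Omega>"
  have ne: "BV_test_fields \<Omega> \<noteq> {}" using zero_in_BV_test_fields by blast
  have z: "divergence (\<lambda>x. 0) x = 0" for x :: 'a by (simp add: divergence_def)
  have "ennreal (?a \<phi>) + ennreal (?b \<psi>) \<le> ennreal A" if "\<phi> \<in> BV_test_fields \<Omega>" "\<psi> \<in> BV_test_fields \<Omega>" for \<phi> \<psi>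
  proof -
    \<comment> \<open>\<open>ennreal\<close> replaces negative integrals by 0. The same effect is
      obtained in \<open>le\<close> by inserting the zero field for \<phi>, for \<psi>, or for
      both.\<close>
    have "max 0 (?a \<phi>) + max 0 (?b \<psi>) \<le> A"
      using le[OF that] le[OF that(1) zero_in_BV_test_fields] le[OF zero_in_BV_test_fields that(2)]
        le[OF zero_in_BV_test_fields zero_in_BV_test_fields] by (simp add: z max_def)
    then have "ennreal (max 0 (?a \<phi>) + max 0 (?b \<psi>)) \<le> ennreal A" by (rule ennreal_leI)
    then show ?thesis by (simp add: ennreal_plus ennreal_max_0)
  qed
  then have "(SUP \<phi>\<in>BV_test_fields \<Omega>. ennreal (?a \<phi>)) + ennreal (?b \<psi>) \<le> ennreal A"
    if "\<psi> \<in> BV_test_fields \<Omega>" for \<psi>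
    using that ne by (subst ennreal_SUP_add_left[symmetric]) (auto intro: SUP_least)
  then show ?thesis
    unfolding total_variation_def using ne
    by (subst ennreal_SUP_add_right) (auto intro: SUP_least)
qed

lemma total_variation_submodular:
  fixes u v :: "'a::euclidean_space \<Rightarrow> real"
  assumes "open \<Omega>" "bounded \<Omega>" and u: "u \<in> BV \<Omega>" and v: "v \<in> BV \<Omega>"
  shows "total_variation \<Omega> (\<lambda>x. min (u x) (v x)) + total_variation \<Omega> (\<lambda>x. max (u x) (v x))
    \<le> total_variation \<Omega> u + total_variation \<Omega> v"
proof -
  have iu: "integrable (lebesgue_on \<Omega>) u" and iv: "integrable (lebesgue_on \<Omega>) v"
    and fu: "total_variation \<Omega> u < \<infinity>" and fv: "total_variation \<Omega> v < \<infinity>"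
    using u v by (auto simp: BV_def)
  obtain u' where u': "integrable lborel u'" "\<And>x. x \<notin> \<Omega> \<Longrightarrow> u' x = 0" "AE x in lborel. x \<in> \<Omega> \<longrightarrow> u x = u' x"
    using lebesgue_on_borel_representative[OF \<open>open \<Omega>\<close> iu] by blast
  obtain v' where v': "integrable lborel v'" "\<And>x. x \<notin> \<Omega> \<Longrightarrow> v' x = 0" "AE x in lborel. x \<in> \<Omega> \<longrightarrow> v x = v' x"
    using lebesgue_on_borel_representative[OF \<open>open \<Omega>\<close> iv] by blast
  have [measurable]: "u' \<in> borel_measurable borel" "v' \<in> borel_measurable borel"
    "u \<in> borel_measurable (lebesgue_on \<Omega>)" "v \<in> borel_measurable (lebesgue_on \<Omega>)"
    using u' v' iu iv by auto
  obtain R where R: "\<And>x. x \<in> \<Omega> \<Longrightarrow> norm x \<le> R"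
    using \<open>bounded \<Omega>\<close> by (auto simp: bounded_iff)
  have div: "divergence \<phi> \<in> borel_measurable borel" if "\<phi> \<in> BV_test_fields \<Omega>" for \<phi> :: "'a \<Rightarrow> 'a"
    using that continuous_on_divergence[of \<phi> UNIV]
    by (auto simp: BV_test_fields_def intro: borel_measurable_continuous_onI)
  let ?A = "enn2real (total_variation \<Omega> u)" and ?B = "enn2real (total_variation \<Omega> v)"
  have "total_variation \<Omega> (\<lambda>x. min (u x) (v x)) + total_variation \<Omega> (\<lambda>x. max (u x) (v x)) \<le> ennreal (?A + ?B)"
  proof (rule total_variation_le_add)
    fix \<phi> \<psi> :: "'a \<Rightarrow> 'a" assume \<phi>: "\<phi> \<in> BV_test_fields \<Omega>" and \<psi>: "\<psi> \<in> BV_test_fields \<Omega>"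
    have "(\<integral>x. min (u x) (v x) * divergence \<phi> x \<partial>lebesgue_on \<Omega>) = (\<integral>x. min (u' x) (v' x) * divergence \<phi> x \<partial>lborel)"
      using u' v' by (intro integral_lebesgue_on_representative[OF \<open>open \<Omega>\<close>] div[OF \<phi>]) (auto, measurable)
    moreover have "(\<integral>x. max (u x) (v x) * divergence \<psi> x \<partial>lebesgue_on \<Omega>) = (\<integral>x. max (u' x) (v' x) * divergence \<psi> x \<partial>lborel)"
      using u' v' by (intro integral_lebesgue_on_representative[OF \<open>open \<Omega>\<close>] div[OF \<psi>]) (auto, measurable)
    moreover have "(\<integral>x. min (u' x) (v' x) * divergence \<phi> x \<partial>lborel) + (\<integral>x. max (u' x) (v' x) * divergence \<psi> x \<partial>lborel) \<le> ?A + ?B"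
    proof (rule min_max_divergence_le[OF \<open>open \<Omega>\<close> u'(1) v'(1) _ _ _ _ \<phi> \<psi>])
      show "R < norm x \<Longrightarrow> u' x = 0" "R < norm x \<Longrightarrow> v' x = 0" for x
        using R[of x] u'(2)[of x] v'(2)[of x] by auto
      fix \<theta> :: "'a \<Rightarrow> 'a" assume \<theta>: "\<theta> \<in> BV_test_fields \<Omega>"
      show "(\<integral>x. u' x * divergence \<theta> x \<partial>lborel) \<le> ?A"
        using total_variation_ge[OF fu \<theta>] integral_lebesgue_on_representative[OF \<open>open \<Omega>\<close> _ u'(2,3) _ div[OF \<theta>]] by simp
      show "(\<integral>x. v' x * divergence \<theta> x \<partial>lborel) \<le> ?B"
        using total_variation_ge[OF fv \<theta>] integral_lebesgue_on_representative[OF \<open>open \<Omega>\<close> _ v'(2,3) _ div[OF \<theta>]] by simp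
    qed
    ultimately show "(\<integral>x. min (u x) (v x) * divergence \<phi> x \<partial>lebesgue_on \<Omega>)
        + (\<integral>x. max (u x) (v x) * divergence \<psi> x \<partial>lebesgue_on \<Omega>) \<le> ?A + ?B" by simp
  qed
  also have "\<dots> = total_variation \<Omega> u + total_variation \<Omega> v"
    using fu fv by (simp add: ennreal_plus)
  finally show ?thesis .
qed

lemma BV_min_max:
  fixes u v :: "'a::euclidean_space \<Rightarrow> real"
  assumes "open \<Omega>" "bounded \<Omega>" and u: "u \<in> BV \<Omega>" and v: "v \<in> BV \<Omega>"
  shows "(\<lambda>x. min (u x) (v x)) \<in> BV \<Omega>" "(\<lambda>x. max (u x) (v x)) \<in> BV \<Omega>"
proof -
  have "total_variation \<Omega> (\<lambda>x. min (u x) (v x)) + total_variation \<Omega> (\<lambda>x. max (u x) (v x)) < \<infinity>"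
    by (rule le_less_trans[OF total_variation_submodular[OF assms]]) (use u v in \<open>auto simp: BV_def\<close>)
  then show "(\<lambda>x. min (u x) (v x)) \<in> BV \<Omega>" "(\<lambda>x. max (u x) (v x)) \<in> BV \<Omega>"
    using u v by (auto simp: BV_def)
qed

section \<open>Traces of minima and maxima\<close>

text \<open>A measure density condition on \<open>\<Omega>\<close> at \<open>x\<close>, which makes approximate limits at \<open>x\<close> unique.\<close>

definition fat_at :: "'a::euclidean_space set \<Rightarrow> 'a \<Rightarrow> bool" where
  "fat_at \<Omega> x \<longleftrightarrow> (\<exists>c>0. \<forall>\<^sub>F r in at_right 0. \<exists>z. ball z (c * r) \<subseteq> \<Omega> \<inter> ball x r)"

text \<open>A homothety with centre x shrinks a fixed ball of \<Omega> towards x, and convexity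
  keeps the image in \<Omega>. The lemma serves dimension one, where a domain is an
  interval.\<close>

lemma fat_at_convex:
  fixes \<Omega> :: "'a::euclidean_space set"
  assumes "open \<Omega>" "convex \<Omega>" "\<Omega> \<noteq> {}" and x: "x \<in> closure \<Omega>"
  shows "fat_at \<Omega> x"
proof -
  obtain p where "p \<in> \<Omega>" using \<open>\<Omega> \<noteq> {}\<close> by blast
  then obtain s where s: "0 < s" "ball p s \<subseteq> \<Omega>"
    using openE[OF \<open>open \<Omega>\<close>] by blast
  \<comment> \<open>\<open>ball p s\<close> lies within distance \<open>l\<close> of x, so the ratio
    \<open>r / l\<close> carries it into \<open>ball x r\<close>.\<close>
  define l where "l = norm (p - x) + s"
  have l: "0 < l" using s by (simp add: l_def add_nonneg_pos)
  have sub: "ball (x + (r / l) *\<^sub>R (p - x)) (s / l * r) \<subseteq> \<Omega> \<inter> ball x r" if "0 < r" "r < l" for r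
  proof
    fix y assume y: "y \<in> ball (x + (r / l) *\<^sub>R (p - x)) (s / l * r)"
    \<comment> \<open>The preimage of \<open>y\<close> under the homothety.\<close>
    define c where "c = x + (l / r) *\<^sub>R (y - x)"
    have "c - p = (l / r) *\<^sub>R (y - (x + (r / l) *\<^sub>R (p - x)))"
      using that l by (simp add: c_def algebra_simps)
    then have "norm (c - p) = (l / r) * norm (y - (x + (r / l) *\<^sub>R (p - x)))"
      using that l by simp
    also have "\<dots> < (l / r) * (s / l * r)"
      using y that l by (intro mult_strict_left_mono) (auto simp: dist_norm norm_minus_commute)
    finally have "norm (c - p) < s" using that l by simp
    then have "c \<in> ball p s" by (simp add: dist_norm norm_minus_commute)
    then have "c \<in> interior \<Omega>" using s \<open>open \<Omega>\<close> by (auto simp: interior_open)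
    from mem_interior_closure_convex_shrink[OF \<open>convex \<Omega>\<close> this x, of "r / l"]
    have "x - (r / l) *\<^sub>R (x - c) \<in> \<Omega>" using that l \<open>open \<Omega>\<close> by (auto simp: interior_open)
    moreover have "x - (r / l) *\<^sub>R (x - c) = y" using that l by (simp add: c_def algebra_simps)
    ultimately have "y \<in> \<Omega>" by simp
    moreover have "norm (y - x) < r"
    proof -
      have "norm (y - x) \<le> norm (y - (x + (r / l) *\<^sub>R (p - x))) + norm ((r / l) *\<^sub>R (p - x))"
        using norm_triangle_ineq[of "y - (x + (r / l) *\<^sub>R (p - x))" "(r / l) *\<^sub>R (p - x)"] by (simp add: algebra_simps)
      also have "\<dots> < s / l * r + r / l * norm (p - x)"
        using y that l by (intro add_less_le_mono) (auto simp: dist_norm norm_minus_commute)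
      also have "\<dots> = r * ((norm (p - x) + s) / l)" by (simp add: add_divide_distrib algebra_simps)
      finally show ?thesis using l by (simp flip: l_def)
    qed
    ultimately show "y \<in> \<Omega> \<inter> ball x r" by (simp add: dist_norm norm_minus_commute)
  qed
  have "\<forall>\<^sub>F r in at_right 0. \<exists>z. ball z (s / l * r) \<subseteq> \<Omega> \<inter> ball x r"
    unfolding eventually_at_right_field
  proof (intro exI[of _ l] conjI allI impI l)
    fix r assume "0 < r" "r < l"
    from sub[OF this] show "\<exists>z. ball z (s / l * r) \<subseteq> \<Omega> \<inter> ball x r" by (rule exI)
  qed
  then show ?thesis unfolding fat_at_def using s l by (intro exI[of _ "s / l"]) auto
qed

text \<open>Differentiability of the graph function at the single point \<open>P x\<close> gives a
  Lipschitz estimate based there, so near x the set \<Omega> contains an open cone with axis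
  \<open>e\<close>. Balls centred on the axis and inscribed in this cone scale with r.\<close>

lemma fat_at_C1_boundary:
  fixes \<Omega> :: "'a::euclidean_space set"
  assumes "open \<Omega>" "C1_boundary \<Omega>" and x: "x \<in> frontier \<Omega>"
  shows "fat_at \<Omega> x"
proof -
  obtain R e \<psi> where R: "0 < R" and e: "norm e = 1" and \<psi>: "C1_map \<psi>"
    and graph: "\<Omega> \<inter> ball x R = {y \<in> ball x R. \<psi> (y - (y \<bullet> e) *\<^sub>R e) < y \<bullet> e}"
    using assms unfolding C1_boundary_def by blast
  define P where "P y = y - (y \<bullet> e) *\<^sub>R e" for y
  have ee: "e \<bullet> e = 1" using e by (simp add: norm_eq_1)
  have "P y \<bullet> P y = y \<bullet> y - (y \<bullet> e) * (y \<bullet> e)" for y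
    unfolding P_def by (simp add: inner_diff_left inner_diff_right inner_commute[of e y] ee)
  then have P_norm: "norm (P y) \<le> norm y" for y
    by (simp add: norm_le)
  have P_diff: "P y - P z = P (y - z)" for y z by (simp add: P_def algebra_simps)
  \<comment> \<open>x lies outside the open set \<Omega> but is a limit of points of \<Omega>; each
    fact gives one inequality.\<close>
  have graph_x: "\<psi> (P x) = x \<bullet> e"
  proof (rule antisym)
    have "x \<notin> \<Omega>" using x \<open>open \<Omega>\<close> by (simp add: frontier_def interior_open)
    then have "\<not> \<psi> (P x) < x \<bullet> e"
      using R eqset_imp_iff[OF graph, of x] by (simp add: P_def)
    then show "x \<bullet> e \<le> \<psi> (P x)" by simp
    have "x \<in> closure \<Omega>" using x by (simp add: frontier_def)
    then obtain X where X: "\<And>n. X n \<in> \<Omega>" "X \<longlonglongrightarrow> x" unfolding closure_sequential by blast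
    have "\<forall>\<^sub>F n in sequentially. X n \<in> ball x R"
      using X(2) R by (auto simp: tendsto_iff dist_commute)
    then have ev: "\<forall>\<^sub>F n in sequentially. \<psi> (P (X n)) \<le> X n \<bullet> e"
    proof eventually_elim
      case (elim n)
      then have "X n \<in> \<Omega> \<inter> ball x R" using X by auto
      then show ?case unfolding graph by (auto simp: P_def)
    qed
    have "(\<lambda>n. P (X n)) \<longlonglongrightarrow> P x" unfolding P_def by (intro tendsto_intros X)
    moreover have "isCont \<psi> (P x)"
      using C1_map_continuous[OF \<psi>, of UNIV] by (simp add: continuous_on_eq_continuous_at)
    ultimately have "(\<lambda>n. \<psi> (P (X n))) \<longlonglongrightarrow> \<psi> (P x)" by (rule isCont_tendsto_compose[rotated])
    then show "\<psi> (P x) \<le> x \<bullet> e"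
      by (rule tendsto_le[OF sequentially_bot _ _ ev, rotated]) (intro tendsto_intros X)
  qed
  have bl: "bounded_linear (frechet_derivative \<psi> (at (P x)))"
    using has_derivative_bounded_linear[OF C1_map_has_derivative[OF \<psi>]] .
  obtain B where B: "\<And>h. norm (frechet_derivative \<psi> (at (P x)) h) \<le> norm h * B" "0 < B"
    using bounded_linear.pos_bounded[OF bl] by blast
  have "\<exists>d>0. \<forall>y. norm (y - P x) < d \<longrightarrow>
      norm (\<psi> y - \<psi> (P x) - frechet_derivative \<psi> (at (P x)) (y - P x)) \<le> 1 * norm (y - P x)"
    using C1_map_has_derivative[OF \<psi>, of "P x"] unfolding has_derivative_at_alt
    by (elim conjE) (drule spec[of _ 1], simp)
  then obtain d where d: "0 < d" "\<And>y. norm (y - P x) < d \<Longrightarrow>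
      norm (\<psi> y - \<psi> (P x) - frechet_derivative \<psi> (at (P x)) (y - P x)) \<le> 1 * norm (y - P x)"
    by blast
  \<comment> \<open>The bound of the derivative plus the constant 1 of the remainder
    estimate.\<close>
  define L where "L = B + 1"
  have L: "0 < L" using B by (simp add: L_def)
  have lip: "\<bar>\<psi> y - \<psi> (P x)\<bar> \<le> L * norm (y - P x)" if "norm (y - P x) < d" for y
    using d(2)[OF that] B(1)[of "y - P x"] unfolding L_def by (simp add: algebra_simps)
  \<comment> \<open>The centre lies r / 2 above x. A deviation w from it costs L |w| in the graph
    function and |w| in height, so (L + 1) |w| must stay below r / 2, the value of (L + 2) c r;
    \<open>c < 1 / 2\<close> keeps the ball inside \<open>ball x r\<close>.\<close>
  define c where "c = 1 / (2 * (L + 2))"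
  have c: "0 < c" "c < 1 / 2" using L by (simp_all add: c_def)
  have sub: "ball (x + (r / 2) *\<^sub>R e) (c * r) \<subseteq> \<Omega> \<inter> ball x r" if r: "0 < r" "r < R" "r < d" for r
  proof
    fix y assume y: "y \<in> ball (x + (r / 2) *\<^sub>R e) (c * r)"
    define w where "w = y - (x + (r / 2) *\<^sub>R e)"
    have w: "norm w < c * r" using y by (simp add: w_def dist_norm norm_minus_commute)
    have yx: "y - x = (r / 2) *\<^sub>R e + w" by (simp add: w_def)
    have "norm (y - x) \<le> r / 2 + norm w"
      unfolding yx using norm_triangle_ineq[of "(r / 2) *\<^sub>R e" w] e r by simp
    also have "\<dots> < r / 2 + 1 / 2 * r"
      using w mult_strict_right_mono[OF c(2) r(1)] by simp
    finally have yr: "norm (y - x) < r" by simp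
    have "P y - P x = P w"
      unfolding P_diff yx by (simp add: P_def inner_add_left scaleR_add_left ee)
    then have Pw: "norm (P y - P x) \<le> norm w" using P_norm by simp
    have "c * r < 1 / 2 * r" by (rule mult_strict_right_mono[OF c(2) r(1)])
    then have "norm w < d" using w r by linarith
    then have "\<bar>\<psi> (P y) - \<psi> (P x)\<bar> \<le> L * norm (P y - P x)"
      using Pw by (intro lip) simp
    also have "\<dots> \<le> L * norm w" using Pw L by (intro mult_left_mono) auto
    finally have "\<psi> (P y) \<le> x \<bullet> e + L * norm w" using graph_x by simp
    also have "\<dots> < y \<bullet> e"
    proof -
      have "(L + 1) * norm w \<le> (L + 1) * (c * r)" using w L by (intro mult_left_mono) auto
      also have "\<dots> < (L + 2) * (c * r)" using c r by simp
      also have "\<dots> = r / 2" using L by (simp add: c_def field_simps)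
      finally have "(L + 1) * norm w < r / 2" .
      moreover have "y \<bullet> e = x \<bullet> e + r / 2 + w \<bullet> e"
        using arg_cong[OF yx, of "\<lambda>v. v \<bullet> e"] ee by (simp add: inner_diff_left inner_add_left)
      moreover have "\<bar>w \<bullet> e\<bar> \<le> norm w" using Cauchy_Schwarz_ineq2[of w e] e by simp
      ultimately show ?thesis by (simp add: algebra_simps)
    qed
    finally have "\<psi> (P y) < y \<bullet> e" .
    then have "y \<in> \<Omega> \<inter> ball x R"
      unfolding graph using yr r by (simp add: P_def dist_norm norm_minus_commute)
    then show "y \<in> \<Omega> \<inter> ball x r" using yr by (simp add: dist_norm norm_minus_commute)
  qed
  have "\<forall>\<^sub>F r in at_right 0. \<exists>z. ball z (c * r) \<subseteq> \<Omega> \<inter> ball x r"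
    unfolding eventually_at_right_field
  proof (intro exI[of _ "min R d"] conjI allI impI)
    show "0 < min R d" using R d(1) by simp
    fix r assume "0 < r" "r < min R d"
    then have "ball (x + (r / 2) *\<^sub>R e) (c * r) \<subseteq> \<Omega> \<inter> ball x r" by (intro sub) auto
    then show "\<exists>z. ball z (c * r) \<subseteq> \<Omega> \<inter> ball x r" by (rule exI)
  qed
  then show ?thesis unfolding fat_at_def using c by blast
qed

section \<open>One-sided approximate limits\<close>

lemma integrable_lebesgue_on_Int_ball:
  fixes u :: "'a::euclidean_space \<Rightarrow> real"
  assumes "open \<Omega>" and u: "integrable (lebesgue_on \<Omega>) u"
  shows "integrable (lebesgue_on (\<Omega> \<inter> ball x r)) (\<lambda>y. \<bar>u y - a\<bar>)"
proof -
  let ?S = "\<Omega> \<inter> ball x r"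
  have O: "\<Omega> \<in> sets lebesgue" using \<open>open \<Omega>\<close> by auto
  have S: "?S \<in> lmeasurable"
    using \<open>open \<Omega>\<close> by (intro bounded_set_imp_lmeasurable) auto
  have i: "integrable lebesgue (\<lambda>x. indicator \<Omega> x *\<^sub>R u x)"
    using u integrable_restrict_space[of \<Omega> lebesgue u] O by simp
  have "integrable lebesgue (\<lambda>y. indicator ?S y *\<^sub>R (indicator \<Omega> y *\<^sub>R u y))"
    using S by (intro integrable_mult_indicator i) auto
  also have "(\<lambda>y. indicator ?S y *\<^sub>R (indicator \<Omega> y *\<^sub>R u y)) = (\<lambda>y. indicator ?S y *\<^sub>R u y)"
    by (auto simp: indicator_def)
  finally have "integrable (lebesgue_on ?S) u"
    using S by (subst integrable_restrict_space) auto
  moreover have "integrable (lebesgue_on ?S) (\<lambda>y. a)"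
    using finite_measure_lebesgue_on[OF S] by (rule finite_measure.integrable_const)
  ultimately show ?thesis by auto
qed

definition approx_limit :: "'a::euclidean_space set \<Rightarrow> ('a \<Rightarrow> real) \<Rightarrow> 'a \<Rightarrow> real \<Rightarrow> bool" where
  "approx_limit \<Omega> u x a \<longleftrightarrow>
     ((\<lambda>r. (\<integral>y. \<bar>u y - a\<bar> \<partial>lebesgue_on (\<Omega> \<inter> ball x r)) / r ^ DIM('a)) \<longlongrightarrow> 0) (at_right 0)"

text \<open>By the triangle inequality, |a - b| times the measure of \<Omega> \<inter> ball x r is
  at most the sum of the two integrals. That measure is at least a fixed multiple of the power of r
  in the denominator, so the limit forces |a - b| = 0.\<close>

lemma approx_limit_unique:
  fixes u :: "'a::euclidean_space \<Rightarrow> real"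
  assumes "open \<Omega>" and u: "integrable (lebesgue_on \<Omega>) u" and "fat_at \<Omega> x"
    and a: "approx_limit \<Omega> u x a" and b: "approx_limit \<Omega> u x b"
  shows "a = b"
proof -
  obtain c where c: "0 < c" and fat: "\<forall>\<^sub>F r in at_right 0. \<exists>z. ball z (c * r) \<subseteq> \<Omega> \<inter> ball x r"
    using \<open>fat_at \<Omega> x\<close> unfolding fat_at_def by blast
  let ?I = "\<lambda>a r. \<integral>y. \<bar>u y - a\<bar> \<partial>lebesgue_on (\<Omega> \<inter> ball x r)"
  let ?k = "\<bar>a - b\<bar> * (unit_ball_vol (DIM('a)) * c ^ DIM('a))"
  have lim: "((\<lambda>r. ?I a r / r ^ DIM('a) + ?I b r / r ^ DIM('a)) \<longlongrightarrow> 0 + 0) (at_right 0)"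
    using a b unfolding approx_limit_def by (rule tendsto_add)
  have "\<forall>\<^sub>F r in at_right 0. ?k \<le> ?I a r / r ^ DIM('a) + ?I b r / r ^ DIM('a)"
    using fat eventually_at_right_less[of 0]
  proof eventually_elim
    case (elim r)
    then obtain z where z: "ball z (c * r) \<subseteq> \<Omega> \<inter> ball x r" and r: "0 < r" by blast
    let ?S = "\<Omega> \<inter> ball x r"
    have S: "?S \<in> lmeasurable" using \<open>open \<Omega>\<close> by (intro bounded_set_imp_lmeasurable) auto
    note i = integrable_lebesgue_on_Int_ball[OF \<open>open \<Omega>\<close> u]
    have "unit_ball_vol (DIM('a)) * (c * r) ^ DIM('a) = measure lebesgue (ball z (c * r))"
      using c r by (simp add: content_ball)
    also have "\<dots> \<le> measure lebesgue ?S"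
      using z S by (intro measure_mono_fmeasurable) auto
    finally have "\<bar>a - b\<bar> * (unit_ball_vol (DIM('a)) * (c * r) ^ DIM('a)) \<le> \<bar>a - b\<bar> * measure lebesgue ?S"
      by (intro mult_left_mono) auto
    also have "\<dots> = (\<integral>y. \<bar>a - b\<bar> \<partial>lebesgue_on ?S)"
      using S by (simp add: measure_restrict_space space_restrict_space)
    also have "\<dots> \<le> (\<integral>y. \<bar>u y - a\<bar> + \<bar>u y - b\<bar> \<partial>lebesgue_on ?S)"
      using finite_measure_lebesgue_on[OF S]
      by (intro integral_mono finite_measure.integrable_const Bochner_Integration.integrable_add i) auto
    also have "\<dots> = ?I a r + ?I b r"
      by (intro Bochner_Integration.integral_add i)
    finally have "?k * r ^ DIM('a) \<le> ?I a r + ?I b r"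
      by (simp add: power_mult_distrib mult.assoc)
    then show ?case using r by (simp add: pos_le_divide_eq flip: add_divide_distrib)
  qed
  then have "?k \<le> 0"
    using lim by (intro tendsto_lowerbound[of _ _ "at_right (0::real)"]) auto
  moreover have K: "0 < unit_ball_vol (real DIM('a)) * c ^ DIM('a)"
    using c by (intro mult_pos_pos unit_ball_vol_pos) auto
  ultimately have "\<not> 0 < \<bar>a - b\<bar>"
    using mult_pos_pos[OF _ K, of "\<bar>a - b\<bar>"] by linarith
  then show ?thesis by simp
qed

text \<open>The hypothesis \<open>le\<close> is the nonexpansiveness shared by the binary minimum
  and maximum.\<close>

lemma approx_limit_compose:
  fixes u v w :: "'a::euclidean_space \<Rightarrow> real"
  assumes "open \<Omega>" and u: "integrable (lebesgue_on \<Omega>) u" and v: "integrable (lebesgue_on \<Omega>) v"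
    and w: "integrable (lebesgue_on \<Omega>) w"
    and a: "approx_limit \<Omega> u x a" and b: "approx_limit \<Omega> v x b"
    and le: "\<And>y. \<bar>w y - c\<bar> \<le> \<bar>u y - a\<bar> + \<bar>v y - b\<bar>"
  shows "approx_limit \<Omega> w x c"
  unfolding approx_limit_def
proof (rule tendsto_sandwich[OF _ _ tendsto_const])
  let ?I = "\<lambda>w a r. \<integral>y. \<bar>w y - a\<bar> \<partial>lebesgue_on (\<Omega> \<inter> ball x r)"
  note i = integrable_lebesgue_on_Int_ball[OF \<open>open \<Omega>\<close>]
  show "((\<lambda>r. ?I u a r / r ^ DIM('a) + ?I v b r / r ^ DIM('a)) \<longlongrightarrow> 0) (at_right 0)"
    using tendsto_add[OF a[unfolded approx_limit_def] b[unfolded approx_limit_def]] by simp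
  show "\<forall>\<^sub>F r in at_right 0. 0 \<le> ?I w c r / r ^ DIM('a)"
    using eventually_at_right_less[of 0] by eventually_elim simp
  show "\<forall>\<^sub>F r in at_right 0. ?I w c r / r ^ DIM('a) \<le> ?I u a r / r ^ DIM('a) + ?I v b r / r ^ DIM('a)"
    using eventually_at_right_less[of 0]
  proof eventually_elim
    case (elim r)
    have "?I w c r \<le> (\<integral>y. \<bar>u y - a\<bar> + \<bar>v y - b\<bar> \<partial>lebesgue_on (\<Omega> \<inter> ball x r))"
      by (intro integral_mono Bochner_Integration.integrable_add i u v w le)
    also have "\<dots> = ?I u a r + ?I v b r"
      by (intro Bochner_Integration.integral_add i u v)
    finally show ?case using elim by (simp add: divide_right_mono flip: add_divide_distrib)
  qed
qed

text \<open>At almost every boundary point all four functions have their traces as approximate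
  limits; the minimum and maximum of the traces of u and v are approximate limits as well, and
  uniqueness identifies them.\<close>

lemma BV_trace_min_max:
  fixes \<Omega> :: "'a::euclidean_space set"
  assumes \<Omega>: "open \<Omega>" "bounded \<Omega>" and fat: "\<And>x. x \<in> frontier \<Omega> \<Longrightarrow> fat_at \<Omega> x"
    and \<gamma>: "BV_trace_operator \<Omega> \<gamma>" and u: "u \<in> BV \<Omega>" and v: "v \<in> BV \<Omega>"
  shows "AE x in surface_on (frontier \<Omega>).
     \<gamma> (\<lambda>y. min (u y) (v y)) x = min (\<gamma> u x) (\<gamma> v x) \<and> \<gamma> (\<lambda>y. max (u y) (v y)) x = max (\<gamma> u x) (\<gamma> v x)"
proof -
  note m = BV_min_max[OF \<Omega> u v]
  have ae: "AE x in surface_on (frontier \<Omega>). approx_limit \<Omega> w x (\<gamma> w x)" if "w \<in> BV \<Omega>" for w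
    using \<gamma> that unfolding BV_trace_operator_def approx_limit_def by blast
  have int: "integrable (lebesgue_on \<Omega>) w" if "w \<in> BV \<Omega>" for w using that by (simp add: BV_def)
  have sp: "AE x in surface_on (frontier \<Omega>). x \<in> frontier \<Omega>"
    using AE_space[of "surface_on (frontier \<Omega>)"] by (simp add: surface_on_def space_restrict_space)
  show ?thesis
    using sp ae[OF u] ae[OF v] ae[OF m(1)] ae[OF m(2)]
  proof eventually_elim
    case (elim x)
    note uv = int[OF u] int[OF v]
    have "approx_limit \<Omega> (\<lambda>y. min (u y) (v y)) x (min (\<gamma> u x) (\<gamma> v x))"
      by (rule approx_limit_compose[OF \<Omega>(1) uv int[OF m(1)] elim(2,3)]) (auto simp: min_def)
    moreover have "approx_limit \<Omega> (\<lambda>y. max (u y) (v y)) x (max (\<gamma> u x) (\<gamma> v x))"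
      by (rule approx_limit_compose[OF \<Omega>(1) uv int[OF m(2)] elim(2,3)]) (auto simp: max_def)
    ultimately show ?case
      using approx_limit_unique[OF \<Omega>(1) int[OF m(1)] fat[OF elim(1)] elim(4)]
        approx_limit_unique[OF \<Omega>(1) int[OF m(2)] fat[OF elim(1)] elim(5)] by blast
  qed
qed

text \<open>The two restricted measures are compared through the ambient Hausdorff measure, which
  uses measurability of both sets; for \<open>F\<close> this is
  \<open>closed_in_sets_hausdorff_measure\<close>.\<close>

lemma AE_surface_on_subset:
  fixes F :: "'a::euclidean_space set"
  assumes "closed F" "\<Gamma> \<subseteq> F" "\<Gamma> \<in> sets (hausdorff_measure (DIM('a) - 1))" and ae: "AE x in surface_on F. P x"
  shows "AE x in surface_on \<Gamma>. P x"
proof -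
  have F: "F \<in> sets (hausdorff_measure (DIM('a) - 1))"
    by (rule closed_in_sets_hausdorff_measure[OF \<open>closed F\<close>])
  have sp: "space (hausdorff_measure (DIM('a) - 1)) = (UNIV :: 'a set)"
    by (simp add: hausdorff_measure_def space_measure_of_conv)
  have "AE x in hausdorff_measure (DIM('a) - 1). x \<in> F \<longrightarrow> P x"
    using ae F unfolding surface_on_def by (subst (asm) AE_restrict_space_iff) (auto simp: sp)
  then have "AE x in hausdorff_measure (DIM('a) - 1). x \<in> \<Gamma> \<longrightarrow> P x"
    by eventually_elim (use \<open>\<Gamma> \<subseteq> F\<close> in auto)
  then show ?thesis
    using assms(3) unfolding surface_on_def by (subst AE_restrict_space_iff) (auto simp: sp)
qed

section \<open>The Hilbert space and the energy\<close>

lemma L2_functions_mult_integrable: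
  assumes "f \<in> L2_functions M" "g \<in> L2_functions M"
  shows "integrable M (\<lambda>x. f x * g x)"
proof (rule Bochner_Integration.integrable_bound)
  show "integrable M (\<lambda>x. (f x)\<^sup>2 + (g x)\<^sup>2)"
    using assms by (auto simp: L2_functions_def)
  show "(\<lambda>x. f x * g x) \<in> borel_measurable M"
    using assms by (auto simp: L2_functions_def)
  show "AE x in M. norm (f x * g x) \<le> norm ((f x)\<^sup>2 + (g x)\<^sup>2)"
  proof (rule AE_I2)
    fix x
    have "2 * (\<bar>f x\<bar> * \<bar>g x\<bar>) \<le> (f x)\<^sup>2 + (g x)\<^sup>2"
      using sum_squares_bound[of "\<bar>f x\<bar>" "\<bar>g x\<bar>"] by simp
    moreover have "0 \<le> \<bar>f x\<bar> * \<bar>g x\<bar>" by simp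
    ultimately have "\<bar>f x\<bar> * \<bar>g x\<bar> \<le> (f x)\<^sup>2 + (g x)\<^sup>2"
      by linarith
    then show "norm (f x * g x) \<le> norm ((f x)\<^sup>2 + (g x)\<^sup>2)"
      by (simp add: abs_mult)
  qed
qed

lemma L2_functions_bound:
  assumes "f \<in> L2_functions M" "g \<in> borel_measurable M" "\<And>x. \<bar>g x\<bar> \<le> \<bar>f x\<bar>"
  shows "g \<in> L2_functions M"
  unfolding L2_functions_def
proof (intro CollectI conjI assms Bochner_Integration.integrable_bound[of M "\<lambda>x. (f x)\<^sup>2" "\<lambda>x. (g x)\<^sup>2"])
  show "AE x in M. norm ((g x)\<^sup>2) \<le> norm ((f x)\<^sup>2)"
    using assms(3) by (auto simp: abs_le_square_iff)
qed (use assms in \<open>auto simp: L2_functions_def\<close>)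

lemma L2_functions_add:
  assumes "f \<in> L2_functions M" "g \<in> L2_functions M"
  shows "(\<lambda>x. f x + g x) \<in> L2_functions M"
proof -
  have "integrable M (\<lambda>x. (f x)\<^sup>2 + 2 * (f x * g x) + (g x)\<^sup>2)"
    using assms L2_functions_mult_integrable[OF assms] by (auto simp: L2_functions_def)
  also have "(\<lambda>x. (f x)\<^sup>2 + 2 * (f x * g x) + (g x)\<^sup>2) = (\<lambda>x. (f x + g x)\<^sup>2)"
    by (auto simp: power2_eq_square algebra_simps)
  finally show ?thesis using assms by (auto simp: L2_functions_def)
qed

lemma L2_functions_cmult: "f \<in> L2_functions M \<Longrightarrow> (\<lambda>x. c * f x) \<in> L2_functions M"
  by (auto simp: L2_functions_def power_mult_distrib)

lemma L2_functions_diff: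
  assumes "f \<in> L2_functions M" "g \<in> L2_functions M"
  shows "(\<lambda>x. f x - g x) \<in> L2_functions M"
  using L2_functions_add[OF assms(1) L2_functions_cmult[OF assms(2), of "-1"]] by simp

lemma L2_functions_pos: "f \<in> L2_functions M \<Longrightarrow> (\<lambda>x. max 0 (f x)) \<in> L2_functions M"
  by (rule L2_functions_bound[of f]) (auto simp: L2_functions_def)

lemma L2_functions_min_max:
  assumes "f \<in> L2_functions M" "g \<in> L2_functions M"
  shows "(\<lambda>x. min (f x) (g x)) \<in> L2_functions M" "(\<lambda>x. max (f x) (g x)) \<in> L2_functions M"
proof -
  have "(\<lambda>x. min (f x) (g x)) = (\<lambda>x. f x - max 0 (f x - g x))"
    and "(\<lambda>x. max (f x) (g x)) = (\<lambda>x. g x + max 0 (f x - g x))"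
    by (auto simp: max_def min_def)
  then show "(\<lambda>x. min (f x) (g x)) \<in> L2_functions M" "(\<lambda>x. max (f x) (g x)) \<in> L2_functions M"
    using assms by (simp_all add: L2_functions_diff L2_functions_add L2_functions_pos)
qed

definition H_pos :: "'a state \<Rightarrow> 'a state" where
  "H_pos X = (\<lambda>x. max 0 (fst X x), \<lambda>x. max 0 (snd X x))"

lemma H_space_add: "X \<in> H_space \<Omega> \<Gamma> \<Longrightarrow> Y \<in> H_space \<Omega> \<Gamma> \<Longrightarrow> X + Y \<in> H_space \<Omega> \<Gamma>"
  by (auto simp: H_space_def plus_fun_def L2_functions_add)

lemma H_space_diff: "X \<in> H_space \<Omega> \<Gamma> \<Longrightarrow> Y \<in> H_space \<Omega> \<Gamma> \<Longrightarrow> X - Y \<in> H_space \<Omega> \<Gamma>"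
  by (auto simp: H_space_def fun_diff_def L2_functions_diff)

lemma H_space_scale: "X \<in> H_space \<Omega> \<Gamma> \<Longrightarrow> H_scale c X \<in> H_space \<Omega> \<Gamma>"
  by (auto simp: H_space_def H_scale_def L2_functions_cmult)

lemma H_space_pos: "X \<in> H_space \<Omega> \<Gamma> \<Longrightarrow> H_pos X \<in> H_space \<Omega> \<Gamma>"
  by (auto simp: H_space_def H_pos_def L2_functions_pos)

lemma H_space_uminus: "X \<in> H_space \<Omega> \<Gamma> \<Longrightarrow> - X \<in> H_space \<Omega> \<Gamma>"
  using L2_functions_cmult[of "fst X" _ "-1"] L2_functions_cmult[of "snd X" _ "-1"]
  by (cases X) (auto simp: H_space_def fun_Compl_def)

lemma H_space_zero: "0 \<in> H_space \<Omega> \<Gamma>"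
  by (auto simp: H_space_def L2_functions_def zero_prod_def zero_fun_def)

lemma H_space_integrable:
  assumes "X \<in> H_space \<Omega> \<Gamma>" "Y \<in> H_space \<Omega> \<Gamma>"
  shows "integrable (lebesgue_on \<Omega>) (\<lambda>x. fst X x * fst Y x)"
    "integrable (surface_on \<Gamma>) (\<lambda>x. snd X x * snd Y x)"
  using assms by (auto simp: H_space_def intro: L2_functions_mult_integrable)

lemma H_inner_commute: "H_inner \<tau> \<Omega> \<Gamma> X Y = H_inner \<tau> \<Omega> \<Gamma> Y X"
  by (simp add: H_inner_def mult.commute)

lemma H_inner_add_left:
  assumes "X \<in> H_space \<Omega> \<Gamma>" "Y \<in> H_space \<Omega> \<Gamma>" "Z \<in> H_space \<Omega> \<Gamma>"
  shows "H_inner \<tau> \<Omega> \<Gamma> (X + Y) Z = H_inner \<tau> \<Omega> \<Gamma> X Z + H_inner \<tau> \<Omega> \<Gamma> Y Z"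
  using H_space_integrable[OF assms(1,3)] H_space_integrable[OF assms(2,3)]
  by (simp add: H_inner_def plus_fun_def distrib_right distrib_left)

lemma H_inner_diff_left:
  assumes "X \<in> H_space \<Omega> \<Gamma>" "Y \<in> H_space \<Omega> \<Gamma>" "Z \<in> H_space \<Omega> \<Gamma>"
  shows "H_inner \<tau> \<Omega> \<Gamma> (X - Y) Z = H_inner \<tau> \<Omega> \<Gamma> X Z - H_inner \<tau> \<Omega> \<Gamma> Y Z"
  using H_space_integrable[OF assms(1,3)] H_space_integrable[OF assms(2,3)]
  by (simp add: H_inner_def fun_diff_def left_diff_distrib right_diff_distrib)

lemma H_inner_scale_left: "H_inner \<tau> \<Omega> \<Gamma> (H_scale c X) Y = c * H_inner \<tau> \<Omega> \<Gamma> X Y"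
  by (simp add: H_inner_def H_scale_def mult.assoc distrib_left mult.left_commute)

lemma H_inner_uminus_left: "H_inner \<tau> \<Omega> \<Gamma> (- X) Y = - H_inner \<tau> \<Omega> \<Gamma> X Y"
  by (simp add: H_inner_def fun_Compl_def)

lemma H_inner_uminus_right: "H_inner \<tau> \<Omega> \<Gamma> X (- Y) = - H_inner \<tau> \<Omega> \<Gamma> X Y"
  by (simp add: H_inner_def fun_Compl_def)

lemma H_inner_add_right:
  assumes "X \<in> H_space \<Omega> \<Gamma>" "Y \<in> H_space \<Omega> \<Gamma>" "Z \<in> H_space \<Omega> \<Gamma>"
  shows "H_inner \<tau> \<Omega> \<Gamma> Z (X + Y) = H_inner \<tau> \<Omega> \<Gamma> Z X + H_inner \<tau> \<Omega> \<Gamma> Z Y"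
  using H_inner_add_left[OF assms] by (simp add: H_inner_commute)

lemma H_inner_diff_right:
  assumes "X \<in> H_space \<Omega> \<Gamma>" "Y \<in> H_space \<Omega> \<Gamma>" "Z \<in> H_space \<Omega> \<Gamma>"
  shows "H_inner \<tau> \<Omega> \<Gamma> Z (X - Y) = H_inner \<tau> \<Omega> \<Gamma> Z X - H_inner \<tau> \<Omega> \<Gamma> Z Y"
  using H_inner_diff_left[OF assms] by (simp add: H_inner_commute)

lemma H_inner_self_nonneg: "0 \<le> \<tau> \<Longrightarrow> 0 \<le> H_inner \<tau> \<Omega> \<Gamma> X X"
  by (simp add: H_inner_def)

text \<open>The discriminant argument for a form that is only semidefinite on representatives: X may
  be nonzero on a null set, so \<open>a = 0\<close> is a case of its own.\<close>

lemma H_Cauchy_Schwarz: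
  assumes "0 \<le> \<tau>" and X: "X \<in> H_space \<Omega> \<Gamma>" and Y: "Y \<in> H_space \<Omega> \<Gamma>"
  shows "(H_inner \<tau> \<Omega> \<Gamma> X Y)\<^sup>2 \<le> H_inner \<tau> \<Omega> \<Gamma> X X * H_inner \<tau> \<Omega> \<Gamma> Y Y"
proof -
  define a where "a = H_inner \<tau> \<Omega> \<Gamma> X X"
  define b where "b = H_inner \<tau> \<Omega> \<Gamma> X Y"
  define c where "c = H_inner \<tau> \<Omega> \<Gamma> Y Y"
  have nn: "0 \<le> a * t\<^sup>2 + 2 * b * t + c" for t
  proof -
    have S: "H_scale t X \<in> H_space \<Omega> \<Gamma>" by (rule H_space_scale[OF X])
    have "H_inner \<tau> \<Omega> \<Gamma> Y (H_scale t X) = t * b" "H_inner \<tau> \<Omega> \<Gamma> X (H_scale t X) = t * a"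
      using H_inner_scale_left[of \<tau> \<Omega> \<Gamma> t X Y] H_inner_scale_left[of \<tau> \<Omega> \<Gamma> t X X]
      by (simp_all add: H_inner_commute a_def b_def)
    then have "H_inner \<tau> \<Omega> \<Gamma> (H_scale t X + Y) (H_scale t X + Y) = a * t\<^sup>2 + 2 * b * t + c"
      by (simp add: H_inner_add_left H_inner_add_right H_space_add X Y S H_inner_scale_left a_def[symmetric]
          b_def[symmetric] c_def[symmetric] power2_eq_square algebra_simps)
    then show ?thesis using H_inner_self_nonneg[OF \<open>0 \<le> \<tau>\<close>] by metis
  qed
  have "b\<^sup>2 \<le> a * c"
  proof (cases "a = 0")
    case True
    have "b = 0"
    proof (rule ccontr)
      assume "b \<noteq> 0"
      \<comment> \<open>With \<open>a = 0\<close> the polynomial is linear, and at this t it has the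
        value -1.\<close>
      then show False using nn[of "- (c + 1) / (2 * b)"] True by (simp add: field_simps)
    qed
    then show ?thesis using True by simp
  next
    case False
    then have "0 < a" using H_inner_self_nonneg[OF \<open>0 \<le> \<tau>\<close>, of \<Omega> \<Gamma> X] by (simp add: a_def)
    \<comment> \<open>\<open>a\<close> times the value at the minimiser -b / a.\<close>
    then have "0 \<le> a * (a * (- b / a)\<^sup>2 + 2 * b * (- b / a) + c)"
      by (intro mult_nonneg_nonneg[OF _ nn]) simp
    also have "\<dots> = a * c - b\<^sup>2"
      using \<open>0 < a\<close> by (simp add: field_simps power2_eq_square)
    finally show ?thesis by simp
  qed
  then show ?thesis by (simp add: a_def b_def c_def)
qed

lemma H_norm_nonneg [simp]: "0 \<le> H_norm \<Omega> \<Gamma> X"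
  by (simp add: H_norm_def H_inner_self_nonneg)

lemma H_norm_square: "(H_norm \<Omega> \<Gamma> X)\<^sup>2 = H_inner 1 \<Omega> \<Gamma> X X"
  by (simp add: H_norm_def H_inner_self_nonneg)

text \<open>Time regularity is expressed in the norm with weight 1, the flow in weight \<tau>; 1 +
  \<tau> dominates both weights.\<close>

lemma H_inner_self_le:
  assumes "0 \<le> \<tau>"
  shows "H_inner \<tau> \<Omega> \<Gamma> X X \<le> (1 + \<tau>) * (H_norm \<Omega> \<Gamma> X)\<^sup>2"
proof -
  have "0 \<le> (\<integral>x. fst X x * fst X x \<partial>lebesgue_on \<Omega>)" "0 \<le> (\<integral>x. snd X x * snd X x \<partial>surface_on \<Gamma>)"
    by simp_all
  then show ?thesis
    using assms unfolding H_norm_square H_inner_def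
    by (simp add: algebra_simps)
qed

lemma H_inner_bound:
  assumes "0 \<le> \<tau>" and X: "X \<in> H_space \<Omega> \<Gamma>" and Y: "Y \<in> H_space \<Omega> \<Gamma>"
  shows "\<bar>H_inner \<tau> \<Omega> \<Gamma> X Y\<bar> \<le> (1 + \<tau>) * (H_norm \<Omega> \<Gamma> X * H_norm \<Omega> \<Gamma> Y)"
proof -
  have "(H_inner \<tau> \<Omega> \<Gamma> X Y)\<^sup>2 \<le> H_inner \<tau> \<Omega> \<Gamma> X X * H_inner \<tau> \<Omega> \<Gamma> Y Y"
    by (rule H_Cauchy_Schwarz[OF assms])
  also have "\<dots> \<le> ((1 + \<tau>) * (H_norm \<Omega> \<Gamma> X)\<^sup>2) * ((1 + \<tau>) * (H_norm \<Omega> \<Gamma> Y)\<^sup>2)"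
    using assms by (intro mult_mono H_inner_self_le H_inner_self_nonneg) auto
  also have "\<dots> = ((1 + \<tau>) * (H_norm \<Omega> \<Gamma> X * H_norm \<Omega> \<Gamma> Y))\<^sup>2"
    by (simp add: power2_eq_square algebra_simps)
  finally show ?thesis
    using assms abs_le_square_iff[of "H_inner \<tau> \<Omega> \<Gamma> X Y" "(1 + \<tau>) * (H_norm \<Omega> \<Gamma> X * H_norm \<Omega> \<Gamma> Y)"]
    by (simp add: abs_mult)
qed

lemma H_norm_triangle:
  assumes X: "X \<in> H_space \<Omega> \<Gamma>" and Y: "Y \<in> H_space \<Omega> \<Gamma>"
  shows "H_norm \<Omega> \<Gamma> (X + Y) \<le> H_norm \<Omega> \<Gamma> X + H_norm \<Omega> \<Gamma> Y"
proof (rule power2_le_imp_le)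
  have "(H_inner 1 \<Omega> \<Gamma> X Y)\<^sup>2 \<le> (H_norm \<Omega> \<Gamma> X * H_norm \<Omega> \<Gamma> Y)\<^sup>2"
    using H_Cauchy_Schwarz[OF _ X Y, of 1] by (simp add: power_mult_distrib H_norm_square)
  then have "H_inner 1 \<Omega> \<Gamma> X Y \<le> H_norm \<Omega> \<Gamma> X * H_norm \<Omega> \<Gamma> Y"
    by (rule power2_le_imp_le) simp
  then show "(H_norm \<Omega> \<Gamma> (X + Y))\<^sup>2 \<le> (H_norm \<Omega> \<Gamma> X + H_norm \<Omega> \<Gamma> Y)\<^sup>2"
    unfolding power2_sum unfolding H_norm_square
    using H_inner_commute[of 1 \<Omega> \<Gamma> X Y]
    by (simp add: H_inner_add_left H_inner_add_right H_space_add X Y)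
qed simp

lemma H_norm_minus_commute: "H_norm \<Omega> \<Gamma> (X - Y) = H_norm \<Omega> \<Gamma> (Y - X)"
  using H_inner_uminus_left[of 1 \<Omega> \<Gamma> "X - Y" "Y - X"] H_inner_uminus_right[of 1 \<Omega> \<Gamma> "X - Y" "X - Y"]
  by (simp add: H_norm_def)

lemma H_norm_diff_triangle:
  assumes X: "X \<in> H_space \<Omega> \<Gamma>" and Y: "Y \<in> H_space \<Omega> \<Gamma>"
  shows "H_norm \<Omega> \<Gamma> (X - Y) \<le> H_norm \<Omega> \<Gamma> X + H_norm \<Omega> \<Gamma> Y"
  using H_norm_triangle[OF X H_space_uminus[OF Y]] H_norm_minus_commute[of \<Omega> \<Gamma> 0 Y] by simp

lemma H_norm_mono:
  assumes X: "X \<in> H_space \<Omega> \<Gamma>" and Y: "Y \<in> H_space \<Omega> \<Gamma>"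
    and "AE x in lebesgue_on \<Omega>. \<bar>fst X x\<bar> \<le> \<bar>fst Y x\<bar>" "AE x in surface_on \<Gamma>. \<bar>snd X x\<bar> \<le> \<bar>snd Y x\<bar>"
  shows "H_norm \<Omega> \<Gamma> X \<le> H_norm \<Omega> \<Gamma> Y"
proof -
  have "(\<integral>x. fst X x * fst X x \<partial>lebesgue_on \<Omega>) \<le> (\<integral>x. fst Y x * fst Y x \<partial>lebesgue_on \<Omega>)"
    by (rule integral_mono_AE[OF H_space_integrable(1)[OF X X] H_space_integrable(1)[OF Y Y]])
       (use assms(3) in eventually_elim, simp add: abs_le_square_iff power2_eq_square)
  moreover have "(\<integral>x. snd X x * snd X x \<partial>surface_on \<Gamma>) \<le> (\<integral>x. snd Y x * snd Y x \<partial>surface_on \<Gamma>)"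
    by (rule integral_mono_AE[OF H_space_integrable(2)[OF X X] H_space_integrable(2)[OF Y Y]])
       (use assms(4) in eventually_elim, simp add: abs_le_square_iff power2_eq_square)
  ultimately show ?thesis by (simp add: H_norm_def H_inner_def)
qed

lemma H_norm_pos_diff_le:
  assumes X: "X \<in> H_space \<Omega> \<Gamma>" and Y: "Y \<in> H_space \<Omega> \<Gamma>"
  shows "H_norm \<Omega> \<Gamma> (H_pos X - H_pos Y) \<le> H_norm \<Omega> \<Gamma> (X - Y)"
  by (rule H_norm_mono[OF H_space_diff[OF H_space_pos[OF X] H_space_pos[OF Y]] H_space_diff[OF X Y]])
     (auto simp: H_pos_def)

text \<open>\<open>X\<^sup>+\<close> is the gradient of \<open>(X\<^sup>+, X\<^sup>+)\<^sub>\<tau> / 2\<close>.\<close>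

lemma H_pos_square_convex:
  assumes "0 \<le> \<tau>" and X: "X \<in> H_space \<Omega> \<Gamma>" and Y: "Y \<in> H_space \<Omega> \<Gamma>"
  shows "H_inner \<tau> \<Omega> \<Gamma> (H_pos X) (H_pos X) / 2 - H_inner \<tau> \<Omega> \<Gamma> (H_pos Y) (H_pos Y) / 2
     \<le> H_inner \<tau> \<Omega> \<Gamma> (X - Y) (H_pos X)"
proof -
  note PX = H_space_pos[OF X] and PY = H_space_pos[OF Y]
  have pt: "max 0 x * max 0 x - max 0 y * max 0 y \<le> 2 * ((x - y) * max 0 x)" for x y :: real
  proof -
    have "0 \<le> (max 0 x - max 0 y)\<^sup>2" by simp
    then have "2 * (max 0 y * max 0 x) \<le> max 0 x * max 0 x + max 0 y * max 0 y"
      by (simp add: power2_eq_square algebra_simps)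
    moreover have "y * max 0 x \<le> max 0 y * max 0 x" by (intro mult_right_mono) auto
    moreover have "x * max 0 x = max 0 x * max 0 x" by (simp add: max_def)
    moreover have "(x - y) * max 0 x = x * max 0 x - y * max 0 x" by (rule left_diff_distrib)
    ultimately show ?thesis by linarith
  qed
  note i = H_space_integrable[OF PX PX] H_space_integrable[OF PY PY] H_space_integrable[OF H_space_diff[OF X Y] PX]
  have "(\<integral>x. fst (H_pos X) x * fst (H_pos X) x - fst (H_pos Y) x * fst (H_pos Y) x \<partial>lebesgue_on \<Omega>)
      \<le> (\<integral>x. 2 * (fst (X - Y) x * fst (H_pos X) x) \<partial>lebesgue_on \<Omega>)"
    using i by (intro integral_mono) (auto simp: H_pos_def intro: pt)
  moreover have "(\<integral>x. snd (H_pos X) x * snd (H_pos X) x - snd (H_pos Y) x * snd (H_pos Y) x \<partial>surface_on \<Gamma>)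
      \<le> (\<integral>x. 2 * (snd (X - Y) x * snd (H_pos X) x) \<partial>surface_on \<Gamma>)"
    using i by (intro integral_mono) (auto simp: H_pos_def intro: pt)
  ultimately have *: "(\<integral>x. fst (H_pos X) x * fst (H_pos X) x \<partial>lebesgue_on \<Omega>) - (\<integral>x. fst (H_pos Y) x * fst (H_pos Y) x \<partial>lebesgue_on \<Omega>)
      \<le> 2 * (\<integral>x. fst (X - Y) x * fst (H_pos X) x \<partial>lebesgue_on \<Omega>)"
    "(\<integral>x. snd (H_pos X) x * snd (H_pos X) x \<partial>surface_on \<Gamma>) - (\<integral>x. snd (H_pos Y) x * snd (H_pos Y) x \<partial>surface_on \<Gamma>)
      \<le> 2 * (\<integral>x. snd (X - Y) x * snd (H_pos X) x \<partial>surface_on \<Gamma>)"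
    using i by simp_all
  have arith: "(a + \<tau> * a') / 2 - (b + \<tau> * b') / 2 \<le> c + \<tau> * c'"
    if "a - b \<le> 2 * c" "a' - b' \<le> 2 * c'" for a a' b b' c c'
  proof -
    have "(a + p) / 2 - (b + q) / 2 \<le> c + r" if "p - q \<le> 2 * r" for p q r
      using \<open>a - b \<le> 2 * c\<close> that by (simp add: field_simps)
    moreover have "\<tau> * a' - \<tau> * b' \<le> 2 * (\<tau> * c')"
      using mult_left_mono[OF that(2) \<open>0 \<le> \<tau>\<close>] by (simp add: right_diff_distrib mult.left_commute)
    ultimately show ?thesis .
  qed
  show ?thesis
    unfolding H_inner_def by (rule arith[OF *])
qed

lemma H_le_if_H_pos_le_0:
  assumes X: "X \<in> H_space \<Omega> \<Gamma>" and Y: "Y \<in> H_space \<Omega> \<Gamma>" and "0 < \<tau>"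
    and "H_inner \<tau> \<Omega> \<Gamma> (H_pos (X - Y)) (H_pos (X - Y)) \<le> 0"
  shows "H_le \<Omega> \<Gamma> X Y"
proof -
  let ?P = "H_pos (X - Y)"
  have P: "?P \<in> H_space \<Omega> \<Gamma>" by (intro H_space_pos H_space_diff X Y)
  note i = H_space_integrable[OF P P]
  have nn: "0 \<le> (\<integral>x. fst ?P x * fst ?P x \<partial>lebesgue_on \<Omega>)" "0 \<le> (\<integral>x. snd ?P x * snd ?P x \<partial>surface_on \<Gamma>)"
    by simp_all
  have "(\<integral>x. fst ?P x * fst ?P x \<partial>lebesgue_on \<Omega>) = 0" "(\<integral>x. snd ?P x * snd ?P x \<partial>surface_on \<Gamma>) = 0"
    using assms(4) nn mult_nonneg_nonneg[OF less_imp_le[OF \<open>0 < \<tau>\<close>] nn(2)] \<open>0 < \<tau>\<close>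
    unfolding H_inner_def by (auto simp: add_nonneg_eq_0_iff antisym_conv)
  then have "AE x in lebesgue_on \<Omega>. fst ?P x * fst ?P x = 0" "AE x in surface_on \<Gamma>. snd ?P x * snd ?P x = 0"
    using i by (auto simp: integral_nonneg_eq_0_iff_AE)
  then show ?thesis
    unfolding H_le_def H_pos_def by (auto elim!: eventually_mono simp: max_def split: if_splits)
qed

section \<open>Submodularity of the energy and monotonicity of its subdifferential\<close>

lemma surface_on_measurable_subset:
  fixes F :: "'a::euclidean_space set"
  assumes "closed F" "\<Gamma> \<subseteq> F" "\<Gamma> \<in> sets (hausdorff_measure (DIM('a) - 1))"
    and f: "f \<in> borel_measurable (surface_on F)"
  shows "f \<in> borel_measurable (surface_on \<Gamma>)"
proof -
  have F: "F \<in> sets (hausdorff_measure (DIM('a) - 1))"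
    by (rule closed_in_sets_hausdorff_measure[OF \<open>closed F\<close>])
  have "restrict_space (surface_on F) \<Gamma> = surface_on \<Gamma>"
    unfolding surface_on_def using F assms(2,3)
    by (subst restrict_restrict_space) (auto simp: Int_absorb1 sets.Int_space_eq2)
  then show ?thesis using measurable_restrict_space1[OF f, of \<Gamma>] by simp
qed

text \<open>Minimum and maximum are written as U1 - P and U2 + P with P the positive part of U1 -
  U2, so that the same P appears as the increment in both subdifferential inequalities.\<close>

lemma energy_submodular:
  fixes \<Omega> \<Gamma> :: "'a::euclidean_space set"
  assumes \<Omega>: "open \<Omega>" "bounded \<Omega>" and fat: "\<And>x. x \<in> frontier \<Omega> \<Longrightarrow> fat_at \<Omega> x"
    and \<Gamma>: "\<Gamma> \<subseteq> frontier \<Omega>" "\<Gamma> \<in> sets (hausdorff_measure (DIM('a) - 1))"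
    and \<gamma>: "BV_trace_operator \<Omega> \<gamma>"
    and U1: "energy \<Omega> \<Gamma> \<gamma> U1 < \<infinity>" and U2: "energy \<Omega> \<Gamma> \<gamma> U2 < \<infinity>"
  shows "energy \<Omega> \<Gamma> \<gamma> (U1 - H_pos (U1 - U2)) + energy \<Omega> \<Gamma> \<gamma> (U2 + H_pos (U1 - U2))
    \<le> energy \<Omega> \<Gamma> \<gamma> U1 + energy \<Omega> \<Gamma> \<gamma> U2"
proof -
  define u1 where "u1 = fst U1" define v1 where "v1 = snd U1"
  define u2 where "u2 = fst U2" define v2 where "v2 = snd U2"
  have u: "u1 \<in> BV \<Omega>" "u2 \<in> BV \<Omega>" and v: "v1 \<in> L2_functions (surface_on \<Gamma>)" "v2 \<in> L2_functions (surface_on \<Gamma>)"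
    using U1 U2 unfolding energy_def u1_def v1_def u2_def v2_def by (auto split: if_splits)
  let ?min = "\<lambda>f g (x::'a). min (f x) (g x :: real)" and ?max = "\<lambda>f g (x::'a). max (f x) (g x :: real)"
  have eq: "fst (U1 - H_pos (U1 - U2)) = ?min u1 u2" "snd (U1 - H_pos (U1 - U2)) = ?min v1 v2"
    "fst (U2 + H_pos (U1 - U2)) = ?max u1 u2" "snd (U2 + H_pos (U1 - U2)) = ?max v1 v2"
    by (auto simp: H_pos_def u1_def u2_def v1_def v2_def min_def max_def)
  note m = BV_min_max[OF \<Omega> u] and l = L2_functions_min_max[OF v]
  have tr: "AE x in surface_on \<Gamma>. \<gamma> (?min u1 u2) x = min (\<gamma> u1 x) (\<gamma> u2 x) \<and> \<gamma> (?max u1 u2) x = max (\<gamma> u1 x) (\<gamma> u2 x)"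
    by (rule AE_surface_on_subset[OF frontier_closed \<Gamma> BV_trace_min_max[OF \<Omega> fat \<gamma> u]])
  have mg: "\<gamma> w \<in> borel_measurable (surface_on \<Gamma>)" if "w \<in> BV \<Omega>" for w
    using \<gamma> that by (intro surface_on_measurable_subset[OF frontier_closed \<Gamma>]) (auto simp: BV_trace_operator_def)
  have [measurable]: "\<gamma> u1 \<in> borel_measurable (surface_on \<Gamma>)" "\<gamma> u2 \<in> borel_measurable (surface_on \<Gamma>)"
    "\<gamma> (?min u1 u2) \<in> borel_measurable (surface_on \<Gamma>)" "\<gamma> (?max u1 u2) \<in> borel_measurable (surface_on \<Gamma>)"
    "v1 \<in> borel_measurable (surface_on \<Gamma>)" "v2 \<in> borel_measurable (surface_on \<Gamma>)"
    using mg u m v by (auto simp: L2_functions_def)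
  let ?b = "\<lambda>u v. \<integral>\<^sup>+x. ennreal \<bar>\<gamma> u x - v x\<bar> \<partial>surface_on \<Gamma>"
  have "?b (?min u1 u2) (?min v1 v2) + ?b (?max u1 u2) (?max v1 v2)
      = (\<integral>\<^sup>+x. ennreal \<bar>\<gamma> (?min u1 u2) x - ?min v1 v2 x\<bar> + ennreal \<bar>\<gamma> (?max u1 u2) x - ?max v1 v2 x\<bar> \<partial>surface_on \<Gamma>)"
    by (rule nn_integral_add[symmetric]) measurable
  also have "\<dots> \<le> (\<integral>\<^sup>+x. ennreal \<bar>\<gamma> u1 x - v1 x\<bar> + ennreal \<bar>\<gamma> u2 x - v2 x\<bar> \<partial>surface_on \<Gamma>)"
  proof (rule nn_integral_mono_AE)
    \<comment> \<open>Sorting two pairs of reals does not increase the sum of their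
      distances.\<close>
    have pt: "\<bar>min a b - min c d\<bar> + \<bar>max a b - max c d\<bar> \<le> \<bar>a - c\<bar> + \<bar>b - d\<bar>" for a b c d :: real
      by (auto simp: min_def max_def)
    show "AE x in surface_on \<Gamma>. ennreal \<bar>\<gamma> (?min u1 u2) x - ?min v1 v2 x\<bar> + ennreal \<bar>\<gamma> (?max u1 u2) x - ?max v1 v2 x\<bar>
       \<le> ennreal \<bar>\<gamma> u1 x - v1 x\<bar> + ennreal \<bar>\<gamma> u2 x - v2 x\<bar>"
      using tr by eventually_elim (auto simp: pt ennreal_plus[symmetric] simp del: ennreal_plus intro!: ennreal_leI)
  qed
  also have "\<dots> = ?b u1 v1 + ?b u2 v2"
    by (rule nn_integral_add) measurable
  finally have bd: "?b (?min u1 u2) (?min v1 v2) + ?b (?max u1 u2) (?max v1 v2) \<le> ?b u1 v1 + ?b u2 v2" .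
  have "energy \<Omega> \<Gamma> \<gamma> (U1 - H_pos (U1 - U2)) + energy \<Omega> \<Gamma> \<gamma> (U2 + H_pos (U1 - U2))
    = (total_variation \<Omega> (?min u1 u2) + total_variation \<Omega> (?max u1 u2))
      + (?b (?min u1 u2) (?min v1 v2) + ?b (?max u1 u2) (?max v1 v2))"
    unfolding energy_def eq using m l by (simp add: ac_simps)
  also have "\<dots> \<le> (total_variation \<Omega> u1 + total_variation \<Omega> u2) + (?b u1 v1 + ?b u2 v2)"
    by (intro add_mono total_variation_submodular \<Omega> u bd)
  also have "\<dots> = energy \<Omega> \<Gamma> \<gamma> U1 + energy \<Omega> \<Gamma> \<gamma> U2"
    using u v unfolding energy_def u1_def u2_def v1_def v2_def by (simp add: ac_simps)
  finally show ?thesis .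
qed

text \<open>The inequalities of the two subgradients, tested with \<open>U1 \<and> U2\<close> and \<open>U1 \<or> U2\<close>, are added.\<close>

lemma H_subdifferential_T_monotone:
  fixes E :: "'a::euclidean_space state \<Rightarrow> ennreal"
  assumes sub: "E (U1 - H_pos (U1 - U2)) + E (U2 + H_pos (U1 - U2)) \<le> E U1 + E U2"
    and U: "U1 \<in> H_space \<Omega> \<Gamma>" "U2 \<in> H_space \<Omega> \<Gamma>"
    and \<xi>: "\<xi>1 \<in> H_subdifferential \<tau> \<Omega> \<Gamma> E U1" "\<xi>2 \<in> H_subdifferential \<tau> \<Omega> \<Gamma> E U2"
  shows "0 \<le> H_inner \<tau> \<Omega> \<Gamma> (\<xi>1 - \<xi>2) (H_pos (U1 - U2))"
proof -
  define P where "P = H_pos (U1 - U2)"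
  have P: "P \<in> H_space \<Omega> \<Gamma>" unfolding P_def by (intro H_space_pos H_space_diff U)
  have \<xi>H: "\<xi>1 \<in> H_space \<Omega> \<Gamma>" "\<xi>2 \<in> H_space \<Omega> \<Gamma>" and fin: "E U1 < \<infinity>" "E U2 < \<infinity>"
    using \<xi> by (auto simp: H_subdifferential_def)
  have fin': "E (U1 - P) < \<infinity>" "E (U2 + P) < \<infinity>"
    using le_less_trans[OF sub[folded P_def], of top] fin by (auto simp: less_top[symmetric])
  obtain e1 e2 e3 e4 where e: "E U1 = ennreal e1" "E U2 = ennreal e2" "E (U1 - P) = ennreal e3" "E (U2 + P) = ennreal e4"
    and nn: "0 \<le> e1" "0 \<le> e2" "0 \<le> e3" "0 \<le> e4"
    using fin fin' by (cases "E U1"; cases "E U2"; cases "E (U1 - P)"; cases "E (U2 + P)") auto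
  have "enn2ereal (E U1) + ereal (H_inner \<tau> \<Omega> \<Gamma> \<xi>1 ((U1 - P) - U1)) \<le> enn2ereal (E (U1 - P))"
    using \<xi>(1) H_space_diff[OF U(1) P] by (auto simp: H_subdifferential_def)
  then have 1: "e1 - H_inner \<tau> \<Omega> \<Gamma> \<xi>1 P \<le> e3"
    unfolding e using nn by (simp add: H_inner_uminus_right)
  have "enn2ereal (E U2) + ereal (H_inner \<tau> \<Omega> \<Gamma> \<xi>2 ((U2 + P) - U2)) \<le> enn2ereal (E (U2 + P))"
    using \<xi>(2) H_space_add[OF U(2) P] by (auto simp: H_subdifferential_def)
  then have 2: "e2 + H_inner \<tau> \<Omega> \<Gamma> \<xi>2 P \<le> e4"
    unfolding e using nn by simp
  have "e3 + e4 \<le> e1 + e2"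
    using sub nn unfolding P_def[symmetric] e by (simp flip: ennreal_plus)
  then show ?thesis
    using 1 2 unfolding P_def[symmetric] by (simp add: H_inner_diff_left \<xi>H P)
qed

section \<open>Weak derivatives in time\<close>

definition half_square :: "real \<Rightarrow> real" where
  "half_square x = (max 0 x)\<^sup>2 / 2"

text \<open>Four times the second difference of \<open>half_square\<close> with step 1/2: a C1
  passage from 0 to 1 across the unit interval, whose derivative \<open>tent\<close> is the hat
  function of height 2.\<close>

definition smooth_ramp :: "real \<Rightarrow> real" where
  "smooth_ramp x = 4 * (half_square x - 2 * half_square (x - 1/2) + half_square (x - 1))"

definition tent :: "real \<Rightarrow> real" where
  "tent x = 4 * (max 0 x - 2 * max 0 (x - 1/2) + max 0 (x - 1))"

lemma half_square_derivative: "(half_square has_real_derivative max 0 x) (at x)"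
  unfolding has_field_derivative_def has_derivative_at_alt
proof (intro conjI allI impI)
  show "bounded_linear ((*) (max 0 x))" by (rule bounded_linear_mult_right)
  fix e :: real assume "0 < e"
  have quad: "\<bar>half_square y - half_square x - max 0 x * (y - x)\<bar> \<le> \<bar>y - x\<bar> * \<bar>y - x\<bar>" for y
  proof -
    have sq: "\<bar>y - x\<bar> * \<bar>y - x\<bar> = y * y - 2 * (x * y) + x * x"
      unfolding abs_mult_self_eq by (simp add: algebra_simps)
    have nn: "0 \<le> y * y" "0 \<le> x * x" "0 \<le> y * y - 2 * (x * y) + x * x"
      unfolding sq[symmetric] by simp_all
    consider "0 \<le> x" "0 \<le> y" | "0 \<le> x" "y < 0" | "x < 0" "0 \<le> y" | "x < 0" "y < 0" by linarith
    then show ?thesis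
    proof cases
      case 1
      then have eq: "half_square y - half_square x - max 0 x * (y - x) = y * y / 2 - x * y + x * x / 2"
        by (simp add: half_square_def power2_eq_square field_simps)
      show ?thesis unfolding sq eq using nn by linarith
    next
      case 2
      then have eq: "half_square y - half_square x - max 0 x * (y - x) = x * x / 2 - x * y"
        by (simp add: half_square_def power2_eq_square field_simps)
      have "x * y \<le> 0" using 2 by (simp add: mult_nonneg_nonpos)
      then show ?thesis unfolding sq eq using nn by linarith
    next
      case 3
      then have eq: "half_square y - half_square x - max 0 x * (y - x) = y * y / 2"
        by (simp add: half_square_def power2_eq_square)
      have "x * y \<le> 0" using 3 by (simp add: mult_nonpos_nonneg)
      then show ?thesis unfolding sq eq using nn by linarith
    qed (simp add: half_square_def)
  qed
  show "\<exists>d>0. \<forall>y. norm (y - x) < d \<longrightarrow> norm (half_square y - half_square x - max 0 x * (y - x)) \<le> e * norm (y - x)"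
  proof (intro exI[of _ e] conjI allI impI)
    fix y assume "norm (y - x) < e"
    then have "\<bar>y - x\<bar> * \<bar>y - x\<bar> \<le> e * \<bar>y - x\<bar>" by (intro mult_right_mono) auto
    with quad[of y] show "norm (half_square y - half_square x - max 0 x * (y - x)) \<le> e * norm (y - x)"
      by simp
  qed fact
qed

lemma smooth_ramp_derivative: "(smooth_ramp has_real_derivative tent x) (at x)"
proof -
  have "((\<lambda>x. half_square (x - c)) has_real_derivative max 0 (x - c)) (at x)" for c
  proof -
    have "((\<lambda>x. half_square (x - c)) has_real_derivative max 0 (x - c) * 1) (at x)"
      by (rule DERIV_chain2[OF half_square_derivative]) (auto intro!: derivative_eq_intros)
    then show ?thesis by simp
  qed
  from this[of "1/2"] this[of 1] half_square_derivative[of x] show ?thesis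
    unfolding smooth_ramp_def[abs_def] tent_def
    by (intro DERIV_cmult DERIV_add DERIV_diff)
qed

lemma smooth_ramp_scaled_derivative:
  assumes "0 < h"
  shows "((\<lambda>x. smooth_ramp ((x - c) / h)) has_real_derivative tent ((x - c) / h) / h) (at x)"
proof -
  have "((\<lambda>x. smooth_ramp ((x - c) / h)) has_real_derivative tent ((x - c) / h) * (1 / h)) (at x)"
    by (rule DERIV_chain2[OF smooth_ramp_derivative]) (use assms in \<open>auto intro!: derivative_eq_intros\<close>)
  then show ?thesis by simp
qed

lemma continuous_on_tent: "continuous_on S tent"
  unfolding tent_def[abs_def] by (intro continuous_intros)

lemma tent_nonneg: "0 \<le> tent x"
  by (auto simp: tent_def max_def)

lemma tent_eq_0: "x \<le> 0 \<or> 1 \<le> x \<Longrightarrow> tent x = 0"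
  by (auto simp: tent_def max_def)

lemma smooth_ramp_eq_0: "x \<le> 0 \<Longrightarrow> smooth_ramp x = 0"
  by (simp add: smooth_ramp_def half_square_def)

lemma smooth_ramp_eq_1: "1 \<le> x \<Longrightarrow> smooth_ramp x = 1"
  by (simp add: smooth_ramp_def half_square_def power2_eq_square field_simps)

lemma smooth_ramp_bounds: "0 \<le> smooth_ramp x" "smooth_ramp x \<le> 1"
proof -
  have mono: "smooth_ramp x \<le> smooth_ramp y" if "x \<le> y" for x y
  proof (rule DERIV_nonneg_imp_nondecreasing[OF that])
    fix z show "\<exists>w. (smooth_ramp has_real_derivative w) (at z) \<and> 0 \<le> w"
      by (intro exI[of _ "tent z"] conjI smooth_ramp_derivative tent_nonneg)
  qed
  show "0 \<le> smooth_ramp x" using mono[of "min 0 x" x] smooth_ramp_eq_0[of "min 0 x"] by simp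
  show "smooth_ramp x \<le> 1" using mono[of x "max 1 x"] smooth_ramp_eq_1[of "max 1 x"] by simp
qed

lemma integrable_lebesgue_on_Ioo_continuous:
  fixes f :: "real \<Rightarrow> real"
  assumes "continuous_on {a..b} f"
  shows "integrable (lebesgue_on {a<..<b}) f"
proof -
  have "f absolutely_integrable_on {a..b}"
    by (rule absolutely_integrable_continuous_real[OF assms])
  then have "f absolutely_integrable_on {a<..<b}"
    by (rule set_integrable_subset) auto
  then show ?thesis
    by (simp add: integrable_restrict_space set_integrable_def)
qed

text \<open>The scaled tent is a probability density on \<open>{c..c + h}\<close>: its primitive,
  the scaled ramp, rises from 0 to 1 within \<open>{0..T}\<close>. The average therefore deviates
  from \<open>f c\<close> by at most the oscillation of f to the right of c.\<close>

lemma tent_average: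
  fixes f :: "real \<Rightarrow> real"
  assumes f: "continuous_on {0..T} f" and "0 \<le> c" "0 < h" "c + h \<le> T"
    and e: "\<And>x. c \<le> x \<Longrightarrow> x \<le> c + h \<Longrightarrow> \<bar>f x - f c\<bar> \<le> e"
  shows "\<bar>(\<integral>x. tent ((x - c) / h) / h * f x \<partial>lebesgue_on {0<..<T}) - f c\<bar> \<le> e"
proof -
  define k where "k x = tent ((x - c) / h) / h" for x
  have kc: "continuous_on S k" for S
    unfolding k_def[abs_def]
    using \<open>0 < h\<close> by (intro continuous_intros continuous_on_compose2[OF continuous_on_tent[of UNIV]]) auto
  have k0: "0 \<le> k x" for x unfolding k_def using tent_nonneg \<open>0 < h\<close> by simp
  have ik: "integrable (lebesgue_on {0<..<T}) k" "integrable (lebesgue_on {0<..<T}) (\<lambda>x. k x * f x)"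
    by (intro integrable_lebesgue_on_Ioo_continuous continuous_intros kc f)+
  have "((\<lambda>x. smooth_ramp ((x - c) / h)) has_real_derivative k x) (at x)" for x
    unfolding k_def by (rule smooth_ramp_scaled_derivative[OF \<open>0 < h\<close>])
  then have "(k has_integral (smooth_ramp ((T - c) / h) - smooth_ramp ((0 - c) / h))) {0..T}"
    using assms by (intro fundamental_theorem_of_calculus)
      (auto simp flip: has_real_derivative_iff_has_vector_derivative intro: has_field_derivative_at_within)
  moreover have "smooth_ramp ((T - c) / h) = 1" "smooth_ramp ((0 - c) / h) = 0"
    using assms by (auto intro!: smooth_ramp_eq_1 smooth_ramp_eq_0 simp: field_simps)
  ultimately have "(k has_integral 1) {0<..<T}"
    unfolding has_integral_Icc_iff_Ioo by simp
  then have "integral {0<..<T} k = 1" by (rule integral_unique)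
  then have one: "(\<integral>x. k x \<partial>lebesgue_on {0<..<T}) = 1"
    by (subst lebesgue_integral_eq_integral[OF ik(1)]) auto
  have "(\<integral>x. k x * f x \<partial>lebesgue_on {0<..<T}) - f c = (\<integral>x. k x * f x - k x * f c \<partial>lebesgue_on {0<..<T})"
    using ik one by simp
  also have "\<bar>\<dots>\<bar> \<le> (\<integral>x. \<bar>k x * f x - k x * f c\<bar> \<partial>lebesgue_on {0<..<T})"
    by (rule integral_abs_bound)
  also have "\<dots> \<le> (\<integral>x. k x * e \<partial>lebesgue_on {0<..<T})"
  proof (rule integral_mono)
    fix x
    show "\<bar>k x * f x - k x * f c\<bar> \<le> k x * e"
    proof (cases "c \<le> x \<and> x \<le> c + h")
      case True
      have "\<bar>k x * f x - k x * f c\<bar> = k x * \<bar>f x - f c\<bar>"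
        using k0[of x] by (simp add: abs_mult flip: right_diff_distrib)
      also have "\<dots> \<le> k x * e" using True e[of x] by (intro mult_left_mono k0) auto
      finally show ?thesis .
    next
      case False
      then have "tent ((x - c) / h) = 0" using \<open>0 < h\<close> by (intro tent_eq_0) (auto simp: field_simps)
      then show ?thesis by (simp add: k_def)
    qed
  qed (use ik in auto)
  also have "\<dots> = e" using one by simp
  finally show ?thesis by (simp only: k_def)
qed

lemma tent_average_tendsto:
  fixes f :: "real \<Rightarrow> real"
  assumes f: "continuous_on {0..T} f" and c: "0 \<le> c" "c < T" and h: "\<And>n. 0 < h n" "h \<longlonglongrightarrow> 0"
  shows "(\<lambda>n. \<integral>x. tent ((x - c) / h n) / h n * f x \<partial>lebesgue_on {0<..<T}) \<longlonglongrightarrow> f c"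
proof (rule LIMSEQ_I)
  fix e :: real assume "0 < e"
  obtain d where d: "0 < d" "\<And>x. x \<in> {0..T} \<Longrightarrow> \<bar>x - c\<bar> < d \<Longrightarrow> \<bar>f x - f c\<bar> < e / 2"
    using f[unfolded continuous_on_iff, rule_format, of c "e/2"] c \<open>0 < e\<close> by (auto simp: dist_real_def)
  have "\<forall>\<^sub>F n in sequentially. h n < min d (T - c)"
    using h d c by (intro order_tendstoD) auto
  then obtain N where N: "\<And>n. N \<le> n \<Longrightarrow> h n < min d (T - c)"
    by (auto simp: eventually_sequentially)
  show "\<exists>N. \<forall>n\<ge>N. norm ((\<integral>x. tent ((x - c) / h n) / h n * f x \<partial>lebesgue_on {0<..<T}) - f c) < e"
  proof (intro exI[of _ N] allI impI)
    fix n assume n: "N \<le> n"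
    have "\<bar>(\<integral>x. tent ((x - c) / h n) / h n * f x \<partial>lebesgue_on {0<..<T}) - f c\<bar> \<le> e / 2"
    proof (rule tent_average[OF f c(1) h(1)])
      fix x assume "c \<le> x" "x \<le> c + h n"
      then show "\<bar>f x - f c\<bar> \<le> e / 2" using N[OF n] c by (intro less_imp_le d) auto
    qed (use N[OF n] in auto)
    then show "norm ((\<integral>x. tent ((x - c) / h n) / h n * f x \<partial>lebesgue_on {0<..<T}) - f c) < e"
      using \<open>0 < e\<close> by simp
  qed
qed

text \<open>The test functions rise from 0 to 1 just after s and fall back just after t. Their
  derivatives average f near s and near t, while the functions themselves converge boundedly to the
  indicator of the interval.\<close>

lemma weak_derivative_imp_integral:
  fixes f g :: "real \<Rightarrow> real"
  assumes st: "0 < s" "s < t" "t < T" and f: "continuous_on {0..T} f"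
    and g: "integrable (lebesgue_on {0<..<T}) g"
    and weak: "\<And>\<phi>. \<phi> C1_differentiable_on UNIV \<Longrightarrow> (\<exists>K. compact K \<and> K \<subseteq> {0<..<T} \<and> (\<forall>t. t \<notin> K \<longrightarrow> \<phi> t = 0)) \<Longrightarrow>
      (\<integral>x. deriv \<phi> x * f x \<partial>lebesgue_on {0<..<T}) = - (\<integral>x. \<phi> x * g x \<partial>lebesgue_on {0<..<T})"
  shows "f t - f s = (\<integral>x. indicat_real {s<..t} x * g x \<partial>lebesgue_on {0<..<T})"
proof -
  \<comment> \<open>The denominator is at least 2, so \<open>h n < T - t\<close> for every n and the
    supports \<open>{s..t + h n}\<close> stay inside \<open>{0<..<T}\<close>.\<close>
  define h where "h n = (T - t) / real (n + 2)" for n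
  have h: "0 < h n" "h n < T - t" for n
    using st divide_strict_left_mono[of 1 "real (n + 2)" "T - t"] by (auto simp: h_def)
  have h0: "h \<longlonglongrightarrow> 0"
    unfolding h_def using LIMSEQ_ignore_initial_segment[OF lim_const_over_n[of "T - t"], of 2] by simp
  define \<phi> where "\<phi> n x = smooth_ramp ((x - s) / h n) - smooth_ramp ((x - t) / h n)" for n x
  define D where "D n x = tent ((x - s) / h n) / h n - tent ((x - t) / h n) / h n" for n x
  have ramp: "((\<lambda>x. smooth_ramp ((x - c) / h n)) has_real_derivative tent ((x - c) / h n) / h n) (at x)" for c x n
    by (rule smooth_ramp_scaled_derivative[OF h(1)])
  have \<phi>': "(\<phi> n has_real_derivative D n x) (at x)" for n x
    unfolding \<phi>_def D_def by (intro DERIV_diff ramp)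
  have tc: "continuous_on S (\<lambda>x. tent ((x - c) / h n) / h n)" for S c n
    using h(1)[of n] by (intro continuous_intros continuous_on_compose2[OF continuous_on_tent[of UNIV]]) auto
  have C1: "\<phi> n C1_differentiable_on UNIV" for n
    unfolding C1_differentiable_on_def
  proof (intro exI[of _ "D n"] conjI ballI)
    show "(\<phi> n has_vector_derivative D n x) (at x)" for x
      using \<phi>' by (simp add: has_real_derivative_iff_has_vector_derivative)
    show "continuous_on UNIV (D n)" unfolding D_def[abs_def] by (intro continuous_intros tc)
  qed
  have supp: "\<phi> n x = 0" if "x \<notin> {s..t + h n}" for n x
  proof (cases "x < s")
    case True
    then show ?thesis
      using st h(1)[of n] by (simp add: \<phi>_def smooth_ramp_eq_0 divide_nonpos_pos)
  next
    case False
    then have "t + h n < x" using that by auto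
    then show ?thesis
      using st h(1)[of n] by (simp add: \<phi>_def smooth_ramp_eq_1 field_simps)
  qed
  have eq: "(\<integral>x. D n x * f x \<partial>lebesgue_on {0<..<T}) = - (\<integral>x. \<phi> n x * g x \<partial>lebesgue_on {0<..<T})" for n
  proof -
    have "deriv (\<phi> n) x = D n x" for x by (rule DERIV_imp_deriv[OF \<phi>'])
    moreover have "\<exists>K. compact K \<and> K \<subseteq> {0<..<T} \<and> (\<forall>t. t \<notin> K \<longrightarrow> \<phi> n t = 0)"
      using supp[of _ n] st h(2)[of n] by (intro exI[of _ "{s..t + h n}"]) auto
    ultimately show ?thesis using weak[OF C1[of n]] by simp
  qed
  have "(\<lambda>n. \<integral>x. D n x * f x \<partial>lebesgue_on {0<..<T}) \<longlonglongrightarrow> f s - f t"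
  proof -
    have "(\<integral>x. D n x * f x \<partial>lebesgue_on {0<..<T})
       = (\<integral>x. tent ((x - s) / h n) / h n * f x \<partial>lebesgue_on {0<..<T})
         - (\<integral>x. tent ((x - t) / h n) / h n * f x \<partial>lebesgue_on {0<..<T})" for n
      unfolding D_def left_diff_distrib
      by (intro Bochner_Integration.integral_diff integrable_lebesgue_on_Ioo_continuous continuous_on_mult tc f)
    then show ?thesis
      using tendsto_diff[OF tent_average_tendsto[OF f, of s h] tent_average_tendsto[OF f, of t h]] st h h0 by simp
  qed
  moreover have "(\<lambda>n. - (\<integral>x. \<phi> n x * g x \<partial>lebesgue_on {0<..<T}))
      \<longlonglongrightarrow> - (\<integral>x. indicat_real {s<..t} x * g x \<partial>lebesgue_on {0<..<T})"
  proof (rule tendsto_minus, rule integral_dominated_convergence[where w="\<lambda>x. norm (g x)"])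
    have gm: "g \<in> borel_measurable (lebesgue_on {0<..<T})" using g by auto
    have mono: "(f :: real \<Rightarrow> real) \<in> borel_measurable (lebesgue_on {0<..<T})" if "f \<in> borel_measurable borel" for f
      using that by (intro measurable_restrict_space1 measurable_completion) auto
    have "continuous_on UNIV (\<phi> n)" for n
      by (intro continuous_at_imp_continuous_on ballI DERIV_isCont[OF \<phi>'])
    then have \<phi>m: "\<phi> n \<in> borel_measurable (lebesgue_on {0<..<T})" for n
      by (intro mono borel_measurable_continuous_onI)
    show "(\<lambda>x. \<phi> n x * g x) \<in> borel_measurable (lebesgue_on {0<..<T})" for n
      using \<phi>m gm by (rule borel_measurable_times)
    show "(\<lambda>x. indicat_real {s<..t} x * g x) \<in> borel_measurable (lebesgue_on {0<..<T})"
      by (rule borel_measurable_times[OF mono gm]) simp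
    show "AE x in lebesgue_on {0<..<T}. (\<lambda>n. \<phi> n x * g x) \<longlonglongrightarrow> indicat_real {s<..t} x * g x"
    proof (rule AE_I2, rule tendsto_mult_right)
      fix x
      \<comment> \<open>The ramp vanishes at its starting point, so the limit is the indicator of an
        interval open on the left; the difference of two such limits is the half-open
        \<open>{s<..t}\<close>.\<close>
      have step: "(\<lambda>n. smooth_ramp ((x - c) / h n)) \<longlonglongrightarrow> indicat_real {c<..} x" for c
      proof (cases "c < x")
        case True
        have "\<forall>\<^sub>F n in sequentially. h n < x - c"
          using h0 True by (intro order_tendstoD) auto
        then have "\<forall>\<^sub>F n in sequentially. smooth_ramp ((x - c) / h n) = 1"
        proof eventually_elim
          case (elim n)
          then show ?case using h(1)[of n] by (intro smooth_ramp_eq_1) (simp add: field_simps)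
        qed
        then show ?thesis using True by (simp add: tendsto_eventually)
      next
        case False
        then have "smooth_ramp ((x - c) / h n) = 0" for n
          using h(1)[of n] by (intro smooth_ramp_eq_0) (simp add: field_simps)
        then show ?thesis using False by simp
      qed
      have "indicat_real {s<..t} x = indicat_real {s<..} x - indicat_real {t<..} x"
        using st by (auto simp: indicator_def)
      then show "(\<lambda>n. \<phi> n x) \<longlonglongrightarrow> indicat_real {s<..t} x"
        unfolding \<phi>_def by (auto intro!: tendsto_diff step)
    qed
    show "AE x in lebesgue_on {0<..<T}. norm (\<phi> n x * g x) \<le> norm (g x)" for n
    proof (rule AE_I2)
      fix x
      have "\<bar>\<phi> n x\<bar> \<le> 1"
        using smooth_ramp_bounds[of "(x - s) / h n"] smooth_ramp_bounds[of "(x - t) / h n"]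
        by (auto simp: \<phi>_def abs_le_iff)
      then show "norm (\<phi> n x * g x) \<le> norm (g x)"
        using mult_right_mono[of "\<bar>\<phi> n x\<bar>" 1 "\<bar>g x\<bar>"] by (simp add: abs_mult)
    qed
  qed (use g in auto)
  ultimately have "f s - f t = - (\<integral>x. indicat_real {s<..t} x * g x \<partial>lebesgue_on {0<..<T})"
    unfolding eq by (rule LIMSEQ_unique)
  then show ?thesis by simp
qed

section \<open>Scalar pairings of vector-valued functions and integrals\<close>

lemma H_simple_inner:
  assumes S: "H_simple \<Omega> \<Gamma> S" and Y: "Y \<in> H_space \<Omega> \<Gamma>"
  shows "(\<lambda>t. H_inner \<tau> \<Omega> \<Gamma> (S t) Y) = (\<lambda>t. \<Sum>Z\<in>range S. H_inner \<tau> \<Omega> \<Gamma> Z Y * indicator (S -` {Z}) t)"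
proof
  fix t
  have "(\<Sum>Z\<in>range S. H_inner \<tau> \<Omega> \<Gamma> Z Y * indicator (S -` {Z}) t)
      = (\<Sum>Z\<in>range S. if Z = S t then H_inner \<tau> \<Omega> \<Gamma> Z Y else 0)"
    by (intro sum.cong) (auto simp: indicator_def)
  also have "\<dots> = H_inner \<tau> \<Omega> \<Gamma> (S t) Y"
    using S by (subst sum.delta) (auto simp: H_simple_def)
  finally show "H_inner \<tau> \<Omega> \<Gamma> (S t) Y = (\<Sum>Z\<in>range S. H_inner \<tau> \<Omega> \<Gamma> Z Y * indicator (S -` {Z}) t)" ..
qed

lemma H_simple_inner_measurable:
  assumes S: "H_simple \<Omega> \<Gamma> S" and Y: "Y \<in> H_space \<Omega> \<Gamma>"
  shows "(\<lambda>t. H_inner \<tau> \<Omega> \<Gamma> (S t) Y) \<in> borel_measurable lebesgue"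
  unfolding H_simple_inner[OF assms]
  using S by (intro borel_measurable_sum borel_measurable_times borel_measurable_indicator) (auto simp: H_simple_def)

lemma H_space_sum_scale:
  assumes "finite R" "R \<subseteq> H_space \<Omega> \<Gamma>"
  shows "(\<Sum>Z\<in>R. H_scale (c Z) Z) \<in> H_space \<Omega> \<Gamma>"
  using assms by (induction R rule: finite_induct) (auto intro: H_space_zero H_space_add H_space_scale)

lemma H_inner_sum_scale:
  assumes "finite R" "R \<subseteq> H_space \<Omega> \<Gamma>" and Y: "Y \<in> H_space \<Omega> \<Gamma>"
  shows "H_inner \<tau> \<Omega> \<Gamma> (\<Sum>Z\<in>R. H_scale (c Z) Z) Y = (\<Sum>Z\<in>R. c Z * H_inner \<tau> \<Omega> \<Gamma> Z Y)"
  using assms(1,2)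
proof (induction R rule: finite_induct)
  case empty
  show ?case by (simp add: H_inner_def)
next
  case (insert Z R)
  then show ?case
    by (simp add: H_inner_add_left H_space_scale H_space_sum_scale Y H_inner_scale_left)
qed

lemma lmeasurable_Ioo: "{a<..<b::real} \<in> lmeasurable"
  using lmeasurable_box[of a b] by simp

lemma H_simple_inner_integral:
  assumes S: "H_simple \<Omega> \<Gamma> S" and Y: "Y \<in> H_space \<Omega> \<Gamma>"
  shows "integrable (lebesgue_on {0<..<T}) (\<lambda>t. H_inner \<tau> \<Omega> \<Gamma> (S t) Y)"
    and "(\<integral>t. H_inner \<tau> \<Omega> \<Gamma> (S t) Y \<partial>lebesgue_on {0<..<T}) = H_inner \<tau> \<Omega> \<Gamma> (H_simple_integral T S) Y"
    and "H_simple_integral T S \<in> H_space \<Omega> \<Gamma>"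
proof -
  have fin: "finite (range S)" "range S \<subseteq> H_space \<Omega> \<Gamma>" and meas: "\<And>Z. S -` {Z} \<in> sets lebesgue"
    using S by (auto simp: H_simple_def)
  let ?M = "lebesgue_on {0<..<T}"
  interpret finite_measure ?M
    by (rule finite_measure_lebesgue_on[OF lmeasurable_Ioo])
  have sets: "S -` {Z} \<inter> {0<..<T} \<in> sets ?M" for Z
    unfolding sets_restrict_space by (rule image_eqI[OF Int_commute meas])
  have ind: "integrable ?M (indicat_real (S -` {Z}))" "(\<integral>t. indicat_real (S -` {Z}) t \<partial>?M) = measure lebesgue (S -` {Z} \<inter> {0<..<T})" for Z
  proof -
    have eq: "indicat_real (S -` {Z}) t = indicat_real (S -` {Z} \<inter> {0<..<T}) t" if "t \<in> space ?M" for t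
      using that by (auto simp: space_restrict_space indicator_def)
    have "integrable ?M (indicat_real (S -` {Z} \<inter> {0<..<T}))"
      using sets[of Z] by (intro integrable_real_indicator) (auto simp: less_top[symmetric])
    then show "integrable ?M (indicat_real (S -` {Z}))"
      using Bochner_Integration.integrable_cong[of ?M ?M "indicat_real (S -` {Z})" "indicat_real (S -` {Z} \<inter> {0<..<T})"] eq
      by simp
    have "(\<integral>t. indicat_real (S -` {Z}) t \<partial>?M) = (\<integral>t. indicat_real (S -` {Z} \<inter> {0<..<T}) t \<partial>?M)"
      by (rule Bochner_Integration.integral_cong[OF refl eq])
    also have "\<dots> = measure ?M (S -` {Z} \<inter> {0<..<T})"
      using sets[of Z] sets.sets_into_space[OF sets[of Z]] by (simp add: Int_absorb2)
    also have "\<dots> = measure lebesgue (S -` {Z} \<inter> {0<..<T})"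
      by (subst measure_restrict_space) auto
    finally show "(\<integral>t. indicat_real (S -` {Z}) t \<partial>?M) = measure lebesgue (S -` {Z} \<inter> {0<..<T})" .
  qed
  show "integrable ?M (\<lambda>t. H_inner \<tau> \<Omega> \<Gamma> (S t) Y)"
    unfolding H_simple_inner[OF assms] using ind by auto
  show "H_simple_integral T S \<in> H_space \<Omega> \<Gamma>"
    unfolding H_simple_integral_def by (rule H_space_sum_scale[OF fin])
  have "(\<integral>t. H_inner \<tau> \<Omega> \<Gamma> (S t) Y \<partial>?M) = (\<Sum>Z\<in>range S. H_inner \<tau> \<Omega> \<Gamma> Z Y * measure lebesgue (S -` {Z} \<inter> {0<..<T}))"
    unfolding H_simple_inner[OF assms] using ind by (subst Bochner_Integration.integral_sum) auto
  then show "(\<integral>t. H_inner \<tau> \<Omega> \<Gamma> (S t) Y \<partial>?M) = H_inner \<tau> \<Omega> \<Gamma> (H_simple_integral T S) Y"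
    unfolding H_simple_integral_def by (simp add: H_inner_sum_scale[OF fin Y] mult.commute)
qed

lemma H_inner_tendsto:
  assumes "0 \<le> \<tau>" and Y: "Y \<in> H_space \<Omega> \<Gamma>" and X: "X \<in> H_space \<Omega> \<Gamma>"
    and Z: "\<And>n. Z n \<in> H_space \<Omega> \<Gamma>" and lim: "((\<lambda>n. H_norm \<Omega> \<Gamma> (Z n - X)) \<longlongrightarrow> 0) F"
  shows "((\<lambda>n. H_inner \<tau> \<Omega> \<Gamma> (Z n) Y) \<longlongrightarrow> H_inner \<tau> \<Omega> \<Gamma> X Y) F"
proof (rule LIM_zero_cancel, rule Lim_null_comparison)
  show "((\<lambda>n. (1 + \<tau>) * (H_norm \<Omega> \<Gamma> (Z n - X) * H_norm \<Omega> \<Gamma> Y)) \<longlongrightarrow> 0) F"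
    using tendsto_mult_right[OF tendsto_mult_left[OF lim], of "1 + \<tau>" "H_norm \<Omega> \<Gamma> Y"] by (simp add: mult.assoc)
  show "\<forall>\<^sub>F n in F. norm (H_inner \<tau> \<Omega> \<Gamma> (Z n) Y - H_inner \<tau> \<Omega> \<Gamma> X Y) \<le> (1 + \<tau>) * (H_norm \<Omega> \<Gamma> (Z n - X) * H_norm \<Omega> \<Gamma> Y)"
    using H_inner_bound[OF \<open>0 \<le> \<tau>\<close> H_space_diff[OF Z X] Y] by (simp add: H_inner_diff_left Z X Y)
qed

text \<open>The pairing is an almost everywhere limit of measurable scalar functions, and Lebesgue
  measure is complete.\<close>

lemma H_strongly_measurable_inner:
  assumes "0 \<le> \<tau>" and F: "H_strongly_measurable \<Omega> \<Gamma> T F" and Y: "Y \<in> H_space \<Omega> \<Gamma>"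
  shows "(\<lambda>t. H_inner \<tau> \<Omega> \<Gamma> (F t) Y) \<in> borel_measurable (lebesgue_on {0<..<T})"
proof -
  obtain S where S: "\<And>n::nat. H_simple \<Omega> \<Gamma> (S n)"
    and ae: "AE t in lebesgue_on {0<..<T}. (\<lambda>n. H_norm \<Omega> \<Gamma> (S n t - F t)) \<longlonglongrightarrow> 0"
    and FH: "\<And>t. t \<in> {0<..<T} \<Longrightarrow> F t \<in> H_space \<Omega> \<Gamma>"
    using F unfolding H_strongly_measurable_def by blast
  have SH: "S n t \<in> H_space \<Omega> \<Gamma>" for n t using S by (auto simp: H_simple_def)
  \<comment> \<open>The cutoff makes the sequence converge almost everywhere on the whole line,
    outside the interval trivially, so the completeness of \<open>lebesgue\<close> can be used
    there.\<close>
  let ?k = "\<lambda>n t. indicator {0<..<T} t * H_inner \<tau> \<Omega> \<Gamma> (S n t) Y"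
  have "(\<lambda>t. lim (\<lambda>n. ?k n t)) \<in> borel_measurable lebesgue"
    by (intro borel_measurable_lim_metric borel_measurable_times borel_measurable_indicator H_simple_inner_measurable S Y) auto
  moreover have "AE t in lebesgue. t \<in> {0<..<T} \<longrightarrow> (\<lambda>n. H_norm \<Omega> \<Gamma> (S n t - F t)) \<longlonglongrightarrow> 0"
    using ae by (subst (asm) AE_restrict_space_iff) auto
  then have "AE t in lebesgue. lim (\<lambda>n. ?k n t) = indicator {0<..<T} t * H_inner \<tau> \<Omega> \<Gamma> (F t) Y"
  proof eventually_elim
    case (elim t)
    show ?case
    proof (cases "t \<in> {0<..<T}")
      case True
      then have "(\<lambda>n. H_inner \<tau> \<Omega> \<Gamma> (S n t) Y) \<longlonglongrightarrow> H_inner \<tau> \<Omega> \<Gamma> (F t) Y"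
        using elim by (intro H_inner_tendsto \<open>0 \<le> \<tau>\<close> Y SH FH) auto
      then show ?thesis using True by (simp add: limI)
    qed (auto intro!: limI)
  qed
  ultimately have "(\<lambda>t. indicator {0<..<T} t * H_inner \<tau> \<Omega> \<Gamma> (F t) Y) \<in> borel_measurable lebesgue"
    by (rule borel_measurable_AE)
  then show ?thesis
    by (subst borel_measurable_restrict_space_iff) auto
qed

text \<open>\<open>nn_integral_cmult\<close> does not apply to the norms in \<open>H_has_integral\<close>, whose measurability
  is not known.\<close>

lemma nn_integral_cmult_le:
  assumes "0 \<le> c"
  shows "(\<integral>\<^sup>+x. ennreal c * f x \<partial>M) \<le> ennreal c * (\<integral>\<^sup>+x. f x \<partial>M)"
proof (cases "c = 0")
  case False
  then have c: "0 < c" using assms by simp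
  have inv: "ennreal c * (ennreal (1 / c) * x) = x" "ennreal (1 / c) * (ennreal c * x) = x" for x
    using c by (simp_all add: mult.assoc[symmetric] flip: ennreal_mult)
  show ?thesis
    unfolding nn_integral_def[of M "\<lambda>x. ennreal c * f x"]
  proof (rule SUP_least, clarify)
    fix g assume g: "simple_function M g" "g \<le> (\<lambda>x. ennreal c * f x)"
    have "integral\<^sup>S M g = (\<integral>\<^sup>+x. ennreal c * (ennreal (1 / c) * g x) \<partial>M)"
      unfolding inv by (rule nn_integral_eq_simple_integral[OF g(1), symmetric])
    also have "\<dots> = ennreal c * (\<integral>\<^sup>+x. ennreal (1 / c) * g x \<partial>M)"
      using g(1) by (intro nn_integral_cmult borel_measurable_times_ennreal borel_measurable_const borel_measurable_simple_function)
    also have "\<dots> \<le> ennreal c * (\<integral>\<^sup>+x. f x \<partial>M)"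
    proof (intro mult_left_mono nn_integral_mono)
      fix x
      have "ennreal (1 / c) * g x \<le> ennreal (1 / c) * (ennreal c * f x)"
        using g(2) by (intro mult_left_mono) (auto simp: le_fun_def)
      then show "ennreal (1 / c) * g x \<le> f x" unfolding inv .
    qed simp
    finally show "integral\<^sup>S M g \<le> ennreal c * (\<integral>\<^sup>+x. f x \<partial>M)" .
  qed
qed simp

text \<open>Pairing with a fixed Y commutes with the integral. The weak derivative identity in
  \<open>H_space\<close> thereby becomes a family of scalar identities, the only form in which it is
  used.\<close>

lemma H_has_integral_inner:
  assumes "0 \<le> \<tau>" and F: "H_has_integral \<Omega> \<Gamma> T F X" and Y: "Y \<in> H_space \<Omega> \<Gamma>"
  shows "H_inner \<tau> \<Omega> \<Gamma> X Y = (\<integral>t. H_inner \<tau> \<Omega> \<Gamma> (F t) Y \<partial>lebesgue_on {0<..<T})"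
proof -
  let ?M = "lebesgue_on {0<..<T}" and ?i = "\<lambda>X. H_inner \<tau> \<Omega> \<Gamma> X Y"
  obtain S where S: "\<And>n::nat. H_simple \<Omega> \<Gamma> (S n)"
    and L1: "(\<lambda>n. \<integral>\<^sup>+t. ennreal (H_norm \<Omega> \<Gamma> (S n t - F t)) \<partial>?M) \<longlonglongrightarrow> 0"
    and lim: "(\<lambda>n. H_norm \<Omega> \<Gamma> (H_simple_integral T (S n) - X)) \<longlonglongrightarrow> 0"
    and X: "X \<in> H_space \<Omega> \<Gamma>" and sm: "H_strongly_measurable \<Omega> \<Gamma> T F"
    using F unfolding H_has_integral_def by blast
  have FH: "F t \<in> H_space \<Omega> \<Gamma>" if "t \<in> {0<..<T}" for t
    using sm that by (simp add: H_strongly_measurable_def)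
  have SH: "S n t \<in> H_space \<Omega> \<Gamma>" for n t using S by (auto simp: H_simple_def)
  have m: "(\<lambda>t. ?i (F t)) \<in> borel_measurable ?M"
    by (rule H_strongly_measurable_inner[OF \<open>0 \<le> \<tau>\<close> sm Y])
  note Si = H_simple_inner_integral[OF S Y]
  have Sint: "integrable ?M (\<lambda>t. ?i (S n t))" for n by (rule Si(1))
  define C where "C = (1 + \<tau>) * H_norm \<Omega> \<Gamma> Y"
  have C: "0 \<le> C" using \<open>0 \<le> \<tau>\<close> by (simp add: C_def)
  have bound: "(\<integral>\<^sup>+t. norm (?i (S n t) - ?i (F t)) \<partial>?M) \<le> ennreal C * (\<integral>\<^sup>+t. ennreal (H_norm \<Omega> \<Gamma> (S n t - F t)) \<partial>?M)" for n
  proof -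
    have "(\<integral>\<^sup>+t. norm (?i (S n t) - ?i (F t)) \<partial>?M) \<le> (\<integral>\<^sup>+t. ennreal C * ennreal (H_norm \<Omega> \<Gamma> (S n t - F t)) \<partial>?M)"
    proof (rule nn_integral_mono)
      fix t assume "t \<in> space ?M"
      then have t: "t \<in> {0<..<T}" by (simp add: space_restrict_space)
      have "\<bar>?i (S n t - F t)\<bar> \<le> C * H_norm \<Omega> \<Gamma> (S n t - F t)"
        using H_inner_bound[OF \<open>0 \<le> \<tau>\<close> H_space_diff[OF SH FH[OF t]] Y] by (simp add: C_def algebra_simps)
      then show "ennreal (norm (?i (S n t) - ?i (F t))) \<le> ennreal C * ennreal (H_norm \<Omega> \<Gamma> (S n t - F t))"
        using C by (simp add: H_inner_diff_left SH FH[OF t] Y flip: ennreal_mult)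
    qed
    also have "\<dots> \<le> ennreal C * (\<integral>\<^sup>+t. ennreal (H_norm \<Omega> \<Gamma> (S n t - F t)) \<partial>?M)"
      by (rule nn_integral_cmult_le[OF C])
    finally show ?thesis .
  qed
  have lim0: "(\<lambda>n. \<integral>\<^sup>+t. norm (?i (S n t) - ?i (F t)) \<partial>?M) \<longlonglongrightarrow> 0"
  proof (rule tendsto_sandwich[OF _ _ tendsto_const])
    show "(\<lambda>n. ennreal C * (\<integral>\<^sup>+t. ennreal (H_norm \<Omega> \<Gamma> (S n t - F t)) \<partial>?M)) \<longlonglongrightarrow> 0"
      using ennreal_tendsto_cmult[OF _ L1, of "ennreal C"] by simp
  qed (use bound in auto)
  \<comment> \<open>One integrable simple pairing at finite L1 distance is enough.\<close>
  have int: "integrable ?M (\<lambda>t. ?i (F t))"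
  proof -
    have "\<forall>\<^sub>F n in sequentially. (\<integral>\<^sup>+t. norm (?i (S n t) - ?i (F t)) \<partial>?M) < 1"
      by (rule order_tendstoD(2)[OF lim0]) simp
    then obtain n where n: "(\<integral>\<^sup>+t. norm (?i (S n t) - ?i (F t)) \<partial>?M) < 1"
      by (auto simp: eventually_sequentially)
    have "integrable ?M (\<lambda>t. ?i (S n t) - ?i (F t))"
      using m Sint[of n] n by (intro integrableI_bounded) (auto intro: less_trans[of _ 1] simp: less_top[symmetric])
    from Bochner_Integration.integrable_diff[OF Sint[of n] this] show ?thesis by simp
  qed
  have "(\<lambda>n. \<integral>t. ?i (S n t) \<partial>?M) \<longlonglongrightarrow> (\<integral>t. ?i (F t) \<partial>?M)"
    by (rule tendsto_L1_int[OF Sint int lim0])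
  moreover have "(\<lambda>n. \<integral>t. ?i (S n t) \<partial>?M) \<longlonglongrightarrow> ?i X"
    unfolding Si(2) by (rule H_inner_tendsto[OF \<open>0 \<le> \<tau>\<close> Y X Si(3) lim])
  ultimately show ?thesis by (rule LIMSEQ_unique[symmetric])
qed

text \<open>\<open>L2_time\<close> asserts integrability of the squared norm; measurability of the
  norm is recovered by the square root, and its integrability from x \<le> 1 + x^2 on a bounded
  interval.\<close>

lemma L2_time_norm_integrable:
  assumes "L2_time \<Omega> \<Gamma> T G"
  shows "integrable (lebesgue_on {0<..<T}) (\<lambda>t. H_norm \<Omega> \<Gamma> (G t))"
proof -
  let ?M = "lebesgue_on {0<..<T}"
  have sq: "integrable ?M (\<lambda>t. (H_norm \<Omega> \<Gamma> (G t))\<^sup>2)" using assms by (simp add: L2_time_def)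
  interpret finite_measure ?M
    by (rule finite_measure_lebesgue_on[OF lmeasurable_Ioo])
  have "(\<lambda>t. sqrt ((H_norm \<Omega> \<Gamma> (G t))\<^sup>2)) \<in> borel_measurable ?M"
    by (rule measurable_compose[OF borel_measurable_integrable[OF sq]
          borel_measurable_continuous_onI[OF continuous_on_real_sqrt[OF continuous_on_id]]])
  then have m: "(\<lambda>t. H_norm \<Omega> \<Gamma> (G t)) \<in> borel_measurable ?M" by simp
  show ?thesis
  proof (rule Bochner_Integration.integrable_bound[OF _ m])
    show "integrable ?M (\<lambda>t. 1 + (H_norm \<Omega> \<Gamma> (G t))\<^sup>2)" using sq by auto
    have "x \<le> 1 + x\<^sup>2" for x :: real
      using zero_le_power2[of "x - 1/2"] by (simp add: power2_eq_square algebra_simps)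
    then show "AE t in ?M. norm (H_norm \<Omega> \<Gamma> (G t)) \<le> norm (1 + (H_norm \<Omega> \<Gamma> (G t))\<^sup>2)"
      by (intro AE_I2) auto
  qed
qed

text \<open>The fundamental theorem for the scalar function r \<mapsto> (U(r), Y) with Y frozen,
  deduced from the weak derivative identity and the continuity of U.\<close>

lemma W12_inner_diff:
  assumes "0 \<le> \<tau>" and W: "W12_loc_with_derivative \<Omega> \<Gamma> U G" and Y: "Y \<in> H_space \<Omega> \<Gamma>"
    and st: "0 < s" "s < t" "t < T"
  shows "integrable (lebesgue_on {0<..<T}) (\<lambda>r. H_inner \<tau> \<Omega> \<Gamma> (G r) Y)"
    and "H_inner \<tau> \<Omega> \<Gamma> (U t - U s) Y = (\<integral>r. indicat_real {s<..t} r * H_inner \<tau> \<Omega> \<Gamma> (G r) Y \<partial>lebesgue_on {0<..<T})"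
proof -
  let ?M = "lebesgue_on {0<..<T}" and ?i = "\<lambda>X. H_inner \<tau> \<Omega> \<Gamma> X Y"
  have T: "0 < T" using st by simp
  have G: "L2_time \<Omega> \<Gamma> T G" and wd: "weak_time_derivative \<Omega> \<Gamma> T U G"
    and UH: "\<And>t. 0 \<le> t \<Longrightarrow> U t \<in> H_space \<Omega> \<Gamma>"
    and cont: "\<And>t. 0 \<le> t \<Longrightarrow> ((\<lambda>s. H_norm \<Omega> \<Gamma> (U s - U t)) \<longlongrightarrow> 0) (at t within {0..})"
    using W T unfolding W12_loc_with_derivative_def by auto
  have sm: "H_strongly_measurable \<Omega> \<Gamma> T G" using G by (simp add: L2_time_def)
  have GH: "G r \<in> H_space \<Omega> \<Gamma>" if "r \<in> {0<..<T}" for r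
    using sm that by (simp add: H_strongly_measurable_def)
  show int: "integrable ?M (\<lambda>r. ?i (G r))"
  proof (rule Bochner_Integration.integrable_bound[OF _ H_strongly_measurable_inner[OF \<open>0 \<le> \<tau>\<close> sm Y]])
    show "integrable ?M (\<lambda>r. (1 + \<tau>) * (H_norm \<Omega> \<Gamma> (G r) * H_norm \<Omega> \<Gamma> Y))"
      using L2_time_norm_integrable[OF G] by auto
    show "AE r in ?M. norm (?i (G r)) \<le> norm ((1 + \<tau>) * (H_norm \<Omega> \<Gamma> (G r) * H_norm \<Omega> \<Gamma> Y))"
    proof (rule AE_I2)
      fix r assume "r \<in> space ?M"
      then have "G r \<in> H_space \<Omega> \<Gamma>" by (intro GH) (simp add: space_restrict_space)
      from H_inner_bound[OF \<open>0 \<le> \<tau>\<close> this Y]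
      show "norm (?i (G r)) \<le> norm ((1 + \<tau>) * (H_norm \<Omega> \<Gamma> (G r) * H_norm \<Omega> \<Gamma> Y))"
        using \<open>0 \<le> \<tau>\<close> by (simp add: abs_mult)
    qed
  qed
  have fc: "continuous_on {0..T} (\<lambda>r. ?i (U r))"
    unfolding continuous_on
  proof
    fix r assume r: "r \<in> {0..T}"
    \<comment> \<open>\<open>H_inner_tendsto\<close> requires every term to lie in
      \<open>H_space\<close>, but U is controlled at nonnegative times only; the modification agrees
      with U there.\<close>
    let ?V = "\<lambda>q. if 0 \<le> q then U q else U r"
    have "((\<lambda>q. H_norm \<Omega> \<Gamma> (U q - U r)) \<longlongrightarrow> 0) (at r within {0..T})"
      using cont[of r] r by (auto intro: tendsto_within_subset)
    then have "((\<lambda>q. H_norm \<Omega> \<Gamma> (?V q - U r)) \<longlongrightarrow> 0) (at r within {0..T})"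
      by (rule Lim_transform_eventually) (auto simp: eventually_at_filter)
    then have "((\<lambda>q. ?i (?V q)) \<longlongrightarrow> ?i (U r)) (at r within {0..T})"
      using r by (intro H_inner_tendsto \<open>0 \<le> \<tau>\<close> Y) (auto intro: UH)
    then show "((\<lambda>q. ?i (U q)) \<longlongrightarrow> ?i (U r)) (at r within {0..T})"
      by (rule Lim_transform_eventually) (auto simp: eventually_at_filter)
  qed
  have "?i (U t) - ?i (U s) = (\<integral>r. indicat_real {s<..t} r * ?i (G r) \<partial>?M)"
  proof (rule weak_derivative_imp_integral[OF st fc int])
    fix \<phi> :: "real \<Rightarrow> real"
    assume "\<phi> C1_differentiable_on UNIV" "\<exists>K. compact K \<and> K \<subseteq> {0<..<T} \<and> (\<forall>t. t \<notin> K \<longrightarrow> \<phi> t = 0)"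
    then obtain X where X: "H_has_integral \<Omega> \<Gamma> T (\<lambda>t. H_scale (deriv \<phi> t) (U t)) X"
      "H_has_integral \<Omega> \<Gamma> T (\<lambda>t. H_scale (\<phi> t) (G t)) (- X)"
      using wd unfolding weak_time_derivative_def by blast
    show "(\<integral>x. deriv \<phi> x * ?i (U x) \<partial>?M) = - (\<integral>x. \<phi> x * ?i (G x) \<partial>?M)"
      using H_has_integral_inner[OF \<open>0 \<le> \<tau>\<close> X(1) Y] H_has_integral_inner[OF \<open>0 \<le> \<tau>\<close> X(2) Y]
      by (simp add: H_inner_scale_left H_inner_uminus_left)
  qed
  then show "?i (U t - U s) = (\<integral>r. indicat_real {s<..t} r * ?i (G r) \<partial>?M)"
    using st by (simp add: H_inner_diff_left UH Y)
qed

section \<open>Decay of the positive part of the difference of two solutions\<close>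

lemma nonincreasing_of_local:
  fixes f :: "real \<Rightarrow> real"
  assumes "a \<le> b" "0 < d" and loc: "\<And>s t. a \<le> s \<Longrightarrow> s < t \<Longrightarrow> t \<le> b \<Longrightarrow> t - s < d \<Longrightarrow> f t \<le> f s"
  shows "f b \<le> f a"
proof (cases "a = b")
  case False
  \<comment> \<open>So many equal steps are shorter than \<open>d\<close>, and the local inequality
    can be chained along them.\<close>
  obtain n where n: "(b - a) / d < real n" using reals_Archimedean2 by blast
  have "0 < n" using n assms False by (cases n) (auto simp: divide_less_0_iff field_simps)
  define q where "q = (b - a) / real n"
  define p where "p i = a + real i * q" for i
  have step: "p (Suc i) - p i = q" for i
    by (simp add: p_def distrib_right)
  have small: "0 < q" "q < d" and nq: "real n * q = b - a"
    using n \<open>0 < n\<close> \<open>0 < d\<close> assms(1) False by (auto simp: q_def field_simps)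
  have "i \<le> n \<Longrightarrow> f (p i) \<le> f a" for i
  proof (induction i)
    case (Suc i)
    have "real (Suc i) * q \<le> real n * q"
      using Suc small by (intro mult_right_mono) auto
    then have "p (Suc i) \<le> b" using nq by (simp add: p_def)
    then have "f (p (Suc i)) \<le> f (p i)"
      using step[of i] small by (intro loc) (auto simp: p_def)
    with Suc show ?case by simp
  qed (simp add: p_def)
  from this[of n] show ?thesis using nq by (simp add: p_def)
qed simp

text \<open>Continuity is expressed by a seminorm on representatives, so compactness of
  \<open>{a..b}\<close> is used directly, through a Lebesgue number of the cover by balls on which U
  varies by less than e / 2 from its value at the centre.\<close>

lemma W12_uniformly_continuous:
  assumes W: "W12_loc_with_derivative \<Omega> \<Gamma> U G" and "0 \<le> a" "0 < e"
  shows "\<exists>d>0. \<forall>s\<in>{a..b}. \<forall>t\<in>{a..b}. \<bar>s - t\<bar> < d \<longrightarrow> H_norm \<Omega> \<Gamma> (U s - U t) < e"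
proof -
  have UH: "\<And>t. 0 \<le> t \<Longrightarrow> U t \<in> H_space \<Omega> \<Gamma>"
    and cont: "\<And>t. 0 \<le> t \<Longrightarrow> ((\<lambda>s. H_norm \<Omega> \<Gamma> (U s - U t)) \<longlongrightarrow> 0) (at t within {0..})"
    using W unfolding W12_loc_with_derivative_def by auto
  have "\<exists>d>0. \<forall>s\<ge>0. \<bar>s - t\<bar> < d \<longrightarrow> H_norm \<Omega> \<Gamma> (U s - U t) < e / 2" if t: "t \<in> {a..b}" for t
  proof -
    have "0 \<le> t" using t \<open>0 \<le> a\<close> by simp
    from tendstoD[OF cont[OF this], of "e/2"] \<open>0 < e\<close>
    obtain d where d: "0 < d" "\<And>s. 0 \<le> s \<Longrightarrow> s \<noteq> t \<Longrightarrow> \<bar>s - t\<bar> < d \<Longrightarrow> H_norm \<Omega> \<Gamma> (U s - U t) < e / 2"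
      by (auto simp: eventually_at dist_real_def)
    have "H_norm \<Omega> \<Gamma> (U t - U t) = 0" by (simp add: H_norm_def H_inner_def)
    then show ?thesis using d \<open>0 < e\<close> by (intro exI[of _ d]) (metis half_gt_zero)
  qed
  then obtain \<delta> where \<delta>: "\<And>t. t \<in> {a..b} \<Longrightarrow> 0 < \<delta> t"
    "\<And>t s. t \<in> {a..b} \<Longrightarrow> 0 \<le> s \<Longrightarrow> \<bar>s - t\<bar> < \<delta> t \<Longrightarrow> H_norm \<Omega> \<Gamma> (U s - U t) < e / 2"
    by metis
  obtain d where d: "0 < d" "\<And>x. x \<in> {a..b} \<Longrightarrow> \<exists>B\<in>(\<lambda>t. ball t (\<delta> t)) ` {a..b}. ball x d \<subseteq> B"
  proof (rule Heine_Borel_lemma[of "{a..b}" "(\<lambda>t. ball t (\<delta> t)) ` {a..b}"])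
    show "{a..b} \<subseteq> \<Union> ((\<lambda>t. ball t (\<delta> t)) ` {a..b})" using \<delta>(1) by fastforce
  qed auto
  show ?thesis
  proof (intro exI[of _ d] conjI ballI impI)
    fix s t assume s: "s \<in> {a..b}" and t: "t \<in> {a..b}" and st: "\<bar>s - t\<bar> < d"
    obtain c where c: "c \<in> {a..b}" "ball s d \<subseteq> ball c (\<delta> c)" using d(2)[OF s] by blast
    have "s \<in> ball s d" "t \<in> ball s d" using d(1) st by (auto simp: dist_real_def)
    then have "s \<in> ball c (\<delta> c)" "t \<in> ball c (\<delta> c)" using c(2) by blast+
    then have "\<bar>s - c\<bar> < \<delta> c" "\<bar>t - c\<bar> < \<delta> c" by (auto simp: dist_real_def)
    then have "H_norm \<Omega> \<Gamma> (U s - U c) < e / 2" "H_norm \<Omega> \<Gamma> (U t - U c) < e / 2"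
      using \<delta>(2)[OF c(1)] s t \<open>0 \<le> a\<close> by auto
    moreover have "H_norm \<Omega> \<Gamma> ((U s - U c) - (U t - U c)) \<le> H_norm \<Omega> \<Gamma> (U s - U c) + H_norm \<Omega> \<Gamma> (U t - U c)"
      using s t c \<open>0 \<le> a\<close> by (intro H_norm_diff_triangle H_space_diff UH) auto
    moreover have "(U s - U c) - (U t - U c) = U s - U t" by simp
    ultimately show "H_norm \<Omega> \<Gamma> (U s - U t) < e" by simp
  qed fact
qed

text \<open>On a short interval \<open>{s<..t}\<close> convexity bounds the increment by the integral of
  \<open>(G1 r - G2 r, W(t)\<^sup>+)\<^sub>\<tau>\<close> with \<open>W = U1 - U2\<close>; replacing \<open>W(t)\<^sup>+\<close> by \<open>W(r)\<^sup>+\<close> makes it nonpositive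
  at a cost that vanishes with the length of the interval. This avoids a chain rule for
  vector-valued absolutely continuous functions.\<close>

lemma W12_diff_pos_square_nonincreasing:
  assumes "0 < \<tau>" and W1: "W12_loc_with_derivative \<Omega> \<Gamma> U1 G1" and W2: "W12_loc_with_derivative \<Omega> \<Gamma> U2 G2"
    and diss: "AE t in lebesgue. 0 < t \<longrightarrow> H_inner \<tau> \<Omega> \<Gamma> (G1 t - G2 t) (H_pos (U1 t - U2 t)) \<le> 0"
    and ab: "0 < a" "a < b"
  shows "H_inner \<tau> \<Omega> \<Gamma> (H_pos (U1 b - U2 b)) (H_pos (U1 b - U2 b))
    \<le> H_inner \<tau> \<Omega> \<Gamma> (H_pos (U1 a - U2 a)) (H_pos (U1 a - U2 a))"
proof -
  define W where "W t = U1 t - U2 t" for t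
  \<comment> \<open>\<open>W12_inner_diff\<close> takes its endpoints strictly inside
    \<open>{0<..<T}\<close>; this T serves all subintervals of \<open>{a..b}\<close>.\<close>
  define T where "T = b + 1"
  let ?M = "lebesgue_on {0<..<T}"
  let ?\<Phi> = "\<lambda>t. H_inner \<tau> \<Omega> \<Gamma> (H_pos (W t)) (H_pos (W t)) / 2"
  have T: "0 < T" "b < T" using ab by (auto simp: T_def)
  have \<tau>: "0 \<le> \<tau>" using \<open>0 < \<tau>\<close> by simp
  have UH: "U1 t \<in> H_space \<Omega> \<Gamma>" "U2 t \<in> H_space \<Omega> \<Gamma>" if "0 \<le> t" for t
    using W1 W2 that unfolding W12_loc_with_derivative_def by auto
  then have WH: "W t \<in> H_space \<Omega> \<Gamma>" if "0 \<le> t" for t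
    using that unfolding W_def by (intro H_space_diff)
  have L2: "L2_time \<Omega> \<Gamma> T G1" "L2_time \<Omega> \<Gamma> T G2"
    using W1 W2 T unfolding W12_loc_with_derivative_def by auto
  have GH: "G1 t \<in> H_space \<Omega> \<Gamma>" "G2 t \<in> H_space \<Omega> \<Gamma>" if "t \<in> {0<..<T}" for t
    using L2 that unfolding L2_time_def H_strongly_measurable_def by auto
  define g where "g t = (1 + \<tau>) * (H_norm \<Omega> \<Gamma> (G1 t) + H_norm \<Omega> \<Gamma> (G2 t))" for t
  have g: "integrable ?M g" unfolding g_def[abs_def]
    using L2_time_norm_integrable[OF L2(1)] L2_time_norm_integrable[OF L2(2)] by auto
  have g0: "0 \<le> g t" for t using \<tau> by (simp add: g_def)
  \<comment> \<open>A budget for the errors, additive over adjacent intervals: once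
    \<open>e * J\<close> is subtracted, the local estimates can be chained by
    \<open>nonincreasing_of_local\<close>.\<close>
  define J where "J t = (\<integral>r. indicat_real {a<..t} r * g r \<partial>?M)" for t
  have ind: "integrable ?M (\<lambda>r. indicat_real {s<..t} r * f r)" if "integrable ?M f" for s t f
  proof -
    have "{s<..t} \<inter> {0<..<T} \<in> sets ?M"
      unfolding sets_restrict_space Int_commute[of "{s<..t}"] by (rule imageI) simp
    then have "integrable ?M (\<lambda>r. indicat_real ({s<..t} \<inter> {0<..<T}) r *\<^sub>R f r)"
      by (rule integrable_mult_indicator[OF _ that])
    then show ?thesis
      by (subst Bochner_Integration.integrable_cong[OF refl, of _ _ "\<lambda>r. indicat_real ({s<..t} \<inter> {0<..<T}) r *\<^sub>R f r"])
         (auto simp: space_restrict_space indicator_def)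
  qed
  have diss': "AE r in ?M. H_inner \<tau> \<Omega> \<Gamma> (G1 r - G2 r) (H_pos (W r)) \<le> 0"
    using diss unfolding W_def by (subst AE_restrict_space_iff) (auto elim!: eventually_mono)
  have main: "?\<Phi> b - ?\<Phi> a \<le> e * J b" if "0 < e" for e
  proof -
    obtain d1 where d1: "0 < d1" "\<And>s t. s \<in> {a..b} \<Longrightarrow> t \<in> {a..b} \<Longrightarrow> \<bar>s - t\<bar> < d1 \<Longrightarrow> H_norm \<Omega> \<Gamma> (U1 s - U1 t) < e / 2"
      using W12_uniformly_continuous[OF W1, of a "e/2" b] ab \<open>0 < e\<close> by auto
    obtain d2 where d2: "0 < d2" "\<And>s t. s \<in> {a..b} \<Longrightarrow> t \<in> {a..b} \<Longrightarrow> \<bar>s - t\<bar> < d2 \<Longrightarrow> H_norm \<Omega> \<Gamma> (U2 s - U2 t) < e / 2"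
      using W12_uniformly_continuous[OF W2, of a "e/2" b] ab \<open>0 < e\<close> by auto
    have near: "H_norm \<Omega> \<Gamma> (W s - W t) \<le> e" if "s \<in> {a..b}" "t \<in> {a..b}" "\<bar>s - t\<bar> < min d1 d2" for s t
    proof -
      have "W s - W t = (U1 s - U1 t) - (U2 s - U2 t)" by (simp add: W_def)
      also have "H_norm \<Omega> \<Gamma> \<dots> \<le> H_norm \<Omega> \<Gamma> (U1 s - U1 t) + H_norm \<Omega> \<Gamma> (U2 s - U2 t)"
        using that ab by (intro H_norm_diff_triangle H_space_diff UH) auto
      also have "\<dots> \<le> e" using d1(2)[of s t] d2(2)[of s t] that by auto
      finally show ?thesis .
    qed
    have "?\<Phi> b - e * J b \<le> ?\<Phi> a - e * J a"
    proof (rule nonincreasing_of_local[of a b "min d1 d2"])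
      fix s t assume st: "a \<le> s" "s < t" "t \<le> b" "t - s < min d1 d2"
      let ?Y = "H_pos (W t)"
      have Y: "?Y \<in> H_space \<Omega> \<Gamma>" using st ab by (intro H_space_pos WH) auto
      have s0: "0 < s" "t < T" using st ab T by auto
      note D1 = W12_inner_diff[OF \<tau> W1 Y s0(1) st(2) s0(2)] and D2 = W12_inner_diff[OF \<tau> W2 Y s0(1) st(2) s0(2)]
      have "?\<Phi> t - ?\<Phi> s \<le> H_inner \<tau> \<Omega> \<Gamma> (W t - W s) ?Y"
        using st ab by (intro H_pos_square_convex \<tau> WH) auto
      also have "W t - W s = (U1 t - U1 s) - (U2 t - U2 s)" by (simp add: W_def)
      also have "H_inner \<tau> \<Omega> \<Gamma> \<dots> ?Y = H_inner \<tau> \<Omega> \<Gamma> (U1 t - U1 s) ?Y - H_inner \<tau> \<Omega> \<Gamma> (U2 t - U2 s) ?Y"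
        using st ab by (intro H_inner_diff_left H_space_diff UH Y) auto
      also have "\<dots> = (\<integral>r. indicat_real {s<..t} r * H_inner \<tau> \<Omega> \<Gamma> (G1 r) ?Y - indicat_real {s<..t} r * H_inner \<tau> \<Omega> \<Gamma> (G2 r) ?Y \<partial>?M)"
        unfolding D1(2) D2(2) by (intro Bochner_Integration.integral_diff[symmetric] ind D1 D2)
      also have "\<dots> \<le> (\<integral>r. indicat_real {s<..t} r * (e * g r) \<partial>?M)"
      proof (rule integral_mono_AE)
        show "integrable ?M (\<lambda>r. indicat_real {s<..t} r * H_inner \<tau> \<Omega> \<Gamma> (G1 r) ?Y - indicat_real {s<..t} r * H_inner \<tau> \<Omega> \<Gamma> (G2 r) ?Y)"
          by (intro Bochner_Integration.integrable_diff ind D1 D2)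
        show "integrable ?M (\<lambda>r. indicat_real {s<..t} r * (e * g r))"
          using g by (intro ind) auto
        show "AE r in ?M. indicat_real {s<..t} r * H_inner \<tau> \<Omega> \<Gamma> (G1 r) ?Y - indicat_real {s<..t} r * H_inner \<tau> \<Omega> \<Gamma> (G2 r) ?Y
            \<le> indicat_real {s<..t} r * (e * g r)"
          using diss' AE_space[of ?M]
        proof eventually_elim
          case (elim r)
          then have r: "r \<in> {0<..<T}" by (simp add: space_restrict_space)
          show ?case
          proof (cases "r \<in> {s<..t}")
            case True
            have Wr: "W r \<in> H_space \<Omega> \<Gamma>" "W t \<in> H_space \<Omega> \<Gamma>" using r st ab by (auto intro: WH)
            note PH = H_space_pos[OF Wr(1)]
            note G = GH[OF r] and GD = H_space_diff[OF GH[OF r]]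
            have "H_inner \<tau> \<Omega> \<Gamma> (G1 r) ?Y - H_inner \<tau> \<Omega> \<Gamma> (G2 r) ?Y = H_inner \<tau> \<Omega> \<Gamma> (G1 r - G2 r) ?Y"
              by (simp add: H_inner_diff_left G Y)
            also have "\<dots> = H_inner \<tau> \<Omega> \<Gamma> (G1 r - G2 r) (H_pos (W r)) + H_inner \<tau> \<Omega> \<Gamma> (G1 r - G2 r) (?Y - H_pos (W r))"
              by (simp add: H_inner_diff_right GD Y PH)
            also have "\<dots> \<le> 0 + (1 + \<tau>) * (H_norm \<Omega> \<Gamma> (G1 r - G2 r) * H_norm \<Omega> \<Gamma> (?Y - H_pos (W r)))"
              by (intro add_mono elim(1) order_trans[OF abs_ge_self H_inner_bound] \<tau> GD H_space_diff Y PH)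
            also have "\<dots> \<le> 0 + (1 + \<tau>) * ((H_norm \<Omega> \<Gamma> (G1 r) + H_norm \<Omega> \<Gamma> (G2 r)) * e)"
            proof -
              have "H_norm \<Omega> \<Gamma> (?Y - H_pos (W r)) \<le> H_norm \<Omega> \<Gamma> (W t - W r)"
                by (rule H_norm_pos_diff_le[OF Wr(2,1)])
              also have "\<dots> \<le> e" using True st by (intro near) auto
              finally show ?thesis
                using H_norm_diff_triangle[OF G] \<tau> by (intro add_left_mono mult_left_mono mult_mono) auto
            qed
            finally show ?thesis using True by (simp add: g_def algebra_simps)
          qed simp
        qed
      qed
      also have "\<dots> = e * (J t - J s)"
      proof -
        have "J t - J s = (\<integral>r. indicat_real {a<..t} r * g r - indicat_real {a<..s} r * g r \<partial>?M)"
          unfolding J_def by (intro Bochner_Integration.integral_diff[symmetric] ind g)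
        also have "\<dots> = (\<integral>r. indicat_real {s<..t} r * g r \<partial>?M)"
          using st by (intro Bochner_Integration.integral_cong) (auto simp: indicator_def)
        finally show ?thesis by (simp add: mult.left_commute)
      qed
      finally show "?\<Phi> t - e * J t \<le> ?\<Phi> s - e * J s" by (simp add: algebra_simps)
    qed (use ab d1 d2 in auto)
    moreover have "J a = 0" by (simp add: J_def)
    ultimately show ?thesis by simp
  qed
  have "?\<Phi> b - ?\<Phi> a \<le> 0"
  proof (rule field_le_epsilon)
    fix e :: real assume "0 < e"
    have J: "0 \<le> J b" unfolding J_def by (intro Bochner_Integration.integral_nonneg) (auto simp: g0)
    have "e / (J b + 1) * J b \<le> e" using J \<open>0 < e\<close> by (simp add: field_simps)
    then show "?\<Phi> b - ?\<Phi> a \<le> 0 + e" using main[of "e / (J b + 1)"] J \<open>0 < e\<close> by simp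
  qed
  then show ?thesis by (simp add: W_def)
qed

text \<open>Submodularity makes the dissipation nonpositive almost everywhere, but the monotonicity
  lemma starts from positive times. The value at t is therefore compared with values at s, which
  tend to 0 as s decreases to 0.\<close>

lemma gradient_flow_comparison:
  assumes "0 < \<tau>"
    and sub: "\<And>U1 U2. E U1 < \<infinity> \<Longrightarrow> E U2 < \<infinity> \<Longrightarrow>
      E (U1 - H_pos (U1 - U2)) + E (U2 + H_pos (U1 - U2)) \<le> E U1 + E U2"
    and U1: "gradient_flow_solution \<tau> \<Omega> \<Gamma> E U10 U1" and U2: "gradient_flow_solution \<tau> \<Omega> \<Gamma> E U20 U2"
    and le: "H_le \<Omega> \<Gamma> U10 U20" and "0 < t"
  shows "H_le \<Omega> \<Gamma> (U1 t) (U2 t)"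
proof -
  obtain G1 where W1: "W12_loc_with_derivative \<Omega> \<Gamma> U1 G1"
    and f1: "AE t in lebesgue. t > 0 \<longrightarrow> - G1 t \<in> H_subdifferential \<tau> \<Omega> \<Gamma> E (U1 t)" and i1: "H_eq \<Omega> \<Gamma> (U1 0) U10"
    using U1 unfolding gradient_flow_solution_def by blast
  obtain G2 where W2: "W12_loc_with_derivative \<Omega> \<Gamma> U2 G2"
    and f2: "AE t in lebesgue. t > 0 \<longrightarrow> - G2 t \<in> H_subdifferential \<tau> \<Omega> \<Gamma> E (U2 t)" and i2: "H_eq \<Omega> \<Gamma> (U2 0) U20"
    using U2 unfolding gradient_flow_solution_def by blast
  have UH: "U1 t \<in> H_space \<Omega> \<Gamma>" "U2 t \<in> H_space \<Omega> \<Gamma>" if "0 \<le> t" for t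
    using W1 W2 that unfolding W12_loc_with_derivative_def by auto
  have cont: "((\<lambda>s. H_norm \<Omega> \<Gamma> (U1 s - U1 0)) \<longlongrightarrow> 0) (at 0 within {0..})"
    "((\<lambda>s. H_norm \<Omega> \<Gamma> (U2 s - U2 0)) \<longlongrightarrow> 0) (at 0 within {0..})"
    using W1 W2 unfolding W12_loc_with_derivative_def by auto
  have diss: "AE t in lebesgue. 0 < t \<longrightarrow> H_inner \<tau> \<Omega> \<Gamma> (G1 t - G2 t) (H_pos (U1 t - U2 t)) \<le> 0"
    using f1 f2
  proof eventually_elim
    case (elim t)
    show ?case
    proof
      assume "0 < t"
      then have \<xi>: "- G1 t \<in> H_subdifferential \<tau> \<Omega> \<Gamma> E (U1 t)" "- G2 t \<in> H_subdifferential \<tau> \<Omega> \<Gamma> E (U2 t)"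
        and H: "U1 t \<in> H_space \<Omega> \<Gamma>" "U2 t \<in> H_space \<Omega> \<Gamma>" using elim UH by auto
      have fin: "E (U1 t) < \<infinity>" "E (U2 t) < \<infinity>" using \<xi> by (auto simp: H_subdifferential_def)
      have "0 \<le> H_inner \<tau> \<Omega> \<Gamma> (- G1 t - - G2 t) (H_pos (U1 t - U2 t))"
        by (rule H_subdifferential_T_monotone[OF sub[OF fin] H \<xi>])
      moreover have "- G1 t - - G2 t = - (G1 t - G2 t)" by simp
      ultimately show "H_inner \<tau> \<Omega> \<Gamma> (G1 t - G2 t) (H_pos (U1 t - U2 t)) \<le> 0"
        by (simp only: H_inner_uminus_left)
    qed
  qed
  let ?\<Phi> = "\<lambda>t. H_inner \<tau> \<Omega> \<Gamma> (H_pos (U1 t - U2 t)) (H_pos (U1 t - U2 t))"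
  let ?b = "\<lambda>s. (1 + \<tau>) * (H_norm \<Omega> \<Gamma> (U1 s - U1 0) + H_norm \<Omega> \<Gamma> (U2 s - U2 0))\<^sup>2"
  have init: "?\<Phi> s \<le> ?b s" if "0 \<le> s" for s
  proof -
    have le0: "AE x in lebesgue_on \<Omega>. fst (U1 0) x \<le> fst (U2 0) x" "AE x in surface_on \<Gamma>. snd (U1 0) x \<le> snd (U2 0) x"
      using i1 i2 le unfolding H_eq_def H_le_def by (auto elim: eventually_elim2 eventually_rev_mp)
    \<comment> \<open>Since U1(0) - U2(0) \<le> 0 almost everywhere, subtracting it from U1(s) -
      U2(s) can only raise the value, so the positive part is bounded by the change since time
      0.\<close>
    have "H_norm \<Omega> \<Gamma> (H_pos (U1 s - U2 s)) \<le> H_norm \<Omega> \<Gamma> ((U1 s - U1 0) - (U2 s - U2 0))"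
    proof (rule H_norm_mono)
      show "AE x in lebesgue_on \<Omega>. \<bar>fst (H_pos (U1 s - U2 s)) x\<bar> \<le> \<bar>fst ((U1 s - U1 0) - (U2 s - U2 0)) x\<bar>"
        using le0(1) by eventually_elim (auto simp: H_pos_def)
      show "AE x in surface_on \<Gamma>. \<bar>snd (H_pos (U1 s - U2 s)) x\<bar> \<le> \<bar>snd ((U1 s - U1 0) - (U2 s - U2 0)) x\<bar>"
        using le0(2) by eventually_elim (auto simp: H_pos_def)
    qed (use that in \<open>auto intro!: H_space_pos H_space_diff UH\<close>)
    also have "\<dots> \<le> H_norm \<Omega> \<Gamma> (U1 s - U1 0) + H_norm \<Omega> \<Gamma> (U2 s - U2 0)"
      using that by (intro H_norm_diff_triangle H_space_diff UH) auto
    finally have "(1 + \<tau>) * (H_norm \<Omega> \<Gamma> (H_pos (U1 s - U2 s)))\<^sup>2 \<le> ?b s"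
      using \<open>0 < \<tau>\<close> by (intro mult_left_mono power_mono) auto
    then show ?thesis
      by (rule order_trans[OF H_inner_self_le[OF less_imp_le[OF \<open>0 < \<tau>\<close>]]])
  qed
  have "(?b \<longlongrightarrow> (1 + \<tau>) * (0 + 0)\<^sup>2) (at 0 within {0..})"
    by (intro tendsto_intros cont)
  then have "(?b \<longlongrightarrow> (1 + \<tau>) * (0 + 0)\<^sup>2) (at_right 0)"
    by (rule tendsto_mono[rotated]) (intro at_le, auto)
  then have lim: "(?b \<longlongrightarrow> 0) (at_right 0)" by simp
  have "?\<Phi> t \<le> 0"
  proof (rule tendsto_lowerbound[OF lim])
    show "\<forall>\<^sub>F s in at_right 0. ?\<Phi> t \<le> ?b s"
      unfolding eventually_at_right_field
    proof (intro exI[of _ t] conjI allI impI)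
      fix s assume "0 < s" "s < t"
      then show "?\<Phi> t \<le> ?b s"
        using W12_diff_pos_square_nonincreasing[OF \<open>0 < \<tau>\<close> W1 W2 diss, of s t] init[of s] by simp
    qed fact
  qed simp
  then show ?thesis
    using \<open>0 < t\<close> by (intro H_le_if_H_pos_le_0[OF _ _ \<open>0 < \<tau>\<close>] UH) auto
qed

theorem theorem4p5:
  fixes \<Omega> \<Gamma> :: "(real ^ 'n) set"
    and \<gamma> :: "(real ^ 'n \<Rightarrow> real) \<Rightarrow> real ^ 'n \<Rightarrow> real"
    and \<tau> :: real
    and u1 v1 u2 v2 :: "real \<Rightarrow> real ^ 'n \<Rightarrow> real"
    and u10 v10 u20 v20 :: "real ^ 'n \<Rightarrow> real"
  assumes "bounded_domain \<Omega>"
    and "1 < CARD('n) \<Longrightarrow> C1_boundary \<Omega>"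
    and "\<Gamma> \<subseteq> frontier \<Omega>"
    and "\<Gamma> \<in> sets (hausdorff_measure (CARD('n) - 1))"
    and "0 < emeasure (hausdorff_measure (CARD('n) - 1)) \<Gamma>"
    and "BV_trace_operator \<Omega> \<gamma>"
    and "0 < \<tau>"
    and "(u10, v10) \<in> H_space \<Omega> \<Gamma>"
    and "(u20, v20) \<in> H_space \<Omega> \<Gamma>"
    and "gradient_flow_solution \<tau> \<Omega> \<Gamma> (energy \<Omega> \<Gamma> \<gamma>) (u10, v10) (\<lambda>t. (u1 t, v1 t))"
    and "gradient_flow_solution \<tau> \<Omega> \<Gamma> (energy \<Omega> \<Gamma> \<gamma>) (u20, v20) (\<lambda>t. (u2 t, v2 t))"
    and "H_le \<Omega> \<Gamma> (u10, v10) (u20, v20)"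
  shows "\<forall>t>0. H_le \<Omega> \<Gamma> (u1 t, v1 t) (u2 t, v2 t)"
proof (intro allI impI)
  fix t :: real assume "0 < t"
  have \<Omega>: "open \<Omega>" "bounded \<Omega>" "connected \<Omega>" "\<Omega> \<noteq> {}"
    using assms(1) by (auto simp: bounded_domain_def)
  have fat: "fat_at \<Omega> x" if x: "x \<in> frontier \<Omega>" for x
  \<comment> \<open>The graph condition on the boundary is assumed only above dimension one; in
    dimension one connectedness gives convexity instead.\<close>
  proof (cases "1 < CARD('n)")
    case True
    then show ?thesis by (intro fat_at_C1_boundary \<Omega> assms(2) x)
  next
    case False
    then have "CARD('n) = 1"
      using zero_less_card_finite[where 'a='n] by linarith
    then have "DIM(real ^ 'n) = 1" by simp
    then have "convex \<Omega>" using \<Omega>(3) by (simp add: connected_convex_1_gen)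
    then show ?thesis using x by (intro fat_at_convex \<Omega>) (auto simp: frontier_def)
  qed
  have \<Gamma>: "\<Gamma> \<in> sets (hausdorff_measure (DIM(real ^ 'n) - 1))" using assms(4) by simp
  from gradient_flow_comparison[OF assms(7) energy_submodular[OF \<Omega>(1,2) fat assms(3) \<Gamma> assms(6)] assms(10-12) \<open>0 < t\<close>]
  show "H_le \<Omega> \<Gamma> (u1 t, v1 t) (u2 t, v2 t)" by blast
qed

end
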